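(* Let $K$ be a field, let $L$ be a Lie algebra over $K$ having a cohomologically nontrivial finite-dimensional module $M$ such that either $LM=M$ or $M$ does not contain a trivial submodule, and let $A$ be an associative commutative algebra with unit over $K$ having an infinite set $\mathcal V$ of pairwise non-isomorphic unital modules of a fixed finite dimension. Then in each of the following cases: (i) $\dim \operatorname{Hom}_L(M,M)=1$; (ii) for any two non-isomorphic modules $V_1,V_2\in\mathcal V$, $\dim \operatorname{Hom}_A(V_1,V_2)\le 1$; the Lie algebra $L\otimes A$ has an infinite number of cohomologically nontrivial pairwise non-isomorphic modules of a fixed finite dimension.
   Context: All tensor products are over $K$. For a Lie algebra $L$ and an associative commutative algebra $A$, the current Lie algebra $L\otimes A$ has the bracket $[x\otimes a,y\otimes b]=[x,y]\otimes ab$. $\operatorname{H}^n(L,M)$ denotes Chevalley--Eilenberg cohomology of the Lie algebra $L$ with coefficients in the $L$-module $M$. An $L$-module $M$ is called cohomologically nontrivial if $\operatorname{H}^n(L,M)\neq 0$ for some $n$. $LM$ denotes the linear span of all $x\bullet m$, $x\in L$, $m\in M$, where $\bullet$ is the module action. A trivial submodule means a nonzero submodule on which $L$ acts by zero. $\operatorname{Hom}_L$ and $\operatorname{Hom}_A$ denote the spaces of homomorphisms of $L$-modules and of $A$-modules, respectively, and $\dim$ is dimension over $K$. *)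

theory Defs
  imports "HOL-Algebra.AbelCoset" "Jordan_Normal_Form.Missing_VectorSpace"
begin

hide_const (open) Multiset.mult

text \<open>
  Vector spaces, spans, submodules and module homomorphisms are those of the \<open>VectorSpace\<close> entry,
  on top of the records of HOL-Algebra.  The fields \<open>mult\<close> and \<open>one\<close> of a record
  used only as a module carry no meaning; as in \<open>func_space\<close> they are filled with a
  default value.
\<close>

text \<open>\<open>vectorspace.dim\<close> is a natural number also for spaces that are not
  finite-dimensional, so finiteness has to be required separately.\<close>

definition has_dimension ::
    "('k, 'x) ring_scheme \<Rightarrow> ('k, 'v, 'y) module_scheme \<Rightarrow> nat \<Rightarrow> bool" where
  "has_dimension K V d \<longleftrightarrow> vectorspace.fin_dim K V \<and> vectorspace.dim K V = d"

text \<open>Functions defined on \<open>D\<close> with values in \<open>N\<close> are taken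
  extensional, so that they are determined by their values on \<open>D\<close>.\<close>

definition function_module ::
    "'d set \<Rightarrow> ('k, 'v, 'y) module_scheme \<Rightarrow> ('d \<Rightarrow> 'v) set \<Rightarrow> ('k, 'd \<Rightarrow> 'v) module" where
  "function_module D N F =
    \<lparr>carrier = F \<inter> extensional D,
     mult = (\<lambda>f g. \<lambda>x\<in>D. \<zero>\<^bsub>N\<^esub>),
     one = (\<lambda>x\<in>D. \<zero>\<^bsub>N\<^esub>),
     zero = (\<lambda>x\<in>D. \<zero>\<^bsub>N\<^esub>),
     add = (\<lambda>f g. \<lambda>x\<in>D. f x \<oplus>\<^bsub>N\<^esub> g x),
     smult = (\<lambda>c f. \<lambda>x\<in>D. c \<odot>\<^bsub>N\<^esub> f x)\<rparr>"

definition quotient_module ::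
    "('k, 'v, 'y) module_scheme \<Rightarrow> 'v set \<Rightarrow> ('k, 'v set) module" where
  "quotient_module V U =
    \<lparr>carrier = a_rcosets\<^bsub>V\<^esub> U,
     mult = (\<lambda>X Y. U),
     one = U,
     zero = U,
     add = (\<lambda>X Y. X <+>\<^bsub>V\<^esub> Y),
     smult = (\<lambda>c X. \<Union>x\<in>X. U +>\<^bsub>V\<^esub> (c \<odot>\<^bsub>V\<^esub> x))\<rparr>"

definition support :: "('k, 'x) ring_scheme \<Rightarrow> 's set \<Rightarrow> ('s \<Rightarrow> 'k) \<Rightarrow> 's set" where
  "support K S f = {s \<in> S. f s \<noteq> \<zero>\<^bsub>K\<^esub>}"

definition free_module :: "('k, 'x) ring_scheme \<Rightarrow> 's set \<Rightarrow> ('k, 's \<Rightarrow> 'k) module" where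
  "free_module K S =
    (ring.func_space K S)
      \<lparr>carrier := {f \<in> S \<rightarrow>\<^sub>E carrier K. finite (support K S f)}\<rparr>"

definition free_gen :: "('k, 'x) ring_scheme \<Rightarrow> 's set \<Rightarrow> 's \<Rightarrow> 's \<Rightarrow> 'k" where
  "free_gen K S s = (\<lambda>t\<in>S. if t = s then \<one>\<^bsub>K\<^esub> else \<zero>\<^bsub>K\<^esub>)"

definition tensor_relations ::
    "('k, 'x) ring_scheme \<Rightarrow> ('k, 'v, 'y) module_scheme \<Rightarrow> ('k, 'w, 'z) module_scheme
      \<Rightarrow> ('v \<times> 'w \<Rightarrow> 'k) set" where
  "tensor_relations K V W =
    (let S = carrier V \<times> carrier W; F = free_module K S; e = free_gen K S in
     module.span K F
      ({e (v \<oplus>\<^bsub>V\<^esub> v', w) \<ominus>\<^bsub>F\<^esub> (e (v, w) \<oplus>\<^bsub>F\<^esub> e (v', w)) |v v' w.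
          v \<in> carrier V \<and> v' \<in> carrier V \<and> w \<in> carrier W}
       \<union> {e (v, w \<oplus>\<^bsub>W\<^esub> w') \<ominus>\<^bsub>F\<^esub> (e (v, w) \<oplus>\<^bsub>F\<^esub> e (v, w')) |v w w'.
          v \<in> carrier V \<and> w \<in> carrier W \<and> w' \<in> carrier W}
       \<union> {e (c \<odot>\<^bsub>V\<^esub> v, w) \<ominus>\<^bsub>F\<^esub> (c \<odot>\<^bsub>F\<^esub> e (v, w)) |c v w.
          c \<in> carrier K \<and> v \<in> carrier V \<and> w \<in> carrier W}
       \<union> {e (v, c \<odot>\<^bsub>W\<^esub> w) \<ominus>\<^bsub>F\<^esub> (c \<odot>\<^bsub>F\<^esub> e (v, w)) |c v w.
          c \<in> carrier K \<and> v \<in> carrier V \<and> w \<in> carrier W}))"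

definition tensor_product ::
    "('k, 'x) ring_scheme \<Rightarrow> ('k, 'v, 'y) module_scheme \<Rightarrow> ('k, 'w, 'z) module_scheme
      \<Rightarrow> ('k, ('v \<times> 'w \<Rightarrow> 'k) set) module" where
  "tensor_product K V W =
    quotient_module (free_module K (carrier V \<times> carrier W)) (tensor_relations K V W)"

definition pure_tensor ::
    "('k, 'x) ring_scheme \<Rightarrow> ('k, 'v, 'y) module_scheme \<Rightarrow> ('k, 'w, 'z) module_scheme
      \<Rightarrow> 'v \<Rightarrow> 'w \<Rightarrow> ('v \<times> 'w \<Rightarrow> 'k) set" where
  "pure_tensor K V W v w =
    (let S = carrier V \<times> carrier W in
     tensor_relations K V W +>\<^bsub>free_module K S\<^esub> free_gen K S (v, w))"

record ('k, 'l) lie_alg = "('k, 'l) module" +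
  bracket :: "'l \<Rightarrow> 'l \<Rightarrow> 'l"

locale lie_algebra = vectorspace K L
  for K :: "('k, 'x) ring_scheme" and L :: "('k, 'l, 'y) lie_alg_scheme" (structure) +
  assumes bracket_closed:
      "\<lbrakk>x \<in> carrier L; y \<in> carrier L\<rbrakk> \<Longrightarrow> bracket L x y \<in> carrier L"
    and bracket_add_left:
      "\<lbrakk>x \<in> carrier L; y \<in> carrier L; z \<in> carrier L\<rbrakk>
        \<Longrightarrow> bracket L (x \<oplus> y) z = bracket L x z \<oplus> bracket L y z"
    and bracket_add_right:
      "\<lbrakk>x \<in> carrier L; y \<in> carrier L; z \<in> carrier L\<rbrakk>
        \<Longrightarrow> bracket L x (y \<oplus> z) = bracket L x y \<oplus> bracket L x z"
    and bracket_smult_left: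
      "\<lbrakk>c \<in> carrier K; x \<in> carrier L; y \<in> carrier L\<rbrakk>
        \<Longrightarrow> bracket L (c \<odot> x) y = c \<odot> bracket L x y"
    and bracket_smult_right:
      "\<lbrakk>c \<in> carrier K; x \<in> carrier L; y \<in> carrier L\<rbrakk>
        \<Longrightarrow> bracket L x (c \<odot> y) = c \<odot> bracket L x y"
    and bracket_self: "x \<in> carrier L \<Longrightarrow> bracket L x x = \<zero>"
    and jacobi:
      "\<lbrakk>x \<in> carrier L; y \<in> carrier L; z \<in> carrier L\<rbrakk>
        \<Longrightarrow> bracket L x (bracket L y z) \<oplus> bracket L y (bracket L z x)
            \<oplus> bracket L z (bracket L x y) = \<zero>"

record ('k, 'l, 'm) lie_mod = "('k, 'm) module" +
  lie_act :: "'l \<Rightarrow> 'm \<Rightarrow> 'm"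

locale lie_module = L?: lie_algebra K L + M?: vectorspace K M
  for K :: "('k, 'x) ring_scheme" and L :: "('k, 'l, 'y) lie_alg_scheme"
    and M :: "('k, 'l, 'm, 'z) lie_mod_scheme" +
  assumes act_closed:
      "\<lbrakk>x \<in> carrier L; m \<in> carrier M\<rbrakk> \<Longrightarrow> lie_act M x m \<in> carrier M"
    and act_add_left:
      "\<lbrakk>x \<in> carrier L; y \<in> carrier L; m \<in> carrier M\<rbrakk>
        \<Longrightarrow> lie_act M (x \<oplus>\<^bsub>L\<^esub> y) m = lie_act M x m \<oplus>\<^bsub>M\<^esub> lie_act M y m"
    and act_add_right:
      "\<lbrakk>x \<in> carrier L; m \<in> carrier M; n \<in> carrier M\<rbrakk>
        \<Longrightarrow> lie_act M x (m \<oplus>\<^bsub>M\<^esub> n) = lie_act M x m \<oplus>\<^bsub>M\<^esub> lie_act M x n"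
    and act_smult_left:
      "\<lbrakk>c \<in> carrier K; x \<in> carrier L; m \<in> carrier M\<rbrakk>
        \<Longrightarrow> lie_act M (c \<odot>\<^bsub>L\<^esub> x) m = c \<odot>\<^bsub>M\<^esub> lie_act M x m"
    and act_smult_right:
      "\<lbrakk>c \<in> carrier K; x \<in> carrier L; m \<in> carrier M\<rbrakk>
        \<Longrightarrow> lie_act M x (c \<odot>\<^bsub>M\<^esub> m) = c \<odot>\<^bsub>M\<^esub> lie_act M x m"
    and act_bracket:
      "\<lbrakk>x \<in> carrier L; y \<in> carrier L; m \<in> carrier M\<rbrakk>
        \<Longrightarrow> lie_act M (bracket L x y) m
            = lie_act M x (lie_act M y m) \<ominus>\<^bsub>M\<^esub> lie_act M y (lie_act M x m)"

definition lie_image ::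
    "('k, 'x) ring_scheme \<Rightarrow> ('k, 'l, 'y) lie_alg_scheme \<Rightarrow> ('k, 'l, 'm, 'z) lie_mod_scheme
      \<Rightarrow> 'm set" where
  "lie_image K L M =
    module.span K M {lie_act M x m |x m. x \<in> carrier L \<and> m \<in> carrier M}"

definition lie_submodule ::
    "('k, 'x) ring_scheme \<Rightarrow> ('k, 'l, 'y) lie_alg_scheme \<Rightarrow> 'm set
      \<Rightarrow> ('k, 'l, 'm, 'z) lie_mod_scheme \<Rightarrow> bool" where
  "lie_submodule K L N M \<longleftrightarrow>
    submodule K N M \<and> (\<forall>x\<in>carrier L. \<forall>m\<in>N. lie_act M x m \<in> N)"

definition has_trivial_submodule ::
    "('k, 'x) ring_scheme \<Rightarrow> ('k, 'l, 'y) lie_alg_scheme \<Rightarrow> ('k, 'l, 'm, 'z) lie_mod_scheme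
      \<Rightarrow> bool" where
  "has_trivial_submodule K L M \<longleftrightarrow>
    (\<exists>N. lie_submodule K L N M \<and> N \<noteq> {\<zero>\<^bsub>M\<^esub>} \<and>
      (\<forall>x\<in>carrier L. \<forall>m\<in>N. lie_act M x m = \<zero>\<^bsub>M\<^esub>))"

definition lie_module_hom ::
    "('k, 'x) ring_scheme \<Rightarrow> ('k, 'l, 'y) lie_alg_scheme
      \<Rightarrow> ('k, 'l, 'm, 'z) lie_mod_scheme \<Rightarrow> ('k, 'l, 'n, 'w) lie_mod_scheme
      \<Rightarrow> ('m \<Rightarrow> 'n) set" where
  "lie_module_hom K L M N =
    {f \<in> module_hom K M N.
      \<forall>x\<in>carrier L. \<forall>m\<in>carrier M. f (lie_act M x m) = lie_act N x (f m)}"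

definition lie_module_iso ::
    "('k, 'x) ring_scheme \<Rightarrow> ('k, 'l, 'y) lie_alg_scheme
      \<Rightarrow> ('k, 'l, 'm, 'z) lie_mod_scheme \<Rightarrow> ('k, 'l, 'n, 'w) lie_mod_scheme \<Rightarrow> bool" where
  "lie_module_iso K L M N \<longleftrightarrow>
    (\<exists>f\<in>lie_module_hom K L M N. bij_betw f (carrier M) (carrier N))"

definition Hom_L ::
    "('k, 'x) ring_scheme \<Rightarrow> ('k, 'l, 'y) lie_alg_scheme
      \<Rightarrow> ('k, 'l, 'm, 'z) lie_mod_scheme \<Rightarrow> ('k, 'l, 'n, 'w) lie_mod_scheme
      \<Rightarrow> ('k, 'm \<Rightarrow> 'n) module" where
  "Hom_L K L M N = function_module (carrier M) N (lie_module_hom K L M N)"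

text \<open>An \<open>A\<close>-module in HOL-Algebra is unital; it becomes a vector space over the ground
  field through \<open>c \<mapsto> c \<cdot> 1\<close>.\<close>

definition restrict_scalars ::
    "('k, 'a, 'x) module_scheme \<Rightarrow> ('a, 'v, 'y) module_scheme \<Rightarrow> ('k, 'v) module" where
  "restrict_scalars A V =
    \<lparr>carrier = carrier V, mult = mult V, one = one V, zero = zero V, add = add V,
     smult = (\<lambda>c v. (c \<odot>\<^bsub>A\<^esub> \<one>\<^bsub>A\<^esub>) \<odot>\<^bsub>V\<^esub> v)\<rparr>"

definition module_iso ::
    "('a, 'x) ring_scheme \<Rightarrow> ('a, 'v, 'y) module_scheme \<Rightarrow> ('a, 'w, 'z) module_scheme
      \<Rightarrow> bool" where
  "module_iso A V W \<longleftrightarrow> (\<exists>f\<in>module_hom A V W. bij_betw f (carrier V) (carrier W))"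

definition Hom_A ::
    "('k, 'a, 'x) module_scheme \<Rightarrow> ('a, 'v, 'y) module_scheme \<Rightarrow> ('a, 'w, 'z) module_scheme
      \<Rightarrow> ('k, 'v \<Rightarrow> 'w) module" where
  "Hom_A A V W = function_module (carrier V) (restrict_scalars A W) (module_hom A V W)"

text \<open>The bilinear extension of \<open>[x \<otimes> a, y \<otimes> b] = [x, y] \<otimes> ab\<close>: every
  representative \<open>f\<close> of an element of the tensor product expresses it as the sum of the
  \<open>f (x, a) \<cdot> (x \<otimes> a)\<close> over the support of \<open>f\<close>.  The resulting coset does
  not depend on the representatives, so the union is a single coset.\<close>

definition current_bracket ::
    "('k, 'x) ring_scheme \<Rightarrow> ('k, 'l, 'y) lie_alg_scheme \<Rightarrow> ('k, 'a, 'z) module_scheme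
      \<Rightarrow> ('l \<times> 'a \<Rightarrow> 'k) set \<Rightarrow> ('l \<times> 'a \<Rightarrow> 'k) set \<Rightarrow> ('l \<times> 'a \<Rightarrow> 'k) set" where
  "current_bracket K L A X Y =
    (let S = carrier L \<times> carrier A; T = tensor_product K L A in
     \<Union>f\<in>X. \<Union>g\<in>Y.
       \<Oplus>\<^bsub>T\<^esub>p\<in>support K S f. \<Oplus>\<^bsub>T\<^esub>q\<in>support K S g.
         (f p \<otimes>\<^bsub>K\<^esub> g q) \<odot>\<^bsub>T\<^esub>
           pure_tensor K L A (bracket L (fst p) (fst q)) (snd p \<otimes>\<^bsub>A\<^esub> snd q))"

definition current_algebra ::
    "('k, 'x) ring_scheme \<Rightarrow> ('k, 'l, 'y) lie_alg_scheme \<Rightarrow> ('k, 'a, 'z) module_scheme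
      \<Rightarrow> ('k, ('l \<times> 'a \<Rightarrow> 'k) set) lie_alg" where
  "current_algebra K L A =
    module.extend (tensor_product K L A) \<lparr>bracket = current_bracket K L A\<rparr>"

definition tuples :: "('l, 'x) partial_object_scheme \<Rightarrow> nat \<Rightarrow> 'l list set" where
  "tuples L n = {xs. set xs \<subseteq> carrier L \<and> length xs = n}"

definition alternating_maps ::
    "('k, 'x) ring_scheme \<Rightarrow> ('k, 'l, 'y) lie_alg_scheme \<Rightarrow> ('k, 'l, 'm, 'z) lie_mod_scheme
      \<Rightarrow> nat \<Rightarrow> ('l list \<Rightarrow> 'm) set" where
  "alternating_maps K L M n =
    {f \<in> tuples L n \<rightarrow> carrier M.
      (\<forall>xs\<in>tuples L n. \<forall>i<n. (\<lambda>x. f (xs[i := x])) \<in> module_hom K L M) \<and>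
      (\<forall>xs\<in>tuples L n. \<not> distinct xs \<longrightarrow> f xs = \<zero>\<^bsub>M\<^esub>)}"

definition cochains ::
    "('k, 'x) ring_scheme \<Rightarrow> ('k, 'l, 'y) lie_alg_scheme \<Rightarrow> ('k, 'l, 'm, 'z) lie_mod_scheme
      \<Rightarrow> nat \<Rightarrow> ('k, 'l list \<Rightarrow> 'm) module" where
  "cochains K L M n = function_module (tuples L n) M (alternating_maps K L M n)"

text \<open>\<open>nths xs (- {i})\<close> and \<open>nths xs (- {i, j})\<close> are \<open>xs\<close> with the
  entries at the given positions omitted.  Positions are counted from 0, so the first sum carries
  the sign \<open>(-1)^i\<close> and the second \<open>(-1)^(i + j)\<close>.\<close>

definition coboundary ::
    "('k, 'x) ring_scheme \<Rightarrow> ('k, 'l, 'y) lie_alg_scheme \<Rightarrow> ('k, 'l, 'm, 'z) lie_mod_scheme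
      \<Rightarrow> nat \<Rightarrow> ('l list \<Rightarrow> 'm) \<Rightarrow> ('l list \<Rightarrow> 'm)" where
  "coboundary K L M n f =
    (\<lambda>xs\<in>tuples L (Suc n).
      (\<Oplus>\<^bsub>M\<^esub>i\<in>{..n}.
        ((\<ominus>\<^bsub>K\<^esub> \<one>\<^bsub>K\<^esub>) [^]\<^bsub>K\<^esub> i) \<odot>\<^bsub>M\<^esub> lie_act M (xs ! i) (f (nths xs (- {i}))))
      \<oplus>\<^bsub>M\<^esub>
      (\<Oplus>\<^bsub>M\<^esub>j\<in>{..n}. \<Oplus>\<^bsub>M\<^esub>i\<in>{..<j}.
        ((\<ominus>\<^bsub>K\<^esub> \<one>\<^bsub>K\<^esub>) [^]\<^bsub>K\<^esub> (i + j)) \<odot>\<^bsub>M\<^esub>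
          f (bracket L (xs ! i) (xs ! j) # nths xs (- {i, j}))))"

definition cocycles ::
    "('k, 'x) ring_scheme \<Rightarrow> ('k, 'l, 'y) lie_alg_scheme \<Rightarrow> ('k, 'l, 'm, 'z) lie_mod_scheme
      \<Rightarrow> nat \<Rightarrow> ('l list \<Rightarrow> 'm) set" where
  "cocycles K L M n =
    {f \<in> carrier (cochains K L M n). coboundary K L M n f = \<zero>\<^bsub>cochains K L M (Suc n)\<^esub>}"

definition coboundaries ::
    "('k, 'x) ring_scheme \<Rightarrow> ('k, 'l, 'y) lie_alg_scheme \<Rightarrow> ('k, 'l, 'm, 'z) lie_mod_scheme
      \<Rightarrow> nat \<Rightarrow> ('l list \<Rightarrow> 'm) set" where
  "coboundaries K L M n =
    (case n of
       0 \<Rightarrow> {\<zero>\<^bsub>cochains K L M 0\<^esub>}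
     | Suc k \<Rightarrow> coboundary K L M k ` carrier (cochains K L M k))"

definition cohomology ::
    "('k, 'x) ring_scheme \<Rightarrow> ('k, 'l, 'y) lie_alg_scheme \<Rightarrow> ('k, 'l, 'm, 'z) lie_mod_scheme
      \<Rightarrow> nat \<Rightarrow> ('k, ('l list \<Rightarrow> 'm) set) module" where
  "cohomology K L M n =
    quotient_module ((cochains K L M n)\<lparr>carrier := cocycles K L M n\<rparr>) (coboundaries K L M n)"

definition cohomologically_nontrivial ::
    "('k, 'x) ring_scheme \<Rightarrow> ('k, 'l, 'y) lie_alg_scheme \<Rightarrow> ('k, 'l, 'm, 'z) lie_mod_scheme
      \<Rightarrow> bool" where
  "cohomologically_nontrivial K L M \<longleftrightarrow>
    (\<exists>n. carrier (cohomology K L M n) \<noteq> {\<zero>\<^bsub>cohomology K L M n\<^esub>})"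

end

theory Submission
  imports Defs
begin

text \<open>
  Fix \<open>V\<close> in \<open>\<V>\<close>.  The tensor product \<open>M \<otimes> V\<close> is a module over the
  current algebra \<open>L \<otimes> A\<close> through \<open>(x \<otimes> a) \<bullet> (m \<otimes> v) = (x \<bullet> m) \<otimes> a v\<close>, and
  its dimension is \<open>dim M\<close> times \<open>d\<close> (\<open>current_lie_algebra\<close>, \<open>N_lie_module\<close>,
  \<open>tensor_dimension\<close>).  The infinitely many modules are these tensor products: their
  cohomology does not vanish, and they determine \<open>V\<close> up to isomorphism.

  Nonvanishing (\<open>tensor_nontrivial\<close>).  Let \<open>f\<close> be a cocycle of \<open>L\<close> in \<open>M\<close>
  that is not a coboundary, and let \<open>v\<close> be a nonzero vector of \<open>V\<close>.  Since \<open>A\<close> is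
  commutative, the formula
  \<open>G (x\<^sub>1 \<otimes> a\<^sub>1, \<dots>, x\<^sub>n \<otimes> a\<^sub>n) = f (x\<^sub>1, \<dots>, x\<^sub>n) \<otimes> a\<^sub>1 \<dots> a\<^sub>n v\<close> defines
  an alternating map, and every term of its coboundary carries the product of all the \<open>a\<^sub>i\<close>, so
  that \<open>G\<close> is a cocycle of \<open>L \<otimes> A\<close> (\<open>tensor_cocycle_exists\<close>).  If \<open>g\<close> is a
  linear form on \<open>V\<close> with \<open>g v = 1\<close>, then restriction along \<open>x \<mapsto> x \<otimes> 1\<close> followed by
  \<open>id \<otimes> g\<close> maps coboundaries to coboundaries and \<open>G\<close> to \<open>f\<close>, so \<open>G\<close> is no
  coboundary.

  Isomorphic tensor products have isomorphic factors (\<open>factors_isomorphic\<close>).  Let \<open>F\<close> be an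
  isomorphism from \<open>M \<otimes> V\<close> to \<open>M \<otimes> W\<close>.  For \<open>a\<close> in \<open>A\<close> the difference of
  \<open>F \<circ> (id \<otimes> a)\<close> and \<open>(id \<otimes> a) \<circ> F\<close> vanishes on \<open>L M \<otimes> V\<close>, and its values are
  annihilated by \<open>L \<otimes> 1\<close>.  So it is zero if \<open>L M = M\<close>, and also if \<open>M\<close> has no trivial
  submodule (\<open>F_scale\<close>).  Consequently, for every linear form \<open>f\<close> on \<open>M\<close>, every linear
  form \<open>g\<close> on \<open>W\<close>, every \<open>m\<close> and every \<open>v\<close>, the map
  \<open>v \<mapsto> (f \<otimes> id) (F (m \<otimes> v))\<close> is an \<open>A\<close>-homomorphism from \<open>V\<close> to \<open>W\<close>, and
  \<open>m \<mapsto> (id \<otimes> g) (F (m \<otimes> v))\<close> is an \<open>L\<close>-endomorphism of \<open>M\<close>.  Suppose that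
  \<open>V\<close> and \<open>W\<close> are not isomorphic.  As their dimensions agree, every \<open>A\<close>-homomorphism
  from \<open>V\<close> to \<open>W\<close> has a nonzero kernel.  Fix a nonzero \<open>m\<close>.

  In case (ii) all \<open>A\<close>-homomorphisms are multiples of one of them, so they vanish at a common
  nonzero \<open>v\<close>; then \<open>(f \<otimes> id) (F (m \<otimes> v)) = 0\<close> for all \<open>f\<close>, hence
  \<open>F (m \<otimes> v) = 0\<close>.  In case (i) let \<open>f m = 1\<close> and let \<open>v\<close> be a nonzero vector with
  \<open>(f \<otimes> id) (F (m \<otimes> v)) = 0\<close>.  Every \<open>L\<close>-endomorphism of \<open>M\<close> is a scalar, so
  \<open>(id \<otimes> g) (F (m \<otimes> v)) = c m\<close>, and an application of \<open>f\<close> gives \<open>c = 0\<close>; this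
  holds for all \<open>g\<close>, hence again \<open>F (m \<otimes> v) = 0\<close>.  Both contradict injectivity, because
  \<open>m \<otimes> v\<close> is not zero.

  The tensor products are cosets of formal sums of pairs.  They are handled through their universal
  property (\<open>tensor_lift_hom\<close>, \<open>tensor_lift_pure\<close>) and the fact that sums of pure tensors
  exhaust them (\<open>tensor_induct\<close>).  In the end they are transported to spaces of sequences of
  scalars along injective coordinates (\<open>copy_module\<close>).
\<close>

section \<open>Linear maps\<close>

lemma (in abelian_group) eq_minusI:
  assumes "p \<oplus>\<^bsub>G\<^esub> r = q" "p \<in> carrier G" "r \<in> carrier G"
  shows "p = q \<ominus>\<^bsub>G\<^esub> r"
  unfolding assms(1)[symmetric] using assms(2,3) by (simp add: minus_eq a_assoc r_neg)

lemma module_homI: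
  assumes "\<And>x. x \<in> carrier V \<Longrightarrow> f x \<in> carrier W"
    and "\<And>x y. x \<in> carrier V \<Longrightarrow> y \<in> carrier V \<Longrightarrow> f (x \<oplus>\<^bsub>V\<^esub> y) = f x \<oplus>\<^bsub>W\<^esub> f y"
    and "\<And>c x. c \<in> carrier K \<Longrightarrow> x \<in> carrier V \<Longrightarrow> f (c \<odot>\<^bsub>V\<^esub> x) = c \<odot>\<^bsub>W\<^esub> f x"
  shows "f \<in> module_hom K V W"
  using assms by (auto simp: module_hom_def)

lemma module_hom_in: "f \<in> module_hom K V W \<Longrightarrow> x \<in> carrier V \<Longrightarrow> f x \<in> carrier W"
  by (auto simp: module_hom_def)

lemma module_hom_cong:
  assumes "module K V" and "f \<in> module_hom K V W" and "\<And>x. x \<in> carrier V \<Longrightarrow> f x = g x"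
  shows "g \<in> module_hom K V W"
proof -
  interpret V: module K V by fact
  show ?thesis
    using assms(2) assms(3)[symmetric] by (auto simp: module_hom_def Pi_def)
qed

lemma module_hom_zero:
  assumes "module K V" "module K W" "f \<in> module_hom K V W"
  shows "f \<zero>\<^bsub>V\<^esub> = \<zero>\<^bsub>W\<^esub>"
  using assms by (intro mod_hom.f0_is_0[of K V W]) (simp add: mod_hom_def mod_hom_axioms_def)

lemma module_hom_finsum:
  assumes "module K V" "module K W" "f \<in> module_hom K V W" "g \<in> I \<rightarrow> carrier V"
  shows "f (\<Oplus>\<^bsub>V\<^esub>i\<in>I. g i) = (\<Oplus>\<^bsub>W\<^esub>i\<in>I. f (g i))"
proof -
  interpret V: module K V by fact
  interpret W: module K W by fact
  show ?thesis
    using assms(4)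
  proof (induct I rule: infinite_finite_induct)
    case (insert i I)
    then have "g i \<in> carrier V" "(\<Oplus>\<^bsub>V\<^esub>i\<in>I. g i) \<in> carrier V"
      by (auto intro: V.M.finsum_closed)
    with insert show ?case
      by (simp add: Pi_def module_hom_add[OF assms(3)] module_hom_in[OF assms(3)])
  qed (simp_all add: module_hom_zero[OF assms(1-3)])
qed

lemma module_hom_finsum_cong:
  assumes "module K V" "module K W" "f \<in> module_hom K V W"
    and g: "\<And>i. i \<in> I \<Longrightarrow> g i \<in> carrier V" and eq: "\<And>i. i \<in> I \<Longrightarrow> f (g i) = k i"
  shows "f (\<Oplus>\<^bsub>V\<^esub>i\<in>I. g i) = (\<Oplus>\<^bsub>W\<^esub>i\<in>I. k i)"
proof -
  interpret W: module K W by fact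
  have "f (\<Oplus>\<^bsub>V\<^esub>i\<in>I. g i) = (\<Oplus>\<^bsub>W\<^esub>i\<in>I. f (g i))"
    using g by (intro module_hom_finsum[OF assms(1-3)]) auto
  also have "\<dots> = (\<Oplus>\<^bsub>W\<^esub>i\<in>I. k i)"
    using g by (intro W.M.finsum_cong') (auto simp: eq[symmetric] intro!: module_hom_in[OF assms(3) g])
  finally show ?thesis .
qed

lemma module_hom_comp:
  assumes "f \<in> module_hom K U V" "g \<in> module_hom K V W"
  shows "(\<lambda>x. g (f x)) \<in> module_hom K U W"
  using assms by (auto simp: module_hom_def Pi_def)

lemma module_hom_id: "(\<lambda>x. x) \<in> module_hom K V V"
  by (auto simp: module_hom_def)

lemma module_hom_const_zero:
  assumes "module K W"
  shows "(\<lambda>x. \<zero>\<^bsub>W\<^esub>) \<in> module_hom K V W"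
proof -
  interpret W: module K W by fact
  show ?thesis by (auto simp: module_hom_def)
qed

lemma module_hom_plus:
  assumes "module K W" "f \<in> module_hom K V W" "g \<in> module_hom K V W"
  shows "(\<lambda>x. f x \<oplus>\<^bsub>W\<^esub> g x) \<in> module_hom K V W"
proof -
  interpret W: module K W by fact
  show ?thesis
    using assms(2,3) by (auto simp: module_hom_def Pi_def W.M.a_ac W.smult_r_distr)
qed

lemma module_hom_smult':
  assumes "module K W" "c \<in> carrier K" "f \<in> module_hom K V W"
  shows "(\<lambda>x. c \<odot>\<^bsub>W\<^esub> f x) \<in> module_hom K V W"
proof -
  interpret W: module K W by fact
  show ?thesis
    using assms(2,3)
    by (auto simp: module_hom_def Pi_def W.smult_r_distr W.smult_assoc1[symmetric] W.R.m_comm)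
qed

lemma module_hom_sum:
  assumes "module K V" "module K W" "\<And>i. i \<in> I \<Longrightarrow> f i \<in> module_hom K V W"
  shows "(\<lambda>x. \<Oplus>\<^bsub>W\<^esub>i\<in>I. f i x) \<in> module_hom K V W"
proof -
  interpret W: module K W by fact
  show ?thesis
    using assms(3)
  proof (induct I rule: infinite_finite_induct)
    case (insert i I)
    have eq: "(\<Oplus>\<^bsub>W\<^esub>j\<in>insert i I. f j x) = f i x \<oplus>\<^bsub>W\<^esub> (\<Oplus>\<^bsub>W\<^esub>j\<in>I. f j x)" if "x \<in> carrier V" for x
      using insert that by (intro W.M.finsum_insert) (auto intro: module_hom_in)
    have "(\<lambda>x. f i x \<oplus>\<^bsub>W\<^esub> (\<Oplus>\<^bsub>W\<^esub>i\<in>I. f i x)) \<in> module_hom K V W"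
      using insert by (intro module_hom_plus[OF assms(2)]) auto
    then show ?case
      by (rule module_hom_cong[OF assms(1)]) (simp add: eq)
  qed (simp_all add: module_hom_const_zero[OF assms(2)])
qed

lemma module_hom_minus:
  assumes "module K V" "module K W" "f \<in> module_hom K V W" "x \<in> carrier V" "y \<in> carrier V"
  shows "f (x \<ominus>\<^bsub>V\<^esub> y) = f x \<ominus>\<^bsub>W\<^esub> f y"
  using assms by (intro mod_hom.f_minus[of K V W]) (simp_all add: mod_hom_def mod_hom_axioms_def)

lemma module_hom_inj_iff:
  assumes "module K V" "module K W" "f \<in> module_hom K V W"
  shows "inj_on f (carrier V) \<longleftrightarrow> (\<forall>x\<in>carrier V. f x = \<zero>\<^bsub>W\<^esub> \<longrightarrow> x = \<zero>\<^bsub>V\<^esub>)"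
proof -
  interpret V: module K V by fact
  interpret W: module K W by fact
  show ?thesis
  proof
    assume "inj_on f (carrier V)"
    then show "\<forall>x\<in>carrier V. f x = \<zero>\<^bsub>W\<^esub> \<longrightarrow> x = \<zero>\<^bsub>V\<^esub>"
      using module_hom_zero[OF assms] by (auto dest: inj_onD[where y = "\<zero>\<^bsub>V\<^esub>"])
  next
    assume ker: "\<forall>x\<in>carrier V. f x = \<zero>\<^bsub>W\<^esub> \<longrightarrow> x = \<zero>\<^bsub>V\<^esub>"
    show "inj_on f (carrier V)"
    proof (rule inj_onI)
      fix x y assume xy: "x \<in> carrier V" "y \<in> carrier V" "f x = f y"
      then have "f (x \<ominus>\<^bsub>V\<^esub> y) = \<zero>\<^bsub>W\<^esub>"
        using assms by (simp add: module_hom_minus[OF assms] module_hom_in[OF assms(3)])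
      with ker xy have "x \<ominus>\<^bsub>V\<^esub> y = \<zero>\<^bsub>V\<^esub>" by auto
      with xy show "x = y" by simp
    qed
  qed
qed

lemma submodule_ker:
  assumes "module K V" "module K W" "f \<in> module_hom K V W"
  shows "submodule K {x \<in> carrier V. f x = \<zero>\<^bsub>W\<^esub>} V"
proof -
  interpret mod_hom K V W f using assms by (simp add: mod_hom_def mod_hom_axioms_def)
  show ?thesis using ker_is_submodule by (simp add: ker_def)
qed

lemma submodule_eq:
  assumes "module K V" "module K W" "f \<in> module_hom K V W" "g \<in> module_hom K V W"
  shows "submodule K {x \<in> carrier V. f x = g x} V"
proof -
  interpret V: module K V by fact
  interpret W: module K W by fact
  show ?thesis
    using assms
    by (auto simp: submodule_def module_hom_add module_hom_smult module_hom_zero)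
qed

lemma submodule_uminus:
  assumes "submodule K U V" "x \<in> U"
  shows "\<ominus>\<^bsub>V\<^esub> x \<in> U"
proof -
  interpret U: submodule K U V by fact
  interpret V: module K V by (rule U.module)
  have "(\<ominus>\<^bsub>K\<^esub> \<one>\<^bsub>K\<^esub>) \<odot>\<^bsub>V\<^esub> x \<in> U" using assms(2) by simp
  moreover have "x \<in> carrier V" using assms(2) U.subset by auto
  ultimately show ?thesis by (simp add: V.smult_minus_1)
qed

section \<open>Modules of functions\<close>

lemma function_module_simps [simp]:
  "carrier (function_module D N F) = F \<inter> extensional D"
  "\<zero>\<^bsub>function_module D N F\<^esub> = (\<lambda>x\<in>D. \<zero>\<^bsub>N\<^esub>)"
  "f \<oplus>\<^bsub>function_module D N F\<^esub> g = (\<lambda>x\<in>D. f x \<oplus>\<^bsub>N\<^esub> g x)"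
  "c \<odot>\<^bsub>function_module D N F\<^esub> f = (\<lambda>x\<in>D. c \<odot>\<^bsub>N\<^esub> f x)"
  by (simp_all add: function_module_def)

lemma function_module_is_module:
  fixes K :: "('k, 'x) ring_scheme"
  assumes "module K N" and F: "\<And>f x. f \<in> F \<Longrightarrow> x \<in> D \<Longrightarrow> f x \<in> carrier N"
    and zero: "(\<lambda>x\<in>D. \<zero>\<^bsub>N\<^esub>) \<in> F"
    and add: "\<And>f g. f \<in> F \<Longrightarrow> g \<in> F \<Longrightarrow> (\<lambda>x\<in>D. f x \<oplus>\<^bsub>N\<^esub> g x) \<in> F"
    and smult: "\<And>c f. c \<in> carrier K \<Longrightarrow> f \<in> F \<Longrightarrow> (\<lambda>x\<in>D. c \<odot>\<^bsub>N\<^esub> f x) \<in> F"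
  shows "module K (function_module D N F)"
proof -
  interpret N: module K N by fact
  show ?thesis
  proof (rule module_criteria)
    show "\<forall>f\<in>carrier (function_module D N F). \<exists>g\<in>carrier (function_module D N F).
        f \<oplus>\<^bsub>function_module D N F\<^esub> g = \<zero>\<^bsub>function_module D N F\<^esub>"
    proof
      fix f assume f: "f \<in> carrier (function_module D N F)"
      let ?g = "\<lambda>x\<in>D. (\<ominus>\<^bsub>K\<^esub> \<one>\<^bsub>K\<^esub>) \<odot>\<^bsub>N\<^esub> f x"
      have "?g \<in> carrier (function_module D N F)" using f smult by simp
      moreover have "f \<oplus>\<^bsub>function_module D N F\<^esub> ?g = \<zero>\<^bsub>function_module D N F\<^esub>"
        using f F by (auto simp: fun_eq_iff N.smult_l_minus N.M.r_neg)
      ultimately show "\<exists>g\<in>carrier (function_module D N F).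
          f \<oplus>\<^bsub>function_module D N F\<^esub> g = \<zero>\<^bsub>function_module D N F\<^esub>" by blast
    qed
  qed (use N.R.is_cring zero F add smult in
       \<open>auto simp: fun_eq_iff extensional_def N.M.a_ac N.smult_assoc1 N.smult_l_distr N.smult_r_distr\<close>)
qed

lemma module_hom_function_module:
  assumes ext: "\<And>f. d f \<in> extensional D"
    and hom: "\<And>x. x \<in> D \<Longrightarrow> (\<lambda>f. d f x) \<in> module_hom K C N"
  shows "d \<in> module_hom K C (function_module D N (D \<rightarrow> carrier N))"
proof (rule module_homI)
  show "d f \<in> carrier (function_module D N (D \<rightarrow> carrier N))" if "f \<in> carrier C" for f
    using ext module_hom_in[OF hom that] by simp
next
  fix f g assume fg: "f \<in> carrier C" "g \<in> carrier C"
  show "d (f \<oplus>\<^bsub>C\<^esub> g) = d f \<oplus>\<^bsub>function_module D N (D \<rightarrow> carrier N)\<^esub> d g"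
    by (rule extensionalityI[OF ext]) (simp_all add: module_hom_add[OF hom fg])
next
  fix c f assume cf: "c \<in> carrier K" "f \<in> carrier C"
  show "d (c \<odot>\<^bsub>C\<^esub> f) = c \<odot>\<^bsub>function_module D N (D \<rightarrow> carrier N)\<^esub> d f"
    by (rule extensionalityI[OF ext]) (simp_all add: module_hom_smult[OF hom cf])
qed

section \<open>Quotient modules\<close>

locale quotient_of_module = module K V
  for K :: "('k, 'x) ring_scheme" and V :: "('k, 'v, 'y) module_scheme" +
  fixes U
  assumes sub: "submodule K U V"
begin

lemma abelian_subgroup: "abelian_subgroup U V"
proof (rule abelian_subgroupI3)
  interpret submodule K U V by (rule sub)
  show "additive_subgroup U V"
    using subset zero_closed m_closed submodule_uminus[OF submodule_axioms]
    by unfold_locales (auto simp flip: a_inv_def)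
qed (rule M.abelian_group_axioms)

lemmas rcos_self = abelian_subgroup.a_rcos_self[OF abelian_subgroup]
  and rcos_const = abelian_subgroup.a_rcos_const[OF abelian_subgroup]
  and rcos_sum = abelian_subgroup.a_rcos_sum[OF abelian_subgroup]
  and rcos_module = abelian_subgroup.a_rcos_module[OF abelian_subgroup]
  and elemrcos_carrier = abelian_subgroup.a_elemrcos_carrier[OF abelian_subgroup]
  and repr_independence = abelian_subgroup.a_repr_independence'[OF abelian_subgroup]

abbreviation coset :: "'v \<Rightarrow> 'v set" where
  "coset x \<equiv> U +>\<^bsub>V\<^esub> x"

abbreviation Q :: "('k, 'v set) module" where
  "Q \<equiv> quotient_module V U"

lemma coset_eq_iff:
  assumes "x \<in> carrier V" "y \<in> carrier V"
  shows "coset x = coset y \<longleftrightarrow> x \<ominus>\<^bsub>V\<^esub> y \<in> U"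
  using repr_independence[of x y] rcos_self[of x] rcos_module[of y x] assms
  by (auto simp: a_minus_def)

lemma coset_eq_self_iff: "x \<in> carrier V \<Longrightarrow> coset x = U \<longleftrightarrow> x \<in> U"
  using rcos_const rcos_self by auto

lemma carrier_quotient_module: "carrier Q = coset ` carrier V"
  by (auto simp: quotient_module_def A_RCOSETS_def')

lemma zero_quotient_module: "\<zero>\<^bsub>Q\<^esub> = coset \<zero>\<^bsub>V\<^esub>"
  using rcos_const[OF submodule.zero_closed[OF sub]] by (simp add: quotient_module_def)

lemma add_quotient_module:
  "x \<in> carrier V \<Longrightarrow> y \<in> carrier V \<Longrightarrow> coset x \<oplus>\<^bsub>Q\<^esub> coset y = coset (x \<oplus>\<^bsub>V\<^esub> y)"
  by (simp add: quotient_module_def rcos_sum)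

text \<open>The scalar multiple of a coset in \<open>quotient_module\<close> is a union over all its representatives.
  It collapses to one coset because the multiples of two representatives differ by an element of
  \<open>U\<close>.\<close>

lemma smult_quotient_module:
  assumes "c \<in> carrier K" "x \<in> carrier V"
  shows "c \<odot>\<^bsub>Q\<^esub> coset x = coset (c \<odot>\<^bsub>V\<^esub> x)"
proof -
  have "coset (c \<odot>\<^bsub>V\<^esub> y) = coset (c \<odot>\<^bsub>V\<^esub> x)" if y: "y \<in> coset x" for y
  proof -
    have yV: "y \<in> carrier V" using y assms by (blast intro: elemrcos_carrier)
    have "y \<ominus>\<^bsub>V\<^esub> x \<in> U"
      using rcos_module assms yV y by (simp add: a_minus_def)
    then have "c \<odot>\<^bsub>V\<^esub> (y \<ominus>\<^bsub>V\<^esub> x) \<in> U" using assms submodule.smult_closed[OF sub] by simp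
    then have "c \<odot>\<^bsub>V\<^esub> y \<ominus>\<^bsub>V\<^esub> c \<odot>\<^bsub>V\<^esub> x \<in> U"
      using module_hom_minus[OF module_axioms module_axioms
          module_hom_smult'[OF module_axioms assms(1) module_hom_id] yV assms(2)] by simp
    then show ?thesis using assms yV by (simp add: coset_eq_iff)
  qed
  moreover have "x \<in> coset x" using assms(2) by (rule rcos_self)
  ultimately have "(\<Union>y\<in>coset x. coset (c \<odot>\<^bsub>V\<^esub> y)) = coset (c \<odot>\<^bsub>V\<^esub> x)" by blast
  then show ?thesis by (simp add: quotient_module_def)
qed

lemma quotient_module_is_module: "module K Q"
proof (rule module_criteria)
  show "\<forall>X\<in>carrier Q. \<exists>Y\<in>carrier Q. X \<oplus>\<^bsub>Q\<^esub> Y = \<zero>\<^bsub>Q\<^esub>"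
    unfolding carrier_quotient_module
  proof (clarify)
    fix x assume "x \<in> carrier V"
    then have "coset x \<oplus>\<^bsub>Q\<^esub> coset (\<ominus>\<^bsub>V\<^esub> x) = \<zero>\<^bsub>Q\<^esub>"
      by (simp add: add_quotient_module zero_quotient_module M.r_neg)
    with \<open>x \<in> carrier V\<close> show "\<exists>Y\<in>coset ` carrier V. coset x \<oplus>\<^bsub>Q\<^esub> Y = \<zero>\<^bsub>Q\<^esub>" by blast
  qed
qed (use R.is_cring in \<open>auto simp: carrier_quotient_module add_quotient_module
       smult_quotient_module zero_quotient_module M.a_ac smult_assoc1 smult_l_distr smult_r_distr\<close>)

end

section \<open>Free modules\<close>

context cring
begin

lemma free_module_simps:
  "carrier (free_module R S) = {f \<in> S \<rightarrow>\<^sub>E carrier R. finite (support R S f)}"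
  "\<zero>\<^bsub>free_module R S\<^esub> = (\<lambda>s\<in>S. \<zero>\<^bsub>R\<^esub>)"
  "f \<oplus>\<^bsub>free_module R S\<^esub> g = (\<lambda>s\<in>S. f s \<oplus>\<^bsub>R\<^esub> g s)"
  "c \<odot>\<^bsub>free_module R S\<^esub> f = (\<lambda>s\<in>S. c \<otimes>\<^bsub>R\<^esub> f s)"
  by (simp_all add: free_module_def func_space_def)

lemma free_module_is_module: "module R (free_module R S)"
proof -
  interpret F: module R "func_space S" by (rule func_space_is_module)
  have "submodule R {f \<in> S \<rightarrow>\<^sub>E carrier R. finite (support R S f)} (func_space S)"
  proof
    fix f g
    assume f: "f \<in> {f \<in> S \<rightarrow>\<^sub>E carrier R. finite (support R S f)}"
      and g: "g \<in> {f \<in> S \<rightarrow>\<^sub>E carrier R. finite (support R S f)}"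
    have "support R S (f \<oplus>\<^bsub>func_space S\<^esub> g) \<subseteq> support R S f \<union> support R S g"
      using f g by (auto simp: support_def func_space_def)
    with f g show "f \<oplus>\<^bsub>func_space S\<^esub> g \<in> {f \<in> S \<rightarrow>\<^sub>E carrier R. finite (support R S f)}"
      by (auto simp: func_space_def intro: finite_subset)
  next
    fix c f
    assume c: "c \<in> carrier R" and f: "f \<in> {f \<in> S \<rightarrow>\<^sub>E carrier R. finite (support R S f)}"
    then have "support R S (c \<odot>\<^bsub>func_space S\<^esub> f) \<subseteq> support R S f"
      by (auto simp: support_def func_space_def)
    with c f show "c \<odot>\<^bsub>func_space S\<^esub> f \<in> {f \<in> S \<rightarrow>\<^sub>E carrier R. finite (support R S f)}"
      by (auto simp: func_space_def intro: finite_subset)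
  qed (auto simp: func_space_def support_def intro: F.module_axioms[unfolded func_space_def])
  then show ?thesis
    unfolding free_module_def by (rule F.submodule_is_module)
qed

lemma free_gen_closed: "s \<in> S \<Longrightarrow> free_gen R S s \<in> carrier (free_module R S)"
  by (auto simp: free_module_simps free_gen_def support_def intro: finite_subset[of _ "{s}"])

end

definition linear_extension ::
    "('k, 'x) ring_scheme \<Rightarrow> 's set \<Rightarrow> ('k, 'w, 'z) module_scheme \<Rightarrow> ('s \<Rightarrow> 'w) \<Rightarrow> ('s \<Rightarrow> 'k) \<Rightarrow> 'w"
  where "linear_extension K S W b f = (\<Oplus>\<^bsub>W\<^esub>s\<in>support K S f. f s \<odot>\<^bsub>W\<^esub> b s)"

context module
begin

text \<open>The supports of two functions and of their sum are different sets; the sums over them become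
  comparable when they are taken over one finite set containing all of them.\<close>

lemma linear_extension_superset:
  assumes "b \<in> S \<rightarrow> carrier M" "f \<in> S \<rightarrow> carrier R" "finite D" "support R S f \<subseteq> D" "D \<subseteq> S"
  shows "linear_extension R S M b f = (\<Oplus>\<^bsub>M\<^esub>s\<in>D. f s \<odot>\<^bsub>M\<^esub> b s)"
  unfolding linear_extension_def using assms
  by (intro M.add.finprod_mono_neutral_cong_left) (auto simp: support_def Pi_def subset_iff)

lemma linear_extension_hom:
  assumes b: "b \<in> S \<rightarrow> carrier M"
  shows "linear_extension R S M b \<in> module_hom R (free_module R S) M"
  supply R.free_module_simps [simp]
proof (rule module_homI)
  fix f assume "f \<in> carrier (free_module R S)"
  then show "linear_extension R S M b f \<in> carrier M"
    using b unfolding linear_extension_def by (intro M.finsum_closed) (auto simp: support_def)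
next
  fix f g assume fg: "f \<in> carrier (free_module R S)" "g \<in> carrier (free_module R S)"
  let ?D = "support R S f \<union> support R S g"
  have D: "finite ?D" "?D \<subseteq> S" using fg by (auto simp: support_def)
  have "linear_extension R S M b (f \<oplus>\<^bsub>free_module R S\<^esub> g)
      = (\<Oplus>\<^bsub>M\<^esub>s\<in>?D. (f \<oplus>\<^bsub>free_module R S\<^esub> g) s \<odot>\<^bsub>M\<^esub> b s)"
    using b fg D by (intro linear_extension_superset) (auto simp: support_def)
  also have "\<dots> = (\<Oplus>\<^bsub>M\<^esub>s\<in>?D. f s \<odot>\<^bsub>M\<^esub> b s \<oplus>\<^bsub>M\<^esub> g s \<odot>\<^bsub>M\<^esub> b s)"
    using b fg D by (intro M.finsum_cong') (auto simp: smult_l_distr Pi_def PiE_def)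
  also have "\<dots> = (\<Oplus>\<^bsub>M\<^esub>s\<in>?D. f s \<odot>\<^bsub>M\<^esub> b s) \<oplus>\<^bsub>M\<^esub> (\<Oplus>\<^bsub>M\<^esub>s\<in>?D. g s \<odot>\<^bsub>M\<^esub> b s)"
    using b fg D by (intro M.finsum_addf) (auto simp: Pi_def PiE_def)
  also have "\<dots> = linear_extension R S M b f \<oplus>\<^bsub>M\<^esub> linear_extension R S M b g"
    using b fg D by (intro arg_cong2[where f = "add M"] linear_extension_superset[symmetric]) auto
  finally show "linear_extension R S M b (f \<oplus>\<^bsub>free_module R S\<^esub> g)
      = linear_extension R S M b f \<oplus>\<^bsub>M\<^esub> linear_extension R S M b g" .
next
  fix c f assume cf: "c \<in> carrier R" "f \<in> carrier (free_module R S)"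
  let ?D = "support R S f"
  have D: "finite ?D" "?D \<subseteq> S" using cf by (auto simp: support_def)
  have "linear_extension R S M b (c \<odot>\<^bsub>free_module R S\<^esub> f)
      = (\<Oplus>\<^bsub>M\<^esub>s\<in>?D. (c \<odot>\<^bsub>free_module R S\<^esub> f) s \<odot>\<^bsub>M\<^esub> b s)"
    using b cf D by (intro linear_extension_superset) (auto simp: support_def)
  also have "\<dots> = (\<Oplus>\<^bsub>M\<^esub>s\<in>?D. c \<odot>\<^bsub>M\<^esub> (f s \<odot>\<^bsub>M\<^esub> b s))"
    using b cf D by (intro M.finsum_cong') (auto simp: smult_assoc1 Pi_def PiE_def)
  also have "\<dots> = c \<odot>\<^bsub>M\<^esub> linear_extension R S M b f"
    unfolding linear_extension_def
    using b cf D by (intro finsum_smult_ldistr[symmetric]) (auto simp: Pi_def PiE_def)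
  finally show "linear_extension R S M b (c \<odot>\<^bsub>free_module R S\<^esub> f)
      = c \<odot>\<^bsub>M\<^esub> linear_extension R S M b f" .
qed

lemma linear_extension_free_gen:
  assumes "b \<in> S \<rightarrow> carrier M" "s \<in> S"
  shows "linear_extension R S M b (free_gen R S s) = b s"
proof -
  have "linear_extension R S M b (free_gen R S s) = (\<Oplus>\<^bsub>M\<^esub>t\<in>{s}. free_gen R S s t \<odot>\<^bsub>M\<^esub> b t)"
    using assms by (intro linear_extension_superset) (auto simp: free_gen_def support_def)
  also have "\<dots> = b s"
    using assms by (simp add: free_gen_def Pi_def)
  finally show ?thesis .
qed

end

section \<open>Tensor products\<close>

definition bilinear_maps ::
    "('k, 'x) ring_scheme \<Rightarrow> ('k, 'v, 'y) module_scheme \<Rightarrow> ('k, 'w, 'z) module_scheme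
      \<Rightarrow> ('k, 'u, 't) module_scheme \<Rightarrow> ('v \<Rightarrow> 'w \<Rightarrow> 'u) set" where
  "bilinear_maps K V W X =
    {b. (\<forall>w\<in>carrier W. (\<lambda>v. b v w) \<in> module_hom K V X) \<and>
        (\<forall>v\<in>carrier V. (\<lambda>w. b v w) \<in> module_hom K W X)}"

lemma bilinear_mapsI:
  assumes "\<And>w. w \<in> carrier W \<Longrightarrow> (\<lambda>v. b v w) \<in> module_hom K V X"
    and "\<And>v. v \<in> carrier V \<Longrightarrow> (\<lambda>w. b v w) \<in> module_hom K W X"
  shows "b \<in> bilinear_maps K V W X"
  using assms by (simp add: bilinear_maps_def)

lemma bilinear_left: "b \<in> bilinear_maps K V W X \<Longrightarrow> w \<in> carrier W \<Longrightarrow> (\<lambda>v. b v w) \<in> module_hom K V X"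
  by (simp add: bilinear_maps_def)

lemma bilinear_right: "b \<in> bilinear_maps K V W X \<Longrightarrow> v \<in> carrier V \<Longrightarrow> (\<lambda>w. b v w) \<in> module_hom K W X"
  by (simp add: bilinear_maps_def)

lemma bilinear_in:
  "b \<in> bilinear_maps K V W X \<Longrightarrow> v \<in> carrier V \<Longrightarrow> w \<in> carrier W \<Longrightarrow> b v w \<in> carrier X"
  by (auto simp: bilinear_maps_def module_hom_def Pi_def)

lemma bilinear_simps:
  assumes "b \<in> bilinear_maps K V W X"
  shows "v \<in> carrier V \<Longrightarrow> v' \<in> carrier V \<Longrightarrow> w \<in> carrier W
      \<Longrightarrow> b (v \<oplus>\<^bsub>V\<^esub> v') w = b v w \<oplus>\<^bsub>X\<^esub> b v' w"
    and "v \<in> carrier V \<Longrightarrow> w \<in> carrier W \<Longrightarrow> w' \<in> carrier W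
      \<Longrightarrow> b v (w \<oplus>\<^bsub>W\<^esub> w') = b v w \<oplus>\<^bsub>X\<^esub> b v w'"
    and "c \<in> carrier K \<Longrightarrow> v \<in> carrier V \<Longrightarrow> w \<in> carrier W \<Longrightarrow> b (c \<odot>\<^bsub>V\<^esub> v) w = c \<odot>\<^bsub>X\<^esub> b v w"
    and "c \<in> carrier K \<Longrightarrow> v \<in> carrier V \<Longrightarrow> w \<in> carrier W \<Longrightarrow> b v (c \<odot>\<^bsub>W\<^esub> w) = c \<odot>\<^bsub>X\<^esub> b v w"
  using assms by (auto simp: bilinear_maps_def module_hom_def)

lemma bilinear_cong:
  assumes "module K V" "module K W" "b \<in> bilinear_maps K V W X"
    and "\<And>v w. v \<in> carrier V \<Longrightarrow> w \<in> carrier W \<Longrightarrow> b v w = b' v w"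
  shows "b' \<in> bilinear_maps K V W X"
  using assms
  by (auto simp: bilinear_maps_def intro: module_hom_cong[OF assms(1)] module_hom_cong[OF assms(2)])

lemma bilinear_comp_args:
  assumes "b \<in> bilinear_maps K V W X" "f \<in> module_hom K V' V" "g \<in> module_hom K W' W"
  shows "(\<lambda>v w. b (f v) (g w)) \<in> bilinear_maps K V' W' X"
  using assms
  by (auto simp: bilinear_maps_def intro!: module_hom_comp[OF assms(2)] module_hom_comp[OF assms(3)]
      intro: module_hom_in)

lemma bilinear_plus:
  assumes "module K X" "b \<in> bilinear_maps K V W X" "b' \<in> bilinear_maps K V W X"
  shows "(\<lambda>v w. b v w \<oplus>\<^bsub>X\<^esub> b' v w) \<in> bilinear_maps K V W X"
  using assms by (auto simp: bilinear_maps_def intro: module_hom_plus)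

text \<open>A representative of the coset is chosen, and the linear extension of \<open>b\<close> to formal sums is
  evaluated at it; by \<open>tensor_lift_eq\<close> the choice does not affect the value.\<close>

definition tensor_lift ::
    "('k, 'x) ring_scheme \<Rightarrow> ('k, 'v, 'y) module_scheme \<Rightarrow> ('k, 'w, 'z) module_scheme
      \<Rightarrow> ('k, 'u, 't) module_scheme \<Rightarrow> ('v \<Rightarrow> 'w \<Rightarrow> 'u) \<Rightarrow> ('v \<times> 'w \<Rightarrow> 'k) set \<Rightarrow> 'u" where
  "tensor_lift K V W X b Y =
    linear_extension K (carrier V \<times> carrier W) X (case_prod b) (SOME f. f \<in> Y)"

locale tensor_factors = V: module K V + W: module K W
  for K :: "('k, 'x) ring_scheme" and V :: "('k, 'v, 'y) module_scheme"
    and W :: "('k, 'w, 'z) module_scheme"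
begin

abbreviation T :: "('k, ('v \<times> 'w \<Rightarrow> 'k) set) module" where
  "T \<equiv> tensor_product K V W"

abbreviation F :: "('k, 'v \<times> 'w \<Rightarrow> 'k) module" where
  "F \<equiv> free_module K (carrier V \<times> carrier W)"

abbreviation gen :: "'v \<times> 'w \<Rightarrow> 'v \<times> 'w \<Rightarrow> 'k" where
  "gen \<equiv> free_gen K (carrier V \<times> carrier W)"

abbreviation Rel :: "('v \<times> 'w \<Rightarrow> 'k) set" where
  "Rel \<equiv> tensor_relations K V W"

abbreviation pure :: "'v \<Rightarrow> 'w \<Rightarrow> ('v \<times> 'w \<Rightarrow> 'k) set" where
  "pure \<equiv> pure_tensor K V W"

lemma F_module: "module K F"
  by (rule V.R.free_module_is_module)

lemma gen_closed: "v \<in> carrier V \<Longrightarrow> w \<in> carrier W \<Longrightarrow> gen (v, w) \<in> carrier F"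
  by (rule V.R.free_gen_closed) simp

definition relators :: "('v \<times> 'w \<Rightarrow> 'k) set" where
  "relators =
      {gen (v \<oplus>\<^bsub>V\<^esub> v', w) \<ominus>\<^bsub>F\<^esub> (gen (v, w) \<oplus>\<^bsub>F\<^esub> gen (v', w)) |v v' w.
          v \<in> carrier V \<and> v' \<in> carrier V \<and> w \<in> carrier W}
       \<union> {gen (v, w \<oplus>\<^bsub>W\<^esub> w') \<ominus>\<^bsub>F\<^esub> (gen (v, w) \<oplus>\<^bsub>F\<^esub> gen (v, w')) |v w w'.
          v \<in> carrier V \<and> w \<in> carrier W \<and> w' \<in> carrier W}
       \<union> {gen (c \<odot>\<^bsub>V\<^esub> v, w) \<ominus>\<^bsub>F\<^esub> (c \<odot>\<^bsub>F\<^esub> gen (v, w)) |c v w.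
          c \<in> carrier K \<and> v \<in> carrier V \<and> w \<in> carrier W}
       \<union> {gen (v, c \<odot>\<^bsub>W\<^esub> w) \<ominus>\<^bsub>F\<^esub> (c \<odot>\<^bsub>F\<^esub> gen (v, w)) |c v w.
          c \<in> carrier K \<and> v \<in> carrier V \<and> w \<in> carrier W}"

lemma Rel_eq: "Rel = module.span K F relators"
  unfolding tensor_relations_def relators_def Let_def ..

lemma relators_sub: "relators \<subseteq> carrier F"
proof -
  interpret F: module K F by (rule F_module)
  show ?thesis unfolding relators_def by (auto simp: gen_closed)
qed

lemma Rel_submodule: "submodule K Rel F"
  unfolding Rel_eq using module.span_is_submodule[OF F_module relators_sub] .

sublocale quot: quotient_of_module K F Rel
  rewrites "quotient_module F Rel = T"
  using F_module Rel_submodule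
  by (simp_all add: quotient_of_module_def quotient_of_module_axioms_def tensor_product_def)

lemma pure_eq: "pure v w = quot.coset (gen (v, w))"
  by (simp add: pure_tensor_def Let_def)

lemma tensor_module: "module K T"
  by (rule quot.quotient_module_is_module)

sublocale T: module K T
  by (rule tensor_module)

lemma relators_in_Rel: "r \<in> relators \<Longrightarrow> r \<in> Rel"
  unfolding Rel_eq using module.in_own_span[OF F_module relators_sub] by blast

lemma pure_bilinear: "pure \<in> bilinear_maps K V W T"
proof (intro bilinear_mapsI module_homI)
  fix v v' w assume v: "v \<in> carrier V" "v' \<in> carrier V" "w \<in> carrier W"
  then have "gen (v \<oplus>\<^bsub>V\<^esub> v', w) \<ominus>\<^bsub>F\<^esub> (gen (v, w) \<oplus>\<^bsub>F\<^esub> gen (v', w)) \<in> relators"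
    unfolding relators_def by blast
  then have "quot.coset (gen (v \<oplus>\<^bsub>V\<^esub> v', w)) = quot.coset (gen (v, w) \<oplus>\<^bsub>F\<^esub> gen (v', w))"
    using v gen_closed by (subst quot.coset_eq_iff) (simp_all add: relators_in_Rel)
  then show "pure (v \<oplus>\<^bsub>V\<^esub> v') w = pure v w \<oplus>\<^bsub>T\<^esub> pure v' w"
    using v gen_closed by (simp add: pure_eq quot.add_quotient_module)
next
  fix v w w' assume v: "v \<in> carrier V" "w \<in> carrier W" "w' \<in> carrier W"
  then have "gen (v, w \<oplus>\<^bsub>W\<^esub> w') \<ominus>\<^bsub>F\<^esub> (gen (v, w) \<oplus>\<^bsub>F\<^esub> gen (v, w')) \<in> relators"
    unfolding relators_def by blast
  then have "quot.coset (gen (v, w \<oplus>\<^bsub>W\<^esub> w')) = quot.coset (gen (v, w) \<oplus>\<^bsub>F\<^esub> gen (v, w'))"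
    using v gen_closed by (subst quot.coset_eq_iff) (simp_all add: relators_in_Rel)
  then show "pure v (w \<oplus>\<^bsub>W\<^esub> w') = pure v w \<oplus>\<^bsub>T\<^esub> pure v w'"
    using v gen_closed by (simp add: pure_eq quot.add_quotient_module)
next
  fix c v w assume v: "c \<in> carrier K" "v \<in> carrier V" "w \<in> carrier W"
  then have "gen (c \<odot>\<^bsub>V\<^esub> v, w) \<ominus>\<^bsub>F\<^esub> (c \<odot>\<^bsub>F\<^esub> gen (v, w)) \<in> relators"
    "gen (v, c \<odot>\<^bsub>W\<^esub> w) \<ominus>\<^bsub>F\<^esub> (c \<odot>\<^bsub>F\<^esub> gen (v, w)) \<in> relators"
    unfolding relators_def by blast+
  then have "quot.coset (gen (c \<odot>\<^bsub>V\<^esub> v, w)) = quot.coset (c \<odot>\<^bsub>F\<^esub> gen (v, w))"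
    "quot.coset (gen (v, c \<odot>\<^bsub>W\<^esub> w)) = quot.coset (c \<odot>\<^bsub>F\<^esub> gen (v, w))"
    using v gen_closed by (subst quot.coset_eq_iff; simp add: relators_in_Rel)+
  then show "pure (c \<odot>\<^bsub>V\<^esub> v) w = c \<odot>\<^bsub>T\<^esub> pure v w" "pure v (c \<odot>\<^bsub>W\<^esub> w) = c \<odot>\<^bsub>T\<^esub> pure v w"
    using v gen_closed by (simp_all add: pure_eq quot.smult_quotient_module)
qed (use gen_closed in \<open>auto simp: pure_eq quot.carrier_quotient_module\<close>)

lemmas pure_closed = bilinear_in[OF pure_bilinear]
  and pure_simps = bilinear_simps[OF pure_bilinear]

text \<open>A scalar in front of a pure tensor can be absorbed in its first factor, so sums of pure tensors
  exhaust the tensor product.  The points of the support of a representative are removed one by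
  one.\<close>

lemma tensor_induct [consumes 1, case_names pure add]:
  assumes X: "X \<in> carrier T"
    and pure: "\<And>v w. v \<in> carrier V \<Longrightarrow> w \<in> carrier W \<Longrightarrow> P (pure v w)"
    and add: "\<And>X Y. X \<in> carrier T \<Longrightarrow> Y \<in> carrier T \<Longrightarrow> P X \<Longrightarrow> P Y \<Longrightarrow> P (X \<oplus>\<^bsub>T\<^esub> Y)"
  shows "P X"
proof -
  have main: "P (quot.coset f)"
    if "finite D" "f \<in> carrier F" "support K (carrier V \<times> carrier W) f \<subseteq> D" for D f
    using that
  proof (induct D arbitrary: f rule: finite_induct)
    case empty
    then have "f = \<zero>\<^bsub>F\<^esub>" 
      by (auto simp: V.R.free_module_simps support_def PiE_def extensional_def fun_eq_iff)
    then have "quot.coset f = \<zero>\<^bsub>T\<^esub>" by (simp only: quot.zero_quotient_module)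
    also have "\<dots> = pure (\<zero>\<^bsub>K\<^esub> \<odot>\<^bsub>V\<^esub> \<zero>\<^bsub>V\<^esub>) \<zero>\<^bsub>W\<^esub>"
      by (subst pure_simps) (use pure_closed in auto)
    finally show ?case using pure by simp
  next
    case (insert p D)
    show ?case
    proof (cases "p \<in> carrier V \<times> carrier W")
      case False
      with insert show ?thesis by (auto simp: support_def)
    next
      case True
      then obtain v w where p: "p = (v, w)" "v \<in> carrier V" "w \<in> carrier W" by auto
      define g where "g = f(p := \<zero>\<^bsub>K\<^esub>)"
      have fp: "f p \<in> carrier K" using insert.prems(1) True by (auto simp: V.R.free_module_simps)
      have sg: "support K (carrier V \<times> carrier W) g \<subseteq> D"
        using insert.prems(2) by (auto simp: support_def g_def)
      have g: "g \<in> carrier F"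
        using insert.prems(1) True finite_subset[OF sg insert.hyps(1)]
        by (auto simp: V.R.free_module_simps g_def PiE_def extensional_def)
      have "f = g \<oplus>\<^bsub>F\<^esub> (f p \<odot>\<^bsub>F\<^esub> gen p)"
        using insert.prems(1) True fp
        by (auto simp: V.R.free_module_simps g_def free_gen_def fun_eq_iff PiE_def extensional_def Pi_def)
      then have "quot.coset f = quot.coset (g \<oplus>\<^bsub>F\<^esub> (f p \<odot>\<^bsub>F\<^esub> gen p))" by simp
      also have "\<dots> = quot.coset g \<oplus>\<^bsub>T\<^esub> (f p \<odot>\<^bsub>T\<^esub> pure v w)"
        using g fp p gen_closed[OF p(2,3)] quot.smult_closed
        by (simp add: quot.add_quotient_module[symmetric] quot.smult_quotient_module pure_eq)
      also have "\<dots> = quot.coset g \<oplus>\<^bsub>T\<^esub> pure (f p \<odot>\<^bsub>V\<^esub> v) w"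
        using p fp by (simp add: pure_simps)
      finally have eq: "quot.coset f = quot.coset g \<oplus>\<^bsub>T\<^esub> pure (f p \<odot>\<^bsub>V\<^esub> v) w" .
      show ?thesis unfolding eq
      proof (intro add pure)
        show "quot.coset g \<in> carrier T" using g by (auto simp: quot.carrier_quotient_module)
        show "P (quot.coset g)" using insert.hyps(3)[OF g sg] .
      qed (use p fp in \<open>auto intro: pure_closed\<close>)
    qed
  qed
  from X obtain f where f: "f \<in> carrier F" "X = quot.coset f"
    by (auto simp: quot.carrier_quotient_module)
  show ?thesis unfolding f(2)
    using f(1) by (intro main[of "support K (carrier V \<times> carrier W) f"]) (auto simp: V.R.free_module_simps)
qed

lemma tensor_hom_eqI:
  assumes "f \<in> module_hom K T X" "g \<in> module_hom K T X"
    and "\<And>v w. v \<in> carrier V \<Longrightarrow> w \<in> carrier W \<Longrightarrow> f (pure v w) = g (pure v w)"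
    and "Y \<in> carrier T"
  shows "f Y = g Y"
  using assms(4)
  by (induct rule: tensor_induct) (use assms(1-3) in \<open>auto simp: module_hom_add\<close>)

context
  fixes X :: "('k, 'u, 't) module_scheme" and b
  assumes X: "module K X" and b: "b \<in> bilinear_maps K V W X"
begin

lemma case_prod_b: "case_prod b \<in> carrier V \<times> carrier W \<rightarrow> carrier X"
  using b by (auto intro: bilinear_in)

abbreviation ext :: "('v \<times> 'w \<Rightarrow> 'k) \<Rightarrow> 'u" where
  "ext \<equiv> linear_extension K (carrier V \<times> carrier W) X (case_prod b)"

lemma ext_hom: "ext \<in> module_hom K F X"
  by (rule module.linear_extension_hom[OF X case_prod_b])

text \<open>The four families of relators are the four identities in the definition of bilinearity.\<close>

lemma ext_Rel:
  assumes "r \<in> Rel"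
  shows "ext r = \<zero>\<^bsub>X\<^esub>"
proof -
  interpret X: module K X by (rule X)
  have gen: "ext (gen (v, w)) = b v w" if "v \<in> carrier V" "w \<in> carrier W" for v w
    using that by (simp add: module.linear_extension_free_gen[OF X case_prod_b])
  have diff: "ext (gen (v, w) \<ominus>\<^bsub>F\<^esub> g) = \<zero>\<^bsub>X\<^esub>"
    if "ext g = b v w" "v \<in> carrier V" "w \<in> carrier W" "g \<in> carrier F" for v w g
    using that bilinear_in[OF b]
    by (simp add: module_hom_minus[OF F_module X ext_hom] gen gen_closed)
  note [simp] = gen gen_closed bilinear_in[OF b] bilinear_simps[OF b] module_hom_add[OF ext_hom]
    module_hom_smult[OF ext_hom]
  have "relators \<subseteq> {g \<in> carrier F. ext g = \<zero>\<^bsub>X\<^esub>}"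
    using relators_sub unfolding relators_def by (auto intro!: diff)
  then show ?thesis
    using assms quot.span_is_subset[OF _ submodule_ker[OF F_module X ext_hom]] unfolding Rel_eq by blast
qed

lemma tensor_lift_eq:
  assumes "Y \<in> carrier T" "f \<in> Y"
  shows "tensor_lift K V W X b Y = ext f"
proof -
  have "(SOME f. f \<in> Y) \<in> Y" using assms(2) by (rule someI[of "\<lambda>f. f \<in> Y"])
  moreover have "ext f = ext g" if "f \<in> Y" "g \<in> Y" for f g
  proof -
    interpret X: module K X by (rule X)
    obtain h where h: "h \<in> carrier F" "Y = quot.coset h"
      using assms(1) by (auto simp: quot.carrier_quotient_module)
    have ext_h: "ext f = ext h" if "f \<in> Y" for f
    proof -
      have f: "f \<in> carrier F" using that h quot.elemrcos_carrier by blast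
      with that h have "f \<ominus>\<^bsub>F\<^esub> h \<in> Rel" using quot.rcos_module by (simp add: a_minus_def)
      then have "ext f \<ominus>\<^bsub>X\<^esub> ext h = \<zero>\<^bsub>X\<^esub>"
        using ext_Rel module_hom_minus[OF F_module X ext_hom f h(1)] by simp
      then show ?thesis
        using module_hom_in[OF ext_hom] f h(1) by simp
    qed
    show ?thesis using ext_h that by simp
  qed
  ultimately show ?thesis using assms(2) unfolding tensor_lift_def by blast
qed

lemma tensor_lift_coset: "f \<in> carrier F \<Longrightarrow> tensor_lift K V W X b (quot.coset f) = ext f"
  using quot.rcos_self quot.carrier_quotient_module by (intro tensor_lift_eq) auto

lemma tensor_lift_pure:
  "v \<in> carrier V \<Longrightarrow> w \<in> carrier W \<Longrightarrow> tensor_lift K V W X b (pure v w) = b v w"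
  using gen_closed
  by (simp add: pure_eq tensor_lift_coset module.linear_extension_free_gen[OF X case_prod_b])

lemma tensor_lift_hom: "tensor_lift K V W X b \<in> module_hom K T X"
proof -
  show ?thesis
    using module_hom_in[OF ext_hom] module_hom_add[OF ext_hom] module_hom_smult[OF ext_hom]
    by (intro module_homI)
      (auto simp: quot.carrier_quotient_module tensor_lift_coset quot.add_quotient_module
          quot.smult_quotient_module)
qed

end

end

text \<open>A map of four arguments that is linear in each of them extends to a bilinear map of two tensor
  products: first in the last pair of arguments, then in the first pair.  The bracket of
  \<open>L \<otimes> A\<close> and its action on \<open>M \<otimes> V\<close> are both of this kind.\<close>

definition tensor_lift2 where
  "tensor_lift2 K V W V' W' X Q Y Z =
    tensor_lift K V W X (\<lambda>v w. tensor_lift K V' W' X (Q v w) Z) Y"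

locale quadrilinear_map = S: tensor_factors K V W + T: tensor_factors K V' W' + X: module K X
  for K :: "('k, 'x) ring_scheme" and V :: "('k, 'v, 'y) module_scheme"
    and W :: "('k, 'w, 'z) module_scheme" and V' :: "('k, 'v', 'y') module_scheme"
    and W' :: "('k, 'w', 'z') module_scheme" and X :: "('k, 'u, 't) module_scheme" +
  fixes Q :: "'v \<Rightarrow> 'w \<Rightarrow> 'v' \<Rightarrow> 'w' \<Rightarrow> 'u"
  assumes left: "\<And>v' w'. v' \<in> carrier V' \<Longrightarrow> w' \<in> carrier W'
      \<Longrightarrow> (\<lambda>v w. Q v w v' w') \<in> bilinear_maps K V W X"
    and right: "\<And>v w. v \<in> carrier V \<Longrightarrow> w \<in> carrier W \<Longrightarrow> Q v w \<in> bilinear_maps K V' W' X"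
begin

lemma inner_pure:
  assumes "v \<in> carrier V" "w \<in> carrier W" "v' \<in> carrier V'" "w' \<in> carrier W'"
  shows "tensor_lift K V' W' X (Q v w) (T.pure v' w') = Q v w v' w'"
  using assms right by (simp add: T.tensor_lift_pure[OF X.module_axioms])

lemma inner_hom:
  assumes "v \<in> carrier V" "w \<in> carrier W"
  shows "tensor_lift K V' W' X (Q v w) \<in> module_hom K T.T X"
  using assms right by (simp add: T.tensor_lift_hom[OF X.module_axioms])

text \<open>The extension in the last two arguments remains bilinear in the first two: on a pure tensor this is
  the hypothesis on \<open>Q\<close>, and sums preserve it.\<close>

lemma inner_bilinear:
  assumes "Z \<in> carrier T.T"
  shows "(\<lambda>v w. tensor_lift K V' W' X (Q v w) Z) \<in> bilinear_maps K V W X"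
  using assms
proof (induct rule: T.tensor_induct)
  case (pure v' w')
  show ?case
    by (rule bilinear_cong[OF S.V.module_axioms S.W.module_axioms left[OF pure]])
      (simp add: inner_pure pure)
next
  case (add Y Z)
  show ?case
    by (rule bilinear_cong[OF S.V.module_axioms S.W.module_axioms
          bilinear_plus[OF X.module_axioms add(3,4)]])
      (simp add: module_hom_add[OF inner_hom] add)
qed

lemma tensor_lift2_left:
  "Z \<in> carrier T.T \<Longrightarrow> (\<lambda>Y. tensor_lift2 K V W V' W' X Q Y Z) \<in> module_hom K S.T X"
  unfolding tensor_lift2_def by (rule S.tensor_lift_hom[OF X.module_axioms inner_bilinear])

lemma tensor_lift2_pure_left:
  assumes "v \<in> carrier V" "w \<in> carrier W" "Z \<in> carrier T.T"
  shows "tensor_lift2 K V W V' W' X Q (S.pure v w) Z = tensor_lift K V' W' X (Q v w) Z"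
  using assms S.tensor_lift_pure[OF X.module_axioms inner_bilinear]
  unfolding tensor_lift2_def by simp

lemma tensor_lift2_bilinear: "tensor_lift2 K V W V' W' X Q \<in> bilinear_maps K S.T T.T X"
proof (rule bilinear_mapsI)
  fix Y assume "Y \<in> carrier S.T"
  then show "(\<lambda>Z. tensor_lift2 K V W V' W' X Q Y Z) \<in> module_hom K T.T X"
  proof (induct rule: S.tensor_induct)
    case (pure v w)
    show ?case
      by (rule module_hom_cong[OF T.tensor_module inner_hom[OF pure]])
        (simp add: tensor_lift2_pure_left pure)
  next
    case (add Y Y')
    show ?case
      by (rule module_hom_cong[OF T.tensor_module module_hom_plus[OF X.module_axioms add(3,4)]])
        (simp add: module_hom_add[OF tensor_lift2_left] add)
  qed
qed (rule tensor_lift2_left)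

lemma tensor_lift2_pure:
  assumes "v \<in> carrier V" "w \<in> carrier W" "v' \<in> carrier V'" "w' \<in> carrier W'"
  shows "tensor_lift2 K V W V' W' X Q (S.pure v w) (T.pure v' w') = Q v w v' w'"
  using assms by (simp add: tensor_lift2_pure_left inner_pure T.pure_closed)

text \<open>The double sum over representatives is the expression that \<open>current_bracket\<close> is made of.\<close>

lemma tensor_lift2_eq:
  assumes "Y \<in> carrier S.T" "Z \<in> carrier T.T" "f \<in> Y" "g \<in> Z"
  shows "tensor_lift2 K V W V' W' X Q Y Z =
    (\<Oplus>\<^bsub>X\<^esub>p\<in>support K (carrier V \<times> carrier W) f. \<Oplus>\<^bsub>X\<^esub>q\<in>support K (carrier V' \<times> carrier W') g.
      (f p \<otimes>\<^bsub>K\<^esub> g q) \<odot>\<^bsub>X\<^esub> Q (fst p) (snd p) (fst q) (snd q))"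
    (is "_ = (\<Oplus>\<^bsub>X\<^esub>p\<in>?A. \<Oplus>\<^bsub>X\<^esub>q\<in>?B. ?s p q)")
proof -
  have f: "f \<in> carrier S.F"
    using assms(1,3) S.quot.elemrcos_carrier by (auto simp: S.quot.carrier_quotient_module)
  have g: "g \<in> carrier T.F"
    using assms(2,4) T.quot.elemrcos_carrier by (auto simp: T.quot.carrier_quotient_module)
  have A: "?A \<subseteq> carrier V \<times> carrier W" and B: "finite ?B" "?B \<subseteq> carrier V' \<times> carrier W'"
    using g by (auto simp: support_def S.V.R.free_module_simps)
  have fK: "f p \<in> carrier K" if "p \<in> ?A" for p
    using that A f by (auto simp: S.V.R.free_module_simps)
  have gK: "g q \<in> carrier K" if "q \<in> ?B" for q
    using that B g by (auto simp: S.V.R.free_module_simps)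
  have A': "fst p \<in> carrier V" "snd p \<in> carrier W" if "p \<in> ?A" for p
    using that A by auto
  have B': "fst p \<in> carrier V'" "snd p \<in> carrier W'" if "p \<in> ?B" for p
    using that B by auto
  have Q: "Q (fst p) (snd p) (fst q) (snd q) \<in> carrier X" if "p \<in> ?A" "q \<in> ?B" for p q
    using that A' B' bilinear_in[OF right] by auto
  have inner: "f p \<odot>\<^bsub>X\<^esub> tensor_lift K V' W' X (Q (fst p) (snd p)) Z = (\<Oplus>\<^bsub>X\<^esub>q\<in>?B. ?s p q)"
    if p: "p \<in> ?A" for p
  proof -
    have "tensor_lift K V' W' X (Q (fst p) (snd p)) Z
        = (\<Oplus>\<^bsub>X\<^esub>q\<in>?B. g q \<odot>\<^bsub>X\<^esub> Q (fst p) (snd p) (fst q) (snd q))"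
      using right[OF A'[OF p]]
      by (subst T.tensor_lift_eq[OF X.module_axioms _ assms(2,4)])
        (auto simp: linear_extension_def case_prod_beta)
    then have "f p \<odot>\<^bsub>X\<^esub> tensor_lift K V' W' X (Q (fst p) (snd p)) Z
        = (\<Oplus>\<^bsub>X\<^esub>q\<in>?B. f p \<odot>\<^bsub>X\<^esub> (g q \<odot>\<^bsub>X\<^esub> Q (fst p) (snd p) (fst q) (snd q)))"
      using p fK gK Q B by (simp add: X.finsum_smult_ldistr)
    also have "\<dots> = (\<Oplus>\<^bsub>X\<^esub>q\<in>?B. ?s p q)"
      using p fK gK Q by (intro X.M.finsum_cong') (auto simp: X.smult_assoc1)
    finally show ?thesis .
  qed
  have "tensor_lift2 K V W V' W' X Q Y Z
      = (\<Oplus>\<^bsub>X\<^esub>p\<in>?A. f p \<odot>\<^bsub>X\<^esub> tensor_lift K V' W' X (Q (fst p) (snd p)) Z)"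
    unfolding tensor_lift2_def
    by (subst S.tensor_lift_eq[OF X.module_axioms inner_bilinear[OF assms(2)] assms(1,3)])
      (simp add: linear_extension_def case_prod_beta)
  also have "\<dots> = (\<Oplus>\<^bsub>X\<^esub>p\<in>?A. \<Oplus>\<^bsub>X\<^esub>q\<in>?B. ?s p q)"
    using inner fK gK Q by (intro X.M.finsum_cong') (auto intro!: X.M.finsum_closed)
  finally show ?thesis .
qed

end

section \<open>The current Lie algebra\<close>

lemma current_algebra_simps [simp]:
  "carrier (current_algebra K L A) = carrier (tensor_product K L A)"
  "zero (current_algebra K L A) = zero (tensor_product K L A)"
  "add (current_algebra K L A) = add (tensor_product K L A)"
  "smult (current_algebra K L A) = smult (tensor_product K L A)"
  "bracket (current_algebra K L A) = current_bracket K L A"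
  by (simp_all add: current_algebra_def module.defs)

text \<open>Being a module depends only on these four fields.  This passes the structure from a tensor product
  to the records that extend it by a bracket or by an action.\<close>

lemma module_transfer:
  assumes "module K V" "carrier V' = carrier V" "zero V' = zero V" "add V' = add V"
    "smult V' = smult V"
  shows "module K V'"
proof -
  interpret V: module K V by fact
  show ?thesis
    by (rule module_criteria) (use assms(2-) V.R.is_cring V.M.r_neg in
      \<open>auto simp: V.M.a_ac V.smult_assoc1 V.smult_l_distr V.smult_r_distr
        intro!: bexI[of _ "\<ominus>\<^bsub>V\<^esub> _"]\<close>)
qed

locale current_lie_algebra = L: lie_algebra K L + A: algebra K A
  for K :: "('k, 'x) ring_scheme" and L :: "('k, 'l, 'y) lie_alg_scheme"
    and A :: "('k, 'a, 'z) module_scheme"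
begin

sublocale tensor_factors K L A
  by unfold_locales

abbreviation LA :: "('k, ('l \<times> 'a \<Rightarrow> 'k) set) lie_alg" where
  "LA \<equiv> current_algebra K L A"

lemma bracket_bilinear: "bracket L \<in> bilinear_maps K L L L"
  by (intro bilinear_mapsI module_homI)
    (simp_all add: L.bracket_closed L.bracket_add_left L.bracket_add_right L.bracket_smult_left
      L.bracket_smult_right)

lemma smult_assoc_right:
  "c \<in> carrier K \<Longrightarrow> a \<in> carrier A \<Longrightarrow> b \<in> carrier A \<Longrightarrow> a \<otimes>\<^bsub>A\<^esub> (c \<odot>\<^bsub>A\<^esub> b) = c \<odot>\<^bsub>A\<^esub> (a \<otimes>\<^bsub>A\<^esub> b)"
  using A.smult_assoc2[of c b a] by (simp add: A.m_comm)

lemma mult_bilinear: "mult A \<in> bilinear_maps K A A A"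
  by (intro bilinear_mapsI module_homI)
    (simp_all add: A.l_distr A.r_distr A.smult_assoc2 smult_assoc_right)

sublocale bracket: quadrilinear_map K L A L A T "\<lambda>x a y b. pure (bracket L x y) (a \<otimes>\<^bsub>A\<^esub> b)"
proof
  fix x a assume "x \<in> carrier L" "a \<in> carrier A"
  then show "(\<lambda>y b. pure (bracket L y x) (b \<otimes>\<^bsub>A\<^esub> a)) \<in> bilinear_maps K L A T"
    "(\<lambda>y b. pure (bracket L x y) (a \<otimes>\<^bsub>A\<^esub> b)) \<in> bilinear_maps K L A T"
    using bilinear_comp_args[OF pure_bilinear bilinear_left[OF bracket_bilinear] bilinear_left[OF mult_bilinear]]
      bilinear_comp_args[OF pure_bilinear bilinear_right[OF bracket_bilinear] bilinear_right[OF mult_bilinear]]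
    by auto
qed

text \<open>All pairs of representatives contribute the same coset to the union in \<open>current_bracket\<close>,
  and there is at least one pair.\<close>

lemma current_bracket_eq:
  assumes "X \<in> carrier T" "Y \<in> carrier T"
  shows "current_bracket K L A X Y
    = tensor_lift2 K L A L A T (\<lambda>x a y b. pure (bracket L x y) (a \<otimes>\<^bsub>A\<^esub> b)) X Y"
    (is "_ = ?Z")
proof -
  have "X \<noteq> {}" "Y \<noteq> {}"
    using assms quot.rcos_self by (auto simp: quot.carrier_quotient_module)
  moreover have "(\<Oplus>\<^bsub>T\<^esub>p\<in>support K (carrier L \<times> carrier A) f. \<Oplus>\<^bsub>T\<^esub>q\<in>support K (carrier L \<times> carrier A) g.
      (f p \<otimes>\<^bsub>K\<^esub> g q) \<odot>\<^bsub>T\<^esub> pure (bracket L (fst p) (fst q)) (snd p \<otimes>\<^bsub>A\<^esub> snd q)) = ?Z"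
    if "f \<in> X" "g \<in> Y" for f g
    using bracket.tensor_lift2_eq[OF assms that] by simp
  ultimately show ?thesis
    unfolding current_bracket_def Let_def by simp
qed

lemma LA_module: "module K LA"
  by (rule module_transfer[OF tensor_module]) simp_all

lemma current_bracket_bilinear: "current_bracket K L A \<in> bilinear_maps K T T T"
  using bilinear_cong[OF tensor_module tensor_module bracket.tensor_lift2_bilinear]
  by (simp add: current_bracket_eq)

lemma current_bracket_pure:
  assumes "x \<in> carrier L" "a \<in> carrier A" "y \<in> carrier L" "b \<in> carrier A"
  shows "current_bracket K L A (pure x a) (pure y b) = pure (bracket L x y) (a \<otimes>\<^bsub>A\<^esub> b)"
  using assms by (simp add: current_bracket_eq pure_closed bracket.tensor_lift2_pure)

lemmas current_bracket_closed = bilinear_in[OF current_bracket_bilinear]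
  and current_bracket_simps = bilinear_simps[OF current_bracket_bilinear]

lemma pure_zero_left: "a \<in> carrier A \<Longrightarrow> pure \<zero>\<^bsub>L\<^esub> a = \<zero>\<^bsub>T\<^esub>"
  using module_hom_zero[OF L.module_axioms tensor_module bilinear_left[OF pure_bilinear]] .

lemma bracket_swap:
  assumes "x \<in> carrier L" "y \<in> carrier L"
  shows "bracket L x y \<oplus>\<^bsub>L\<^esub> bracket L y x = \<zero>\<^bsub>L\<^esub>"
proof -
  have "bracket L (x \<oplus>\<^bsub>L\<^esub> y) (x \<oplus>\<^bsub>L\<^esub> y) = \<zero>\<^bsub>L\<^esub>"
    using assms by (intro L.bracket_self) simp
  moreover have "bracket L (x \<oplus>\<^bsub>L\<^esub> y) (x \<oplus>\<^bsub>L\<^esub> y) = bracket L x y \<oplus>\<^bsub>L\<^esub> bracket L y x"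
    using assms by (subst L.bracket_add_left) (simp_all add: L.bracket_add_right L.bracket_self L.bracket_closed)
  ultimately show ?thesis by simp
qed

lemma current_bracket_swap:
  assumes "X \<in> carrier T" "Y \<in> carrier T"
  shows "current_bracket K L A X Y \<oplus>\<^bsub>T\<^esub> current_bracket K L A Y X = \<zero>\<^bsub>T\<^esub>"
  using assms
proof (induct arbitrary: Y rule: tensor_induct)
  case (pure x a)
  note xa = pure(1,2)
  show ?case using pure(3)
  proof (induct rule: tensor_induct)
    case (pure y b)
    with xa show ?case
      by (simp add: current_bracket_pure A.m_comm[of b a] pure_simps(1)[symmetric] L.bracket_closed
          bracket_swap pure_zero_left)
  next
    case (add Y Y')
    have "pure x a \<in> carrier T" using xa by (simp add: pure_closed)
    with add(1,2) have "current_bracket K L A (pure x a) (Y \<oplus>\<^bsub>T\<^esub> Y')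
        \<oplus>\<^bsub>T\<^esub> current_bracket K L A (Y \<oplus>\<^bsub>T\<^esub> Y') (pure x a)
      = (current_bracket K L A (pure x a) Y \<oplus>\<^bsub>T\<^esub> current_bracket K L A Y (pure x a))
        \<oplus>\<^bsub>T\<^esub> (current_bracket K L A (pure x a) Y' \<oplus>\<^bsub>T\<^esub> current_bracket K L A Y' (pure x a))"
      by (simp add: current_bracket_simps current_bracket_closed T.M.a_ac)
    with add(3,4) show ?case by simp
  qed
next
  case (add X X')
  have "current_bracket K L A (X \<oplus>\<^bsub>T\<^esub> X') Y \<oplus>\<^bsub>T\<^esub> current_bracket K L A Y (X \<oplus>\<^bsub>T\<^esub> X')
      = (current_bracket K L A X Y \<oplus>\<^bsub>T\<^esub> current_bracket K L A Y X)
        \<oplus>\<^bsub>T\<^esub> (current_bracket K L A X' Y \<oplus>\<^bsub>T\<^esub> current_bracket K L A Y X')"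
    using add(1,2,5) by (simp add: current_bracket_simps current_bracket_closed T.M.a_ac)
  with add(3-5) show ?case by simp
qed

text \<open>On a sum \<open>X + Y\<close> the cross terms \<open>[X, Y] + [Y, X]\<close> remain, so antisymmetry has to be
  known first.  It does not imply the assertion, as the characteristic may be 2.\<close>

lemma current_bracket_self:
  assumes "X \<in> carrier T"
  shows "current_bracket K L A X X = \<zero>\<^bsub>T\<^esub>"
  using assms
proof (induct rule: tensor_induct)
  case (pure x a)
  then show ?case by (simp add: current_bracket_pure L.bracket_self pure_zero_left)
next
  case (add X Y)
  have "current_bracket K L A (X \<oplus>\<^bsub>T\<^esub> Y) (X \<oplus>\<^bsub>T\<^esub> Y)
      = (current_bracket K L A X X \<oplus>\<^bsub>T\<^esub> current_bracket K L A Y Y)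
        \<oplus>\<^bsub>T\<^esub> (current_bracket K L A X Y \<oplus>\<^bsub>T\<^esub> current_bracket K L A Y X)"
    using add(1,2) by (simp add: current_bracket_simps current_bracket_closed T.M.a_ac)
  with add show ?case by (simp add: current_bracket_swap)
qed

text \<open>The Jacobi sum is additive in the first argument and invariant under rotation of the three
  arguments; this reduces the identity to pure tensors.  There the three products in \<open>A\<close> agree,
  and the Jacobi identity of \<open>L\<close> remains.\<close>

lemma current_jacobi:
  assumes "X \<in> carrier T" "Y \<in> carrier T" "Z \<in> carrier T"
  shows "current_bracket K L A X (current_bracket K L A Y Z)
      \<oplus>\<^bsub>T\<^esub> current_bracket K L A Y (current_bracket K L A Z X)
      \<oplus>\<^bsub>T\<^esub> current_bracket K L A Z (current_bracket K L A X Y) = \<zero>\<^bsub>T\<^esub>"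
    (is "?J X Y Z = _")
proof -
  note [simp] = current_bracket_simps current_bracket_closed
  have add1: "?J (X \<oplus>\<^bsub>T\<^esub> X') Y Z = ?J X Y Z \<oplus>\<^bsub>T\<^esub> ?J X' Y Z"
    if "X \<in> carrier T" "X' \<in> carrier T" "Y \<in> carrier T" "Z \<in> carrier T" for X X' Y Z
    using that by (simp add: T.M.a_ac)
  have rot: "?J X Y Z = ?J Y Z X" if "X \<in> carrier T" "Y \<in> carrier T" "Z \<in> carrier T" for X Y Z
    using that by (simp add: T.M.a_ac)
  have pures: "?J (pure x a) (pure y b) (pure z c) = \<zero>\<^bsub>T\<^esub>"
    if "x \<in> carrier L" "y \<in> carrier L" "z \<in> carrier L" "a \<in> carrier A" "b \<in> carrier A" "c \<in> carrier A"
    for x y z a b c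
  proof -
    have "b \<otimes>\<^bsub>A\<^esub> (c \<otimes>\<^bsub>A\<^esub> a) = a \<otimes>\<^bsub>A\<^esub> (b \<otimes>\<^bsub>A\<^esub> c)" "c \<otimes>\<^bsub>A\<^esub> (a \<otimes>\<^bsub>A\<^esub> b) = a \<otimes>\<^bsub>A\<^esub> (b \<otimes>\<^bsub>A\<^esub> c)"
      using that by (simp_all add: A.m_ac)
    then show ?thesis
      using that by (simp add: current_bracket_pure L.bracket_closed pure_simps(1)[symmetric]
          L.jacobi pure_zero_left)
  qed
  have 1: "?J (pure x a) (pure y b) Z = \<zero>\<^bsub>T\<^esub>"
    if "x \<in> carrier L" "y \<in> carrier L" "a \<in> carrier A" "b \<in> carrier A" "Z \<in> carrier T" for x y a b Z
    using that(5)
  proof (induct rule: tensor_induct)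
    case (pure z c)
    with that pures show ?case by blast
  next
    case (add Z Z')
    have P: "pure x a \<in> carrier T" "pure y b \<in> carrier T" using that by (auto intro: pure_closed)
    have "?J (pure x a) (pure y b) (Z \<oplus>\<^bsub>T\<^esub> Z') = ?J (Z \<oplus>\<^bsub>T\<^esub> Z') (pure x a) (pure y b)"
      using add P by (intro rot[symmetric]) auto
    also have "\<dots> = ?J Z (pure x a) (pure y b) \<oplus>\<^bsub>T\<^esub> ?J Z' (pure x a) (pure y b)"
      using add P by (intro add1) auto
    also have "\<dots> = \<zero>\<^bsub>T\<^esub>"
      using add P rot[of Z "pure x a" "pure y b"] rot[of Z' "pure x a" "pure y b"] by simp
    finally show ?case .
  qed
  have 2: "?J (pure x a) Y Z = \<zero>\<^bsub>T\<^esub>"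
    if "x \<in> carrier L" "a \<in> carrier A" "Y \<in> carrier T" "Z \<in> carrier T" for x a Y Z
    using that(3)
  proof (induct rule: tensor_induct)
    case (pure y b)
    with that 1 show ?case by blast
  next
    case (add Y Y')
    have P: "pure x a \<in> carrier T" using that by (auto intro: pure_closed)
    have "?J (pure x a) (Y \<oplus>\<^bsub>T\<^esub> Y') Z = ?J (Y \<oplus>\<^bsub>T\<^esub> Y') Z (pure x a)"
      using add P that by (intro rot) auto
    also have "\<dots> = ?J Y Z (pure x a) \<oplus>\<^bsub>T\<^esub> ?J Y' Z (pure x a)"
      using add P that by (intro add1) auto
    also have "\<dots> = \<zero>\<^bsub>T\<^esub>"
      using add P that rot[of "pure x a" Y Z] rot[of "pure x a" Y' Z] by simp
    finally show ?case .
  qed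
  show ?thesis using assms(1)
  proof (induct rule: tensor_induct)
    case (pure x a)
    with assms 2 show ?case by blast
  next
    case (add X X')
    then show ?case using add1[OF add(1,2) assms(2,3)] by simp
  qed
qed

theorem current_lie_algebra: "lie_algebra K LA"
proof -
  have "vectorspace K LA"
    using LA_module L.field_axioms by (simp add: vectorspace_def)
  then show ?thesis
    by (rule lie_algebra.intro)
      (simp add: lie_algebra_axioms_def current_bracket_simps current_bracket_closed
        current_bracket_self current_jacobi)
qed

end

section \<open>Tensor products of a Lie module and an algebra module\<close>

lemma restrict_scalars_simps [simp]:
  "carrier (restrict_scalars A V) = carrier V"
  "zero (restrict_scalars A V) = zero V"
  "add (restrict_scalars A V) = add V"
  "c \<odot>\<^bsub>restrict_scalars A V\<^esub> v = (c \<odot>\<^bsub>A\<^esub> \<one>\<^bsub>A\<^esub>) \<odot>\<^bsub>V\<^esub> v"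
  by (simp_all add: restrict_scalars_def)

lemma restrict_scalars_module:
  assumes "algebra K A" "module A V"
  shows "module K (restrict_scalars A V)"
proof -
  interpret A: algebra K A by fact
  interpret V: module A V by fact
  have "(c \<otimes>\<^bsub>K\<^esub> d) \<odot>\<^bsub>A\<^esub> \<one>\<^bsub>A\<^esub> = (c \<odot>\<^bsub>A\<^esub> \<one>\<^bsub>A\<^esub>) \<otimes>\<^bsub>A\<^esub> (d \<odot>\<^bsub>A\<^esub> \<one>\<^bsub>A\<^esub>)"
    if "c \<in> carrier K" "d \<in> carrier K" for c d
    using that by (simp add: A.smult_assoc2 A.smult_assoc1)
  then show ?thesis
    by (intro module_criteria)
      (use A.R.is_cring V.M.r_neg in \<open>auto simp: V.M.a_ac V.smult_assoc1 V.smult_l_distr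
        V.smult_r_distr A.smult_l_distr intro!: bexI[of _ "\<ominus>\<^bsub>V\<^esub> _"]\<close>)
qed

lemma module_hom_restrict_scalars:
  assumes "algebra K A" "b \<in> module_hom A V W"
  shows "b \<in> module_hom K (restrict_scalars A V) (restrict_scalars A W)"
proof -
  interpret A: algebra K A by fact
  show ?thesis using assms(2) by (auto simp: module_hom_def)
qed

definition tensor_lie_module ::
    "('k, 'x) ring_scheme \<Rightarrow> ('k, 'l, 'y) lie_alg_scheme \<Rightarrow> ('k, 'l, 'm, 'z) lie_mod_scheme
      \<Rightarrow> ('k, 'a, 't) module_scheme \<Rightarrow> ('a, 'v, 'u) module_scheme
      \<Rightarrow> ('k, ('l \<times> 'a \<Rightarrow> 'k) set, ('m \<times> 'v \<Rightarrow> 'k) set) lie_mod" where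
  "tensor_lie_module K L M A V =
    (let V' = restrict_scalars A V; T = tensor_product K M V' in
     module.extend T
       \<lparr>lie_act = tensor_lift2 K L A M V' T
         (\<lambda>x a m v. pure_tensor K M V' (lie_act M x m) (a \<odot>\<^bsub>V\<^esub> v))\<rparr>)"

lemma tensor_lie_module_simps [simp]:
  "carrier (tensor_lie_module K L M A V) = carrier (tensor_product K M (restrict_scalars A V))"
  "zero (tensor_lie_module K L M A V) = zero (tensor_product K M (restrict_scalars A V))"
  "add (tensor_lie_module K L M A V) = add (tensor_product K M (restrict_scalars A V))"
  "smult (tensor_lie_module K L M A V) = smult (tensor_product K M (restrict_scalars A V))"
  by (simp_all add: tensor_lie_module_def module.defs Let_def)

locale lie_module_tensor = lie_module K L M + A: algebra K A + V: module A V
  for K :: "('k, 'x) ring_scheme" and L :: "('k, 'l, 'y) lie_alg_scheme"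
    and M :: "('k, 'l, 'm, 'z) lie_mod_scheme"
    and A :: "('k, 'a, 't) module_scheme" and V :: "('a, 'v, 'u) module_scheme"
begin

abbreviation VK :: "('k, 'v) module" where
  "VK \<equiv> restrict_scalars A V"

abbreviation N :: "('k, ('l \<times> 'a \<Rightarrow> 'k) set, ('m \<times> 'v \<Rightarrow> 'k) set) lie_mod" where
  "N \<equiv> tensor_lie_module K L M A V"

sublocale LA: current_lie_algebra K L A
  by unfold_locales

sublocale VK: module K VK
  by (rule restrict_scalars_module[OF A.algebra_axioms V.module_axioms])

sublocale MV: tensor_factors K M VK
  by unfold_locales

lemma act_bilinear: "lie_act M \<in> bilinear_maps K L M M"
  by (intro bilinear_mapsI module_homI)
    (simp_all add: act_closed act_add_left act_add_right act_smult_left act_smult_right)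

lemma smult_one_mult:
  "c \<in> carrier K \<Longrightarrow> a \<in> carrier A \<Longrightarrow> (c \<odot>\<^bsub>A\<^esub> \<one>\<^bsub>A\<^esub>) \<otimes>\<^bsub>A\<^esub> a = c \<odot>\<^bsub>A\<^esub> a"
  by (simp add: A.smult_assoc2)

lemma smult_bilinear: "smult V \<in> bilinear_maps K A VK VK"
proof (intro bilinear_mapsI module_homI)
  fix c a v assume "c \<in> carrier K" "a \<in> carrier A" "v \<in> carrier VK"
  then show "(c \<odot>\<^bsub>A\<^esub> a) \<odot>\<^bsub>V\<^esub> v = c \<odot>\<^bsub>VK\<^esub> (a \<odot>\<^bsub>V\<^esub> v)"
    "a \<odot>\<^bsub>V\<^esub> (c \<odot>\<^bsub>VK\<^esub> v) = c \<odot>\<^bsub>VK\<^esub> (a \<odot>\<^bsub>V\<^esub> v)"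
    by (simp_all add: V.smult_assoc1[symmetric] smult_one_mult A.m_comm[of a])
qed (simp_all add: V.smult_l_distr V.smult_r_distr)

sublocale act: quadrilinear_map K L A M VK MV.T "\<lambda>x a m v. MV.pure (lie_act M x m) (a \<odot>\<^bsub>V\<^esub> v)"
proof
  fix m v assume "m \<in> carrier M" "v \<in> carrier VK"
  then show "(\<lambda>x a. MV.pure (lie_act M x m) (a \<odot>\<^bsub>V\<^esub> v)) \<in> bilinear_maps K L A MV.T"
    by (rule bilinear_comp_args[OF MV.pure_bilinear bilinear_left[OF act_bilinear]
          bilinear_left[OF smult_bilinear]])
next
  fix x a assume "x \<in> carrier L" "a \<in> carrier A"
  then show "(\<lambda>m v. MV.pure (lie_act M x m) (a \<odot>\<^bsub>V\<^esub> v)) \<in> bilinear_maps K M VK MV.T"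
    by (rule bilinear_comp_args[OF MV.pure_bilinear bilinear_right[OF act_bilinear]
          bilinear_right[OF smult_bilinear]])
qed

lemma lie_act_N_bilinear: "lie_act N \<in> bilinear_maps K LA.T MV.T MV.T"
  using act.tensor_lift2_bilinear by (simp add: tensor_lie_module_def Let_def module.defs)

lemma lie_act_N_pure:
  assumes "x \<in> carrier L" "a \<in> carrier A" "m \<in> carrier M" "v \<in> carrier V"
  shows "lie_act N (LA.pure x a) (MV.pure m v) = MV.pure (lie_act M x m) (a \<odot>\<^bsub>V\<^esub> v)"
  using act.tensor_lift2_pure[of x a m v] assms by (simp add: tensor_lie_module_def Let_def module.defs)

lemmas lie_act_N_closed = bilinear_in[OF lie_act_N_bilinear]
  and lie_act_N_simps = bilinear_simps[OF lie_act_N_bilinear]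

lemma N_module: "module K N"
  by (rule module_transfer[OF MV.tensor_module]) simp_all

text \<open>With the subtracted term moved to the left, both sides are sums of compositions of additive maps,
  which reduces the identity to pure tensors.  There it is the identity of \<open>M\<close> tensored with
  \<open>a b v\<close>, as \<open>A\<close> is commutative.\<close>

lemma lie_act_N_bracket:
  assumes "X \<in> carrier LA.T" "Y \<in> carrier LA.T" "w \<in> carrier MV.T"
  shows "lie_act N (current_bracket K L A X Y) w \<oplus>\<^bsub>MV.T\<^esub> lie_act N Y (lie_act N X w)
    = lie_act N X (lie_act N Y w)"
proof -
  note [simp] = LA.current_bracket_simps LA.current_bracket_closed lie_act_N_closed lie_act_N_simps
    MV.pure_closed LA.pure_closed
  have pures: "lie_act N (current_bracket K L A (LA.pure x a) (LA.pure y b)) (MV.pure m v)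
      \<oplus>\<^bsub>MV.T\<^esub> lie_act N (LA.pure y b) (lie_act N (LA.pure x a) (MV.pure m v))
    = lie_act N (LA.pure x a) (lie_act N (LA.pure y b) (MV.pure m v))"
    if "x \<in> carrier L" "a \<in> carrier A" "y \<in> carrier L" "b \<in> carrier A" "m \<in> carrier M" "v \<in> carrier V"
    for x a y b m v
  proof -
    have "b \<odot>\<^bsub>V\<^esub> (a \<odot>\<^bsub>V\<^esub> v) = (a \<otimes>\<^bsub>A\<^esub> b) \<odot>\<^bsub>V\<^esub> v" "a \<odot>\<^bsub>V\<^esub> (b \<odot>\<^bsub>V\<^esub> v) = (a \<otimes>\<^bsub>A\<^esub> b) \<odot>\<^bsub>V\<^esub> v"
      using that by (simp_all add: V.smult_assoc1[symmetric] A.m_comm)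
    moreover have "lie_act M (bracket L x y) m \<oplus>\<^bsub>M\<^esub> lie_act M y (lie_act M x m)
        = lie_act M x (lie_act M y m)"
      using that by (simp add: act_bracket act_closed M.module.M.minus_eq M.module.M.a_assoc M.module.M.l_neg)
    ultimately show ?thesis
      using that by (simp add: LA.current_bracket_pure lie_act_N_pure bracket_closed act_closed
          MV.pure_simps(1)[symmetric])
  qed
  have 1: "lie_act N (current_bracket K L A (LA.pure x a) (LA.pure y b)) w
      \<oplus>\<^bsub>MV.T\<^esub> lie_act N (LA.pure y b) (lie_act N (LA.pure x a) w)
    = lie_act N (LA.pure x a) (lie_act N (LA.pure y b) w)"
    if "x \<in> carrier L" "a \<in> carrier A" "y \<in> carrier L" "b \<in> carrier A" "w \<in> carrier MV.T" for x a y b w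
    using that(5)
  proof (induct rule: MV.tensor_induct)
    case (pure m v)
    with that pures show ?case by simp
  next
    case (add w w')
    with that show ?case
      by (simp add: add(3,4)[symmetric]) (simp add: MV.T.M.a_ac)
  qed
  have 2: "lie_act N (current_bracket K L A (LA.pure x a) Y) w
      \<oplus>\<^bsub>MV.T\<^esub> lie_act N Y (lie_act N (LA.pure x a) w)
    = lie_act N (LA.pure x a) (lie_act N Y w)"
    if "x \<in> carrier L" "a \<in> carrier A" "Y \<in> carrier LA.T" "w \<in> carrier MV.T" for x a Y w
    using that(3)
  proof (induct rule: LA.tensor_induct)
    case (pure y b)
    with that 1 show ?case by blast
  next
    case (add Y Y')
    with that show ?case
      by (simp add: add(3,4)[symmetric]) (simp add: MV.T.M.a_ac)
  qed
  show ?thesis using assms(1)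
  proof (induct rule: LA.tensor_induct)
    case (pure x a)
    with assms 2 show ?case by blast
  next
    case (add X X')
    with assms show ?case
      by (simp add: add(3,4)[symmetric]) (simp add: MV.T.M.a_ac)
  qed
qed

theorem N_lie_module: "lie_module K LA.LA N"
proof -
  have vs: "vectorspace K N"
    using N_module field_axioms by (simp add: vectorspace_def)
  interpret N: vectorspace K N by (rule vs)
  have "lie_act N (current_bracket K L A X Y) w
      = lie_act N X (lie_act N Y w) \<ominus>\<^bsub>N\<^esub> lie_act N Y (lie_act N X w)"
    if "X \<in> carrier LA.T" "Y \<in> carrier LA.T" "w \<in> carrier MV.T" for X Y w
    using that lie_act_N_bracket[OF that]
    by (intro N.module.M.eq_minusI) (simp_all add: lie_act_N_closed LA.current_bracket_closed)
  then show ?thesis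
    using vs LA.current_lie_algebra
    by (intro lie_module.intro lie_module_axioms.intro)
      (simp_all add: lie_act_N_closed lie_act_N_simps)
qed

end

section \<open>Multilinear maps on tuples\<close>

lemma tuples_length: "xs \<in> tuples L n \<Longrightarrow> length xs = n"
  by (simp add: tuples_def)

lemma tuples_nth: "xs \<in> tuples L n \<Longrightarrow> i < n \<Longrightarrow> xs ! i \<in> carrier L"
  by (auto simp: tuples_def)

lemma tuples_update: "xs \<in> tuples L n \<Longrightarrow> x \<in> carrier L \<Longrightarrow> xs[i := x] \<in> tuples L n"
  using set_update_subset_insert[of xs i x] by (auto simp: tuples_def)

lemma tuples_map: "xs \<in> tuples L n \<Longrightarrow> (\<And>x. x \<in> carrier L \<Longrightarrow> f x \<in> carrier L') \<Longrightarrow> map f xs \<in> tuples L' n"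
  by (auto simp: tuples_def)

lemma tuples_Cons: "x # xs \<in> tuples L (Suc n) \<longleftrightarrow> x \<in> carrier L \<and> xs \<in> tuples L n"
  by (auto simp: tuples_def)

lemma length_nths_compl:
  assumes "I \<subseteq> {..<length xs}"
  shows "length (nths xs (- I)) = length xs - card I"
proof -
  have "{i. i < length xs \<and> i \<in> - I} = {..<length xs} - I" by auto
  then show ?thesis
    using assms by (simp add: length_nths card_Diff_subset finite_subset)
qed

lemma nths_update_notin: "k \<notin> I \<Longrightarrow> nths (xs[k := x]) I = nths xs I"
proof (induct xs arbitrary: k I)
  case (Cons y ys)
  then show ?case by (cases k) (auto simp: nths_Cons)
qed simp

text \<open>The position \<open>k'\<close> does not depend on \<open>x\<close>: a map that is linear in each entry of the
  shorter list is therefore linear in the entry \<open>k\<close> of the longer one.\<close>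

lemma nths_update_in:
  "k < length xs \<Longrightarrow> k \<in> I \<Longrightarrow>
    \<exists>k'<length (nths xs I). \<forall>x. nths (xs[k := x]) I = (nths xs I)[k' := x]"
proof (induct xs arbitrary: k I)
  case (Cons y ys)
  show ?case
  proof (cases k)
    case 0
    with Cons.prems show ?thesis by (auto simp: nths_Cons intro!: exI[of _ 0])
  next
    case (Suc l)
    with Cons obtain k' where k': "k' < length (nths ys {j. Suc j \<in> I})"
      "\<And>x. nths (ys[l := x]) {j. Suc j \<in> I} = (nths ys {j. Suc j \<in> I})[k' := x]"
      by (auto dest: Cons.hyps[of l "{j. Suc j \<in> I}"])
    show ?thesis
      using Suc k' by (intro exI[of _ "if 0 \<in> I then Suc k' else k'"]) (auto simp: nths_Cons)
  qed
qed simp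

lemma tuples_nths_one:
  assumes "xs \<in> tuples L (Suc n)" "i \<le> n"
  shows "nths xs (- {i}) \<in> tuples L n"
  using assms set_nths_subset[of xs "- {i}"] length_nths_compl[of "{i}" xs]
  by (auto simp: tuples_def)

lemma tuples_nths_two:
  assumes "xs \<in> tuples L (Suc n)" "j \<le> n" "i < j" "x \<in> carrier L"
  shows "x # nths xs (- {i, j}) \<in> tuples L n"
proof -
  have "length (nths xs (- {i, j})) = n - 1"
    using assms length_nths_compl[of "{i, j}" xs] by (simp add: tuples_def)
  moreover have "set (nths xs (- {i, j})) \<subseteq> carrier L"
    using assms(1) set_nths_subset[of xs "- {i, j}"] by (auto simp: tuples_def)
  moreover have "Suc (n - 1) = n" using assms(2,3) by linarith
  ultimately show ?thesis using assms(4) by (simp add: tuples_def)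
qed

definition multilinear_maps ::
    "('k, 'x) ring_scheme \<Rightarrow> ('k, 't, 'y) module_scheme \<Rightarrow> ('k, 'u, 'z) module_scheme
      \<Rightarrow> nat \<Rightarrow> ('t list \<Rightarrow> 'u) set" where
  "multilinear_maps K T X n =
    {G \<in> tuples T n \<rightarrow> carrier X.
      \<forall>us\<in>tuples T n. \<forall>i<n. (\<lambda>u. G (us[i := u])) \<in> module_hom K T X}"

lemma alternating_maps_eq:
  "alternating_maps K L M n =
    {f \<in> multilinear_maps K L M n. \<forall>xs\<in>tuples L n. \<not> distinct xs \<longrightarrow> f xs = \<zero>\<^bsub>M\<^esub>}"
  by (auto simp: alternating_maps_def multilinear_maps_def)

lemma multilinear_in: "G \<in> multilinear_maps K T X n \<Longrightarrow> us \<in> tuples T n \<Longrightarrow> G us \<in> carrier X"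
  by (auto simp: multilinear_maps_def)

lemma multilinear_hom:
  "G \<in> multilinear_maps K T X n \<Longrightarrow> us \<in> tuples T n \<Longrightarrow> i < n
    \<Longrightarrow> (\<lambda>u. G (us[i := u])) \<in> module_hom K T X"
  by (auto simp: multilinear_maps_def)

lemma multilinear_nths_one:
  assumes G: "G \<in> multilinear_maps K T X n"
    and us: "us \<in> tuples T (Suc n)" and "i \<le> n" "k < Suc n" "k \<noteq> i"
  shows "(\<lambda>u. G (nths (us[k := u]) (- {i}))) \<in> module_hom K T X"
proof -
  have "k < length us" "k \<in> - {i}" using assms by (auto simp: tuples_length)
  from nths_update_in[OF this] obtain k' where k': "k' < length (nths us (- {i}))"
    "\<And>u. nths (us[k := u]) (- {i}) = (nths us (- {i}))[k' := u]"
    by blast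
  have nt: "nths us (- {i}) \<in> tuples T n" using us \<open>i \<le> n\<close> by (rule tuples_nths_one)
  then show ?thesis
    using multilinear_hom[OF G nt] k' by (simp add: tuples_length)
qed

lemma multilinear_nths_two:
  assumes G: "G \<in> multilinear_maps K T X n"
    and us: "us \<in> tuples T (Suc n)" and ij: "j \<le> n" "i < j" and k: "k < Suc n" "k \<noteq> i" "k \<noteq> j"
    and x: "x \<in> carrier T"
  shows "(\<lambda>u. G (x # nths (us[k := u]) (- {i, j}))) \<in> module_hom K T X"
proof -
  have "k < length us" "k \<in> - {i, j}" using assms by (auto simp: tuples_length)
  from nths_update_in[OF this] obtain k' where k': "k' < length (nths us (- {i, j}))"
    "\<And>u. nths (us[k := u]) (- {i, j}) = (nths us (- {i, j}))[k' := u]"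
    by blast
  have nt: "x # nths us (- {i, j}) \<in> tuples T n" using us ij x by (rule tuples_nths_two)
  then have "Suc k' < n" using k'(1) by (auto simp: tuples_def)
  then show ?thesis
    using multilinear_hom[OF G nt, of "Suc k'"] k' by simp
qed

lemma multilinear_Cons:
  assumes "G \<in> multilinear_maps K T X n" "x # us \<in> tuples T n" "f \<in> module_hom K S T"
  shows "(\<lambda>u. G (f u # us)) \<in> module_hom K S X"
proof -
  have "0 < n" using assms(2) by (auto simp: tuples_def)
  from multilinear_hom[OF assms(1,2) this] have "(\<lambda>u. G (u # us)) \<in> module_hom K T X" by simp
  with assms(3) show ?thesis by (rule module_hom_comp)
qed

lemma multilinear_cong:
  assumes "module K T" and G: "G \<in> multilinear_maps K T X n"
    and eq: "\<And>us. us \<in> tuples T n \<Longrightarrow> H us = G us"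
  shows "H \<in> multilinear_maps K T X n"
proof -
  have "(\<lambda>u. H (us[i := u])) \<in> module_hom K T X" if "us \<in> tuples T n" "i < n" for us i
    by (rule module_hom_cong[OF assms(1) multilinear_hom[OF G that]])
      (use that in \<open>simp add: eq tuples_update\<close>)
  then show ?thesis using G eq by (simp add: multilinear_maps_def Pi_iff)
qed

lemma alternating_maps_cong:
  assumes "module K L" "f \<in> alternating_maps K L M n"
    and "\<And>xs. xs \<in> tuples L n \<Longrightarrow> g xs = f xs"
  shows "g \<in> alternating_maps K L M n"
  using multilinear_cong[OF assms(1), of f M n g] assms(2,3) by (simp add: alternating_maps_eq)

lemma multilinear_plus:
  assumes "module K X" "F \<in> multilinear_maps K T X n" "G \<in> multilinear_maps K T X n"
  shows "(\<lambda>us. F us \<oplus>\<^bsub>X\<^esub> G us) \<in> multilinear_maps K T X n"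
proof -
  interpret X: module K X by fact
  have "(\<lambda>u. F (us[i := u]) \<oplus>\<^bsub>X\<^esub> G (us[i := u])) \<in> module_hom K T X" if "us \<in> tuples T n" "i < n" for us i
    using assms that by (intro module_hom_plus) (auto intro: multilinear_hom)
  then show ?thesis
    using assms(2,3) by (simp add: multilinear_maps_def Pi_iff)
qed

lemma multilinear_smult:
  assumes "module K X" "c \<in> carrier K" "G \<in> multilinear_maps K T X n"
  shows "(\<lambda>us. c \<odot>\<^bsub>X\<^esub> G us) \<in> multilinear_maps K T X n"
proof -
  interpret X: module K X by fact
  have "(\<lambda>u. c \<odot>\<^bsub>X\<^esub> G (us[i := u])) \<in> module_hom K T X" if "us \<in> tuples T n" "i < n" for us i
    using assms that by (intro module_hom_smult') (auto intro: multilinear_hom)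
  then show ?thesis
    using assms(2,3) by (simp add: multilinear_maps_def Pi_iff)
qed

text \<open>Expansion of the value at the tuple with \<open>x + y\<close> in both positions, which is zero.\<close>

lemma alternating_swap:
  assumes "module K L" "module K M" and f: "f \<in> alternating_maps K L M n"
    and xs: "xs \<in> tuples L n" and ij: "i < n" "j < n" "i \<noteq> j"
    and x: "x \<in> carrier L" and y: "y \<in> carrier L"
  shows "f (xs[i := x, j := y]) \<oplus>\<^bsub>M\<^esub> f (xs[i := y, j := x]) = \<zero>\<^bsub>M\<^esub>"
proof -
  interpret L: module K L by fact
  interpret M: module K M by fact
  have G: "f \<in> multilinear_maps K L M n" using f by (simp add: alternating_maps_eq)
  have add_j: "f (xs[i := u, j := x \<oplus>\<^bsub>L\<^esub> y]) = f (xs[i := u, j := x]) \<oplus>\<^bsub>M\<^esub> f (xs[i := u, j := y])"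
    if "u \<in> carrier L" for u
    using module_hom_add[OF multilinear_hom[OF G tuples_update[OF xs that] ij(2)] x y] .
  have add_i: "f (xs[i := x \<oplus>\<^bsub>L\<^esub> y, j := u]) = f (xs[i := x, j := u]) \<oplus>\<^bsub>M\<^esub> f (xs[i := y, j := u])"
    if "u \<in> carrier L" for u
    using module_hom_add[OF multilinear_hom[OF G tuples_update[OF xs that] ij(1)] x y] ij(3)
    by (simp add: list_update_swap)
  have zero: "f (xs[i := u, j := u]) = \<zero>\<^bsub>M\<^esub>" if "u \<in> carrier L" for u
  proof -
    have "\<not> distinct (xs[i := u, j := u])"
      using ij tuples_length[OF xs] nth_eq_iff_index_eq[of "xs[i := u, j := u]" i j] by auto
    then show ?thesis using f xs that by (simp add: alternating_maps_def tuples_update)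
  qed
  have in_M: "f (xs[i := u, j := w]) \<in> carrier M" if "u \<in> carrier L" "w \<in> carrier L" for u w
    using G xs that by (intro multilinear_in[OF G]) (simp add: tuples_update)
  have "\<zero>\<^bsub>M\<^esub> = f (xs[i := x \<oplus>\<^bsub>L\<^esub> y, j := x \<oplus>\<^bsub>L\<^esub> y])" using zero x y by simp
  also have "\<dots> = f (xs[i := x, j := y]) \<oplus>\<^bsub>M\<^esub> f (xs[i := y, j := x])"
    using x y in_M by (simp add: add_i add_j zero[OF x] zero[OF y] M.M.a_comm)
  finally show ?thesis ..
qed

section \<open>Cochains and coboundaries\<close>

context lie_module
begin

lemmas M_module = M.module.module_axioms
  and L_module = L.module.module_axioms

lemma alternating_maps_zero: "(\<lambda>xs\<in>tuples L n. \<zero>\<^bsub>M\<^esub>) \<in> alternating_maps K L M n"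
  by (rule alternating_maps_cong[OF L_module, where f = "\<lambda>xs. \<zero>\<^bsub>M\<^esub>"])
    (auto simp: alternating_maps_def module_hom_const_zero[OF M_module])

lemma alternating_maps_add:
  assumes f: "f \<in> alternating_maps K L M n" and g: "g \<in> alternating_maps K L M n"
  shows "(\<lambda>xs\<in>tuples L n. f xs \<oplus>\<^bsub>M\<^esub> g xs) \<in> alternating_maps K L M n"
proof -
  have "(\<lambda>x. f (xs[i := x]) \<oplus>\<^bsub>M\<^esub> g (xs[i := x])) \<in> module_hom K L M"
    if "xs \<in> tuples L n" "i < n" for xs i
    using f g that by (intro module_hom_plus[OF M_module]) (simp_all add: alternating_maps_def)
  then have "(\<lambda>xs. f xs \<oplus>\<^bsub>M\<^esub> g xs) \<in> alternating_maps K L M n"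
    using f g by (simp add: alternating_maps_def Pi_iff)
  then show ?thesis by (rule alternating_maps_cong[OF L_module]) simp
qed

lemma alternating_maps_smult:
  assumes c: "c \<in> carrier K" and f: "f \<in> alternating_maps K L M n"
  shows "(\<lambda>xs\<in>tuples L n. c \<odot>\<^bsub>M\<^esub> f xs) \<in> alternating_maps K L M n"
proof -
  have "(\<lambda>x. c \<odot>\<^bsub>M\<^esub> f (xs[i := x])) \<in> module_hom K L M"
    if "xs \<in> tuples L n" "i < n" for xs i
    using c f that by (intro module_hom_smult'[OF M_module]) (simp_all add: alternating_maps_def)
  then have "(\<lambda>xs. c \<odot>\<^bsub>M\<^esub> f xs) \<in> alternating_maps K L M n"
    using c f by (simp add: alternating_maps_def Pi_iff)
  then show ?thesis by (rule alternating_maps_cong[OF L_module]) simp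
qed

lemma cochains_module: "module K (cochains K L M n)"
  unfolding cochains_def
  by (rule function_module_is_module[OF M_module])
    (simp_all add: alternating_maps_zero alternating_maps_add alternating_maps_smult,
      simp add: alternating_maps_def Pi_iff)

lemma cochains_simps:
  "carrier (cochains K L M n) = alternating_maps K L M n \<inter> extensional (tuples L n)"
  "\<zero>\<^bsub>cochains K L M n\<^esub> = (\<lambda>xs\<in>tuples L n. \<zero>\<^bsub>M\<^esub>)"
  "f \<oplus>\<^bsub>cochains K L M n\<^esub> g = (\<lambda>xs\<in>tuples L n. f xs \<oplus>\<^bsub>M\<^esub> g xs)"
  "c \<odot>\<^bsub>cochains K L M n\<^esub> f = (\<lambda>xs\<in>tuples L n. c \<odot>\<^bsub>M\<^esub> f xs)"
  by (simp_all add: cochains_def)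

abbreviation sign :: "nat \<Rightarrow> 'k" where
  "sign i \<equiv> (\<ominus>\<^bsub>K\<^esub> \<one>\<^bsub>K\<^esub>) [^]\<^bsub>K\<^esub> i"

abbreviation act_term :: "('l list \<Rightarrow> 'm) \<Rightarrow> 'l list \<Rightarrow> nat \<Rightarrow> 'm" where
  "act_term f xs i \<equiv> lie_act M (xs ! i) (f (nths xs (- {i})))"

abbreviation bracket_term :: "('l list \<Rightarrow> 'm) \<Rightarrow> 'l list \<Rightarrow> nat \<Rightarrow> nat \<Rightarrow> 'm" where
  "bracket_term f xs i j \<equiv> f (bracket L (xs ! i) (xs ! j) # nths xs (- {i, j}))"

lemma sign_closed: "sign i \<in> carrier K"
  by simp

lemma coboundary_eq:
  "xs \<in> tuples L (Suc n) \<Longrightarrow> coboundary K L M n f xs =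
    (\<Oplus>\<^bsub>M\<^esub>i\<in>{..n}. sign i \<odot>\<^bsub>M\<^esub> act_term f xs i)
    \<oplus>\<^bsub>M\<^esub> (\<Oplus>\<^bsub>M\<^esub>j\<in>{..n}. \<Oplus>\<^bsub>M\<^esub>i\<in>{..<j}. sign (i + j) \<odot>\<^bsub>M\<^esub> bracket_term f xs i j)"
  by (simp add: coboundary_def)

lemma act_hom_left: "m \<in> carrier M \<Longrightarrow> (\<lambda>x. lie_act M x m) \<in> module_hom K L M"
  by (rule module_homI) (auto simp: act_closed act_add_left act_smult_left)

lemma act_hom_right: "x \<in> carrier L \<Longrightarrow> (\<lambda>m. lie_act M x m) \<in> module_hom K M M"
  by (rule module_homI) (auto simp: act_closed act_add_right act_smult_right)

lemma bracket_hom_left: "y \<in> carrier L \<Longrightarrow> (\<lambda>x. bracket L x y) \<in> module_hom K L L"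
  by (rule module_homI) (auto simp: bracket_closed bracket_add_left bracket_smult_left)

lemma bracket_hom_right: "x \<in> carrier L \<Longrightarrow> (\<lambda>y. bracket L x y) \<in> module_hom K L L"
  by (rule module_homI) (auto simp: bracket_closed bracket_add_right bracket_smult_right)

lemma coboundary_eval_hom:
  assumes xs: "xs \<in> tuples L (Suc n)"
  shows "(\<lambda>f. coboundary K L M n f xs) \<in> module_hom K (cochains K L M n) M"
proof -
  have eval: "(\<lambda>f. f ys) \<in> module_hom K (cochains K L M n) M" if "ys \<in> tuples L n" for ys
    using that by (intro module_homI) (auto simp: cochains_simps alternating_maps_def)
  have "(\<lambda>f. (\<Oplus>\<^bsub>M\<^esub>i\<in>{..n}. sign i \<odot>\<^bsub>M\<^esub> act_term f xs i)
      \<oplus>\<^bsub>M\<^esub> (\<Oplus>\<^bsub>M\<^esub>j\<in>{..n}. \<Oplus>\<^bsub>M\<^esub>i\<in>{..<j}. sign (i + j) \<odot>\<^bsub>M\<^esub> bracket_term f xs i j))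
    \<in> module_hom K (cochains K L M n) M"
    using xs
    by (intro module_hom_plus[OF M_module] module_hom_sum[OF cochains_module M_module]
        module_hom_smult'[OF M_module] sign_closed
        module_hom_comp[OF eval act_hom_right] eval)
      (auto intro!: tuples_nths_one tuples_nths_two tuples_nth bracket_closed)
  then show ?thesis
    using xs by (simp add: coboundary_eq)
qed

lemma coboundary_extensional: "coboundary K L M n f \<in> extensional (tuples L (Suc n))"
  by (simp add: coboundary_def)

text \<open>In each summand of the coboundary the entry \<open>k\<close> occurs exactly once: as the acting element, in
  the bracket, or as an entry of the argument of \<open>f\<close>.  The coboundary is thus multilinear as soon
  as \<open>f\<close> is; on a tensor product it can be computed on pure tensors.\<close>

lemma coboundary_slot_hom:
  assumes f: "f \<in> multilinear_maps K L M n" and xs: "xs \<in> tuples L (Suc n)" and k: "k < Suc n"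
  shows "(\<lambda>x. coboundary K L M n f (xs[k := x])) \<in> module_hom K L M"
proof -
  note len = tuples_length[OF xs]
  have act: "(\<lambda>x. act_term f (xs[k := x]) i) \<in> module_hom K L M"
    if i: "i \<le> n" for i
  proof (cases "i = k")
    case True
    then show ?thesis
      using act_hom_left[OF multilinear_in[OF f tuples_nths_one[OF xs i]]] k len
      by (simp add: nths_update_notin)
  next
    case False
    then have "(\<lambda>x. f (nths (xs[k := x]) (- {i}))) \<in> module_hom K L M"
      using f xs i k by (intro multilinear_nths_one) auto
    from module_hom_comp[OF this act_hom_right[of "xs ! i"]]
    show ?thesis using False i xs by (simp add: tuples_nth)
  qed
  have brk: "(\<lambda>x. bracket_term f (xs[k := x]) i j) \<in> module_hom K L M" if j: "j \<le> n" "i < j" for i j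
  proof -
    have xij: "xs ! i \<in> carrier L" "xs ! j \<in> carrier L" using xs j by (auto intro: tuples_nth)
    note tup = tuples_nths_two[OF xs j bracket_closed[OF xij]]
    consider "k = i" | "k = j" | "k \<noteq> i" "k \<noteq> j" by blast
    then show ?thesis
    proof cases
      case 1
      then show ?thesis
        using multilinear_Cons[OF f tup bracket_hom_left[OF xij(2)]] j k len
        by (simp add: nths_update_notin)
    next
      case 2
      then show ?thesis
        using multilinear_Cons[OF f tup bracket_hom_right[OF xij(1)]] j k len
        by (simp add: nths_update_notin)
    next
      case 3
      then show ?thesis
        using multilinear_nths_two[OF f xs j k 3 bracket_closed[OF xij]] by simp
    qed
  qed
  have "(\<lambda>x. (\<Oplus>\<^bsub>M\<^esub>i\<in>{..n}. sign i \<odot>\<^bsub>M\<^esub> act_term f (xs[k := x]) i)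
      \<oplus>\<^bsub>M\<^esub> (\<Oplus>\<^bsub>M\<^esub>j\<in>{..n}. \<Oplus>\<^bsub>M\<^esub>i\<in>{..<j}. sign (i + j) \<odot>\<^bsub>M\<^esub> bracket_term f (xs[k := x]) i j))
    \<in> module_hom K L M"
    using act brk
    by (intro module_hom_plus[OF M_module] module_hom_sum[OF L_module M_module]
        module_hom_smult'[OF M_module] sign_closed) auto
  then show ?thesis
    by (rule module_hom_cong[OF L_module]) (use xs in \<open>simp add: coboundary_eq tuples_update\<close>)
qed

end

section \<open>Functoriality of cohomology\<close>

context lie_module
begin

lemma coboundary_zero:
  "coboundary K L M n \<zero>\<^bsub>cochains K L M n\<^esub> = (\<lambda>xs\<in>tuples L (Suc n). \<zero>\<^bsub>M\<^esub>)"
  by (rule extensionalityI[OF coboundary_extensional restrict_extensional])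
    (use module_hom_zero[OF cochains_module M_module coboundary_eval_hom] in simp)

text \<open>The coboundaries are regarded inside the module of all functions on tuples, where they form a
  submodule independently of the identity \<open>d d = 0\<close>.  The cosets of the
  cocycles in that quotient are the elements of the cohomology.\<close>

lemma coboundaries_submodule:
  "submodule K (coboundaries K L M n) (function_module (tuples L n) M (tuples L n \<rightarrow> carrier M))"
    (is "submodule K _ ?E")
proof -
  have E: "module K ?E"
    by (rule function_module_is_module[OF M_module]) (auto simp: Pi_iff)
  show ?thesis
  proof (cases n)
    case 0
    then show ?thesis
      using E by (auto simp: submodule_def coboundaries_def cochains_simps fun_eq_iff)
  next
    case (Suc k)
    let ?C = "cochains K L M k" and ?d = "coboundary K L M k"
    have "?d \<in> module_hom K ?C ?E"
      unfolding Suc by (rule module_hom_function_module[OF coboundary_extensional coboundary_eval_hom])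
    then interpret mod_hom K ?C ?E ?d
      using cochains_module E by (simp add: mod_hom_def mod_hom_axioms_def)
    show ?thesis using im_is_submodule Suc by (simp add: coboundaries_def im_def)
  qed
qed

lemma zero_in_cocycles: "\<zero>\<^bsub>cochains K L M n\<^esub> \<in> cocycles K L M n"
proof -
  interpret C: module K "cochains K L M n" by (rule cochains_module)
  show ?thesis
    unfolding cocycles_def mem_Collect_eq coboundary_zero by (simp add: cochains_simps alternating_maps_zero)
qed

theorem cohomologically_nontrivial_iff:
  "cohomologically_nontrivial K L M \<longleftrightarrow>
    (\<exists>n. \<exists>f\<in>cocycles K L M n. f \<notin> coboundaries K L M n)"
proof -
  have "carrier (cohomology K L M n) \<noteq> {\<zero>\<^bsub>cohomology K L M n\<^esub>} \<longleftrightarrow>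
      (\<exists>f\<in>cocycles K L M n. f \<notin> coboundaries K L M n)" for n
  proof -
    let ?E = "function_module (tuples L n) M (tuples L n \<rightarrow> carrier M)"
    interpret E: quotient_of_module K ?E "coboundaries K L M n"
      using coboundaries_submodule[of n]
      by (simp add: quotient_of_module_def quotient_of_module_axioms_def submodule_def)
    have sub: "cocycles K L M n \<subseteq> carrier ?E"
      by (auto simp: cocycles_def cochains_simps alternating_maps_def)
    have "carrier (cohomology K L M n) = E.coset ` cocycles K L M n"
      by (auto simp: cohomology_def quotient_module_def A_RCOSETS_def' a_r_coset_def' cochains_def)
    moreover have "\<zero>\<^bsub>cohomology K L M n\<^esub> = coboundaries K L M n"
      by (simp add: cohomology_def quotient_module_def)
    moreover have "E.coset f = coboundaries K L M n \<longleftrightarrow> f \<in> coboundaries K L M n"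
      if "f \<in> cocycles K L M n" for f
      using that sub E.coset_eq_self_iff by blast
    moreover have "cocycles K L M n \<noteq> {}" using zero_in_cocycles by blast
    moreover have "c ` Z \<noteq> {B} \<longleftrightarrow> (\<exists>f\<in>Z. c f \<noteq> B)" if "Z \<noteq> {}"
      for c :: "('l list \<Rightarrow> 'm) \<Rightarrow> ('l list \<Rightarrow> 'm) set" and Z B
      using that by auto
    ultimately show ?thesis by simp
  qed
  then show ?thesis by (simp add: cohomologically_nontrivial_def)
qed

end

text \<open>A linear map carries one coboundary to another if it matches the two kinds of summands.  The tuples,
  the algebras and the modules on both sides may differ; this covers restriction along a homomorphism
  of Lie algebras as well as the passage from \<open>L\<close> to \<open>L \<otimes> A\<close>.\<close>

lemma hom_coboundary:
  assumes "lie_module K L M" "lie_module K L' N" and h: "h \<in> module_hom K M N"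
    and xs: "xs \<in> tuples L (Suc n)" and ys: "ys \<in> tuples L' (Suc n)"
    and f: "\<And>zs. zs \<in> tuples L n \<Longrightarrow> f zs \<in> carrier M"
    and act: "\<And>i. i \<le> n \<Longrightarrow>
      h (lie_act M (xs ! i) (f (nths xs (- {i})))) = lie_act N (ys ! i) (g (nths ys (- {i})))"
    and brk: "\<And>i j. j \<le> n \<Longrightarrow> i < j \<Longrightarrow>
      h (f (bracket L (xs ! i) (xs ! j) # nths xs (- {i, j})))
        = g (bracket L' (ys ! i) (ys ! j) # nths ys (- {i, j}))"
  shows "h (coboundary K L M n f xs) = coboundary K L' N n g ys"
proof -
  interpret M: lie_module K L M by fact
  interpret N: lie_module K L' N by fact
  note sum = module_hom_finsum_cong[OF M.M_module N.M_module h]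
  have a: "M.act_term f xs i \<in> carrier M" if "i \<le> n" for i
    using that by (intro M.act_closed tuples_nth[OF xs] f tuples_nths_one[OF xs]) simp_all
  have b: "M.bracket_term f xs i j \<in> carrier M" if "j \<le> n" "i < j" for i j
    using that by (intro f tuples_nths_two[OF xs] M.bracket_closed tuples_nth[OF xs]) simp_all
  have "h (\<Oplus>\<^bsub>M\<^esub>i\<in>{..n}. M.sign i \<odot>\<^bsub>M\<^esub> M.act_term f xs i)
      = (\<Oplus>\<^bsub>N\<^esub>i\<in>{..n}. M.sign i \<odot>\<^bsub>N\<^esub> N.act_term g ys i)"
    using a by (intro sum) (simp_all add: module_hom_smult[OF h M.sign_closed] act)
  moreover have "h (\<Oplus>\<^bsub>M\<^esub>j\<in>{..n}. \<Oplus>\<^bsub>M\<^esub>i\<in>{..<j}. M.sign (i + j) \<odot>\<^bsub>M\<^esub> M.bracket_term f xs i j)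
      = (\<Oplus>\<^bsub>N\<^esub>j\<in>{..n}. \<Oplus>\<^bsub>N\<^esub>i\<in>{..<j}. M.sign (i + j) \<odot>\<^bsub>N\<^esub> N.bracket_term g ys i j)"
    using b by (intro sum M.M.finsum_closed) (simp_all add: module_hom_smult[OF h M.sign_closed] brk Pi_iff)
  ultimately show ?thesis
    using a b
    by (simp add: M.coboundary_eq[OF xs] N.coboundary_eq[OF ys] module_hom_add[OF h] M.M.finsum_closed Pi_iff)
qed

definition pullback :: "('k, 'l, 'y) lie_alg_scheme \<Rightarrow> ('l \<Rightarrow> 'l2) \<Rightarrow> ('n \<Rightarrow> 'm) \<Rightarrow> nat
    \<Rightarrow> ('l2 list \<Rightarrow> 'n) \<Rightarrow> 'l list \<Rightarrow> 'm" where
  "pullback L \<iota> h n f = (\<lambda>xs\<in>tuples L n. h (f (map \<iota> xs)))"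

text \<open>Cohomology is functorial in the pair of the algebra and the module, contravariantly in the algebra:
  \<open>h\<close> is a homomorphism of \<open>L\<close>-modules when \<open>N\<close> is viewed as an \<open>L\<close>-module along
  \<open>\<iota>\<close>.\<close>

locale compatible_pair = M: lie_module K L M + N: lie_module K L' N
  for K :: "('k, 'x) ring_scheme" and L :: "('k, 'l, 'y) lie_alg_scheme"
    and M :: "('k, 'l, 'm, 'z) lie_mod_scheme"
    and L' :: "('k, 'l2, 'y2) lie_alg_scheme" and N :: "('k, 'l2, 'n, 'z2) lie_mod_scheme" +
  fixes \<iota> :: "'l \<Rightarrow> 'l2" and h :: "'n \<Rightarrow> 'm"
  assumes \<iota>_hom: "\<iota> \<in> module_hom K L L'"
    and \<iota>_bracket: "\<And>x y. x \<in> carrier L \<Longrightarrow> y \<in> carrier L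
      \<Longrightarrow> \<iota> (bracket L x y) = bracket L' (\<iota> x) (\<iota> y)"
    and h_hom: "h \<in> module_hom K N M"
    and h_act: "\<And>x w. x \<in> carrier L \<Longrightarrow> w \<in> carrier N \<Longrightarrow> h (lie_act N (\<iota> x) w) = lie_act M x (h w)"
begin

lemma map_\<iota>: "xs \<in> tuples L n \<Longrightarrow> map \<iota> xs \<in> tuples L' n"
  by (rule tuples_map) (auto intro: module_hom_in[OF \<iota>_hom])

lemma pullback_cochain:
  assumes f: "f \<in> alternating_maps K L' N n"
  shows "pullback L \<iota> h n f \<in> carrier (cochains K L M n)"
proof -
  have "(\<lambda>x. h (f (map \<iota> (xs[i := x])))) \<in> module_hom K L M" if "xs \<in> tuples L n" "i < n" for xs i
  proof -
    have "(\<lambda>y. f ((map \<iota> xs)[i := y])) \<in> module_hom K L' N"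
      using f map_\<iota>[OF that(1)] that(2) by (simp add: alternating_maps_def)
    from module_hom_comp[OF module_hom_comp[OF \<iota>_hom this] h_hom]
    show ?thesis by (simp add: map_update)
  qed
  moreover have "h \<zero>\<^bsub>N\<^esub> = \<zero>\<^bsub>M\<^esub>" using module_hom_zero[OF N.M_module M.M_module h_hom] .
  ultimately have "(\<lambda>xs. h (f (map \<iota> xs))) \<in> alternating_maps K L M n"
    using f map_\<iota> module_hom_in[OF h_hom]
    by (simp add: alternating_maps_def Pi_iff distinct_map)
  then have "pullback L \<iota> h n f \<in> alternating_maps K L M n"
    by (rule alternating_maps_cong[OF M.L_module]) (simp add: pullback_def)
  then show ?thesis by (simp add: M.cochains_simps pullback_def)
qed

lemma coboundary_pullback:
  assumes f: "f \<in> alternating_maps K L' N n"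
  shows "coboundary K L M n (pullback L \<iota> h n f) = pullback L \<iota> h (Suc n) (coboundary K L' N n f)"
proof
  fix xs
  show "coboundary K L M n (pullback L \<iota> h n f) xs = pullback L \<iota> h (Suc n) (coboundary K L' N n f) xs"
  proof (cases "xs \<in> tuples L (Suc n)")
    case False
    then show ?thesis by (simp add: coboundary_def pullback_def)
  next
    case xs: True
    have fN: "f ys \<in> carrier N" if "ys \<in> tuples L' n" for ys
      using f that by (simp add: alternating_maps_def Pi_iff)
    have xi: "xs ! i \<in> carrier L" "map \<iota> xs ! i = \<iota> (xs ! i)" if "i \<le> n" for i
      using that xs by (simp_all add: tuples_nth tuples_length)
    have "h (coboundary K L' N n f (map \<iota> xs)) = coboundary K L M n (pullback L \<iota> h n f) xs"
    proof (rule hom_coboundary[OF N.lie_module_axioms M.lie_module_axioms h_hom map_\<iota>[OF xs] xs fN])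
      fix i assume i: "i \<le> n"
      from fN[OF tuples_nths_one[OF map_\<iota>[OF xs] i]] tuples_nths_one[OF xs i]
      show "h (lie_act N (map \<iota> xs ! i) (f (nths (map \<iota> xs) (- {i}))))
          = lie_act M (xs ! i) (pullback L \<iota> h n f (nths xs (- {i})))"
        by (simp add: xi[OF i] h_act pullback_def nths_map)
    next
      fix i j assume ij: "j \<le> n" "i < j"
      then have "bracket L (xs ! i) (xs ! j) # nths xs (- {i, j}) \<in> tuples L n"
        by (intro tuples_nths_two[OF xs] M.bracket_closed xi) simp_all
      then show "h (f (bracket L' (map \<iota> xs ! i) (map \<iota> xs ! j) # nths (map \<iota> xs) (- {i, j})))
          = pullback L \<iota> h n f (bracket L (xs ! i) (xs ! j) # nths xs (- {i, j}))"
        using ij xi[of i] xi[of j] by (simp add: pullback_def nths_map \<iota>_bracket)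
    qed
    then show ?thesis using xs by (simp add: pullback_def)
  qed
qed

lemma pullback_cocycle:
  assumes "f \<in> cocycles K L' N n"
  shows "pullback L \<iota> h n f \<in> cocycles K L M n"
proof -
  have f: "f \<in> alternating_maps K L' N n" and "coboundary K L' N n f = (\<lambda>xs\<in>tuples L' (Suc n). \<zero>\<^bsub>N\<^esub>)"
    using assms by (auto simp: cocycles_def N.cochains_simps)
  then have "coboundary K L M n (pullback L \<iota> h n f) = (\<lambda>xs\<in>tuples L (Suc n). \<zero>\<^bsub>M\<^esub>)"
    using map_\<iota> module_hom_zero[OF N.M_module M.M_module h_hom]
    by (simp add: coboundary_pullback) (simp add: pullback_def fun_eq_iff)
  then show ?thesis
    using pullback_cochain[OF f] by (simp add: cocycles_def M.cochains_simps)
qed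

lemma pullback_coboundary:
  assumes "f \<in> coboundaries K L' N n"
  shows "pullback L \<iota> h n f \<in> coboundaries K L M n"
proof (cases n)
  case 0
  then show ?thesis
    using assms map_\<iota> module_hom_zero[OF N.M_module M.M_module h_hom]
    by (auto simp: coboundaries_def M.cochains_simps N.cochains_simps pullback_def fun_eq_iff)
next
  case (Suc k)
  with assms obtain g where g: "g \<in> carrier (cochains K L' N k)" "f = coboundary K L' N k g"
    by (auto simp: coboundaries_def)
  then have "pullback L \<iota> h n f = coboundary K L M k (pullback L \<iota> h k g)"
    using Suc by (simp add: coboundary_pullback N.cochains_simps)
  moreover have "pullback L \<iota> h k g \<in> carrier (cochains K L M k)"
    using g(1) by (intro pullback_cochain) (simp add: N.cochains_simps)
  ultimately show ?thesis using Suc by (auto simp: coboundaries_def)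
qed

end

lemma lie_module_iso_inverse:
  assumes "lie_module K L M" "lie_module K L N" "lie_module_iso K L M N"
  obtains g h where "g \<in> lie_module_hom K L M N" "h \<in> lie_module_hom K L N M"
    and "\<And>m. m \<in> carrier M \<Longrightarrow> h (g m) = m" "\<And>w. w \<in> carrier N \<Longrightarrow> g (h w) = w"
proof -
  interpret M: lie_module K L M by fact
  interpret N: lie_module K L N by fact
  obtain g where g: "g \<in> lie_module_hom K L M N" "bij_betw g (carrier M) (carrier N)"
    using assms(3) by (auto simp: lie_module_iso_def)
  then have g_hom: "g \<in> module_hom K M N"
    and g_act: "\<And>x m. x \<in> carrier L \<Longrightarrow> m \<in> carrier M \<Longrightarrow> g (lie_act M x m) = lie_act N x (g m)"
    by (auto simp: lie_module_hom_def)
  define h where "h = the_inv_into (carrier M) g"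
  have hg: "h (g m) = m" if "m \<in> carrier M" for m
    using that g(2) by (simp add: h_def bij_betw_def the_inv_into_f_f)
  have gh: "g (h w) = w" "h w \<in> carrier M" if "w \<in> carrier N" for w
    using that g(2) by (auto simp: h_def f_the_inv_into_f_bij_betw bij_betw_def intro: the_inv_into_into)
  have "h \<in> module_hom K N M"
  proof (rule module_homI)
    fix v w assume "v \<in> carrier N" "w \<in> carrier N"
    then show "h (v \<oplus>\<^bsub>N\<^esub> w) = h v \<oplus>\<^bsub>M\<^esub> h w"
      using gh hg[of "h v \<oplus>\<^bsub>M\<^esub> h w"] by (simp add: module_hom_add[OF g_hom])
  next
    fix c w assume "c \<in> carrier K" "w \<in> carrier N"
    then show "h (c \<odot>\<^bsub>N\<^esub> w) = c \<odot>\<^bsub>M\<^esub> h w"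
      using gh hg[of "c \<odot>\<^bsub>M\<^esub> h w"] by (simp add: module_hom_smult[OF g_hom])
  qed (rule gh)
  moreover have "h (lie_act N x w) = lie_act M x (h w)" if "x \<in> carrier L" "w \<in> carrier N" for x w
    using that gh hg[of "lie_act M x (h w)"] g_act[of x "h w"] by (simp add: M.act_closed)
  ultimately have "h \<in> lie_module_hom K L N M" by (simp add: lie_module_hom_def)
  with g(1) show thesis using hg gh(1) by (rule that)
qed

text \<open>The cochains of \<open>N\<close> are those of \<open>M\<close> composed with the isomorphism; a coboundary on the
  \<open>N\<close> side would be sent to a coboundary by the inverse.\<close>

lemma cohomologically_nontrivial_iso:
  assumes "lie_module K L M" "lie_module K L N" "lie_module_iso K L M N"
    and "cohomologically_nontrivial K L M"
  shows "cohomologically_nontrivial K L N"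
proof -
  interpret M: lie_module K L M by fact
  interpret N: lie_module K L N by fact
  obtain g h where g: "g \<in> lie_module_hom K L M N" and h: "h \<in> lie_module_hom K L N M"
    and hg: "\<And>m. m \<in> carrier M \<Longrightarrow> h (g m) = m"
    using lie_module_iso_inverse[OF assms(1-3)] by metis
  interpret push: compatible_pair K L N L M "\<lambda>x. x" g
    by unfold_locales (use g in \<open>auto simp: module_hom_id lie_module_hom_def\<close>)
  interpret pull: compatible_pair K L M L N "\<lambda>x. x" h
    by unfold_locales (use h in \<open>auto simp: module_hom_id lie_module_hom_def\<close>)
  from assms(4) obtain n f where f: "f \<in> cocycles K L M n" "f \<notin> coboundaries K L M n"
    by (auto simp: M.cohomologically_nontrivial_iff)
  have "pullback L (\<lambda>x. x) h n (pullback L (\<lambda>x. x) g n f) = f"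
    using f(1) by (auto simp: pullback_def cocycles_def M.cochains_simps alternating_maps_def
        fun_eq_iff extensional_def hg Pi_iff)
  with f push.pullback_cocycle[OF f(1)] pull.pullback_coboundary
  show ?thesis unfolding N.cohomologically_nontrivial_iff by metis
qed

lemma lie_module_iso_sym:
  assumes "lie_module K L M" "lie_module K L N" "lie_module_iso K L M N"
  shows "lie_module_iso K L N M"
proof -
  obtain g h where "g \<in> lie_module_hom K L M N" and h: "h \<in> lie_module_hom K L N M"
    and "\<And>m. m \<in> carrier M \<Longrightarrow> h (g m) = m" "\<And>w. w \<in> carrier N \<Longrightarrow> g (h w) = w"
    using lie_module_iso_inverse[OF assms] by metis
  then have "bij_betw h (carrier N) (carrier M)"
    by (intro bij_betw_byWitness[where f' = g]) (auto simp: lie_module_hom_def intro: module_hom_in)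
  with h show ?thesis by (auto simp: lie_module_iso_def)
qed

lemma lie_module_iso_trans:
  assumes "lie_module_iso K L M N" "lie_module_iso K L N P"
  shows "lie_module_iso K L M P"
proof -
  obtain f where f: "f \<in> lie_module_hom K L M N" "bij_betw f (carrier M) (carrier N)"
    using assms(1) by (auto simp: lie_module_iso_def)
  obtain g where g: "g \<in> lie_module_hom K L N P" "bij_betw g (carrier N) (carrier P)"
    using assms(2) by (auto simp: lie_module_iso_def)
  have "(\<lambda>m. g (f m)) \<in> lie_module_hom K L M P"
    using f(1) g(1) by (auto simp: lie_module_hom_def module_hom_in[of f K M N] intro: module_hom_comp)
  moreover have "bij_betw (\<lambda>m. g (f m)) (carrier M) (carrier P)"
    using bij_betw_trans[OF f(2) g(2)] by (simp add: o_def)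
  ultimately show ?thesis unfolding lie_module_iso_def by blast
qed

section \<open>Multilinear maps on tensor products\<close>

context tensor_factors
begin

definition is_pure :: "('v \<times> 'w \<Rightarrow> 'k) set \<Rightarrow> bool" where
  "is_pure u \<longleftrightarrow> u \<in> case_prod pure ` (carrier V \<times> carrier W)"

text \<open>The positions in \<open>J\<close> are released one at a time from the requirement to hold pure tensors: for
  fixed other entries, \<open>G\<close> is additive in the released one.\<close>

lemma vanish_on_slots:
  assumes X: "module K X" and J: "J \<subseteq> {..<n}"
    and hom: "\<And>us k. us \<in> tuples T n \<Longrightarrow> k \<in> J \<Longrightarrow> (\<lambda>u. G (us[k := u])) \<in> module_hom K T X"
    and pures: "\<And>us. us \<in> tuples T n \<Longrightarrow> \<forall>k\<in>J. is_pure (us ! k) \<Longrightarrow> G us = \<zero>\<^bsub>X\<^esub>"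
    and us: "us \<in> tuples T n"
  shows "G us = \<zero>\<^bsub>X\<^esub>"
proof -
  interpret X: module K X by fact
  have fin: "finite J" using J finite_subset by blast
  have "\<forall>us\<in>tuples T n. (\<forall>k\<in>J - I. is_pure (us ! k)) \<longrightarrow> G us = \<zero>\<^bsub>X\<^esub>" if "I \<subseteq> J" for I
    using finite_subset[OF that fin] that
  proof (induct I rule: finite_induct)
    case empty
    then show ?case using pures by simp
  next
    case (insert k I)
    show ?case
    proof (intro ballI impI)
      fix us assume us: "us \<in> tuples T n" and p: "\<forall>l\<in>J - insert k I. is_pure (us ! l)"
      have k: "k \<in> J" "k < length us" using insert.prems us J by (auto simp: tuples_length)
      have "G (us[k := u]) = \<zero>\<^bsub>X\<^esub>" if "u \<in> carrier T" for u
        using that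
      proof (induct rule: tensor_induct)
        case (pure v w)
        then have "is_pure (us[k := pure v w] ! l)" if "l \<in> J - I" for l
          using p that k by (cases "l = k") (auto simp: is_pure_def)
        moreover have "us[k := pure v w] \<in> tuples T n"
          using us pure by (simp add: tuples_update pure_closed)
        ultimately show ?case using insert by auto
      next
        case (add u u')
        then show ?case using module_hom_add[OF hom[OF us k(1)] add(1,2)] by simp
      qed
      from this[of "us ! k"] show "G us = \<zero>\<^bsub>X\<^esub>"
        using us k J by (auto intro: tuples_nth)
    qed
  qed
  from this[of J] us show ?thesis by simp
qed

lemma pure_tuple:
  assumes "us \<in> tuples T n" "\<forall>k<n. is_pure (us ! k)"
  obtains ps where "ps \<in> lists (carrier V \<times> carrier W)" "length ps = n" "us = map (case_prod pure) ps"
proof -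
  have "us \<in> lists (case_prod pure ` (carrier V \<times> carrier W))"
    using assms by (auto simp: in_lists_conv_set in_set_conv_nth tuples_length is_pure_def)
  then obtain ps where "ps \<in> lists (carrier V \<times> carrier W)" "us = map (case_prod pure) ps"
    unfolding lists_image by blast
  with that tuples_length[OF assms(1)] show ?thesis by simp
qed

lemma map_pure_tuple:
  "ps \<in> lists (carrier V \<times> carrier W) \<Longrightarrow> length ps = n \<Longrightarrow> map (case_prod pure) ps \<in> tuples T n"
  by (auto simp: tuples_def in_lists_conv_set intro!: pure_closed)

lemma multilinear_eqI:
  assumes X: "module K X" and E: "E \<in> multilinear_maps K T X n" and G: "G \<in> multilinear_maps K T X n"
    and eq: "\<And>ps. ps \<in> lists (carrier V \<times> carrier W) \<Longrightarrow> length ps = n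
      \<Longrightarrow> E (map (case_prod pure) ps) = G (map (case_prod pure) ps)"
    and us: "us \<in> tuples T n"
  shows "E us = G us"
proof -
  interpret X: module K X by fact
  let ?m = "\<ominus>\<^bsub>K\<^esub> \<one>\<^bsub>K\<^esub>"
  have mG: "?m \<odot>\<^bsub>X\<^esub> G us = \<ominus>\<^bsub>X\<^esub> G us" if "us \<in> tuples T n" for us
    using multilinear_in[OF G that] by (simp add: X.smult_l_minus)
  have D: "(\<lambda>us. E us \<oplus>\<^bsub>X\<^esub> ?m \<odot>\<^bsub>X\<^esub> G us) \<in> multilinear_maps K T X n"
    using E G by (intro multilinear_plus[OF X] multilinear_smult[OF X]) auto
  have "E us \<oplus>\<^bsub>X\<^esub> ?m \<odot>\<^bsub>X\<^esub> G us = \<zero>\<^bsub>X\<^esub>"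
  proof (rule vanish_on_slots[OF X order.refl])
    fix us assume us: "us \<in> tuples T n" "\<forall>k\<in>{..<n}. is_pure (us ! k)"
    from us(2) have "\<forall>k<n. is_pure (us ! k)" by simp
    then obtain ps where ps: "ps \<in> lists (carrier V \<times> carrier W)" "length ps = n"
      "us = map (case_prod pure) ps" by (rule pure_tuple[OF us(1)])
    with eq us(1) show "E us \<oplus>\<^bsub>X\<^esub> ?m \<odot>\<^bsub>X\<^esub> G us = \<zero>\<^bsub>X\<^esub>"
      using multilinear_in[OF G us(1)] by (simp add: mG X.M.r_neg)
  qed (use us multilinear_hom[OF D] in auto)
  then have "E us \<ominus>\<^bsub>X\<^esub> G us = \<zero>\<^bsub>X\<^esub>" using us by (simp add: mG X.M.minus_eq)
  then show ?thesis
    using multilinear_in[OF E us] multilinear_in[OF G us] by simp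
qed

text \<open>The universal property of the tensor power of a tensor product, for maps given on lists of pairs.
  By induction on \<open>n\<close>, the values with first pair \<open>(v, w)\<close> extend to a multilinear map of the
  remaining arguments.\<close>

lemma multilinear_extension:
  assumes X: "module K X"
    and in_X: "\<And>ps. ps \<in> lists (carrier V \<times> carrier W) \<Longrightarrow> length ps = n \<Longrightarrow> \<beta> ps \<in> carrier X"
    and bil: "\<And>ps i. ps \<in> lists (carrier V \<times> carrier W) \<Longrightarrow> length ps = n \<Longrightarrow> i < n
      \<Longrightarrow> (\<lambda>v w. \<beta> (ps[i := (v, w)])) \<in> bilinear_maps K V W X"
  shows "\<exists>G\<in>multilinear_maps K T X n.
    \<forall>ps\<in>lists (carrier V \<times> carrier W). length ps = n \<longrightarrow> G (map (case_prod pure) ps) = \<beta> ps"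
  using in_X bil
proof (induct n arbitrary: \<beta>)
  case 0
  then show ?case
    by (intro bexI[of _ "\<lambda>_. \<beta> []"]) (auto simp: multilinear_maps_def)
next
  case (Suc n)
  interpret X: module K X by fact
  let ?S = "lists (carrier V \<times> carrier W)"
  let ?P = "\<lambda>v w G. G \<in> multilinear_maps K T X n \<and>
      (\<forall>ps\<in>?S. length ps = n \<longrightarrow> G (map (case_prod pure) ps) = \<beta> ((v, w) # ps))"
  have ex: "\<exists>G. ?P v w G" if vw: "v \<in> carrier V" "w \<in> carrier W" for v w
  proof -
    have "(\<lambda>v' w'. \<beta> ((v, w) # ps[i := (v', w')])) \<in> bilinear_maps K V W X"
      if "ps \<in> ?S" "length ps = n" "i < n" for ps i
      using Suc.prems(2)[of "(v, w) # ps" "Suc i"] vw that by simp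
    then have "\<exists>G\<in>multilinear_maps K T X n. \<forall>ps\<in>?S. length ps = n \<longrightarrow>
        G (map (case_prod pure) ps) = \<beta> ((v, w) # ps)"
      using vw by (intro Suc.hyps Suc.prems(1)) auto
    then show ?thesis by blast
  qed
  define G where "G v w = (SOME G. ?P v w G)" for v w
  have G: "?P v w (G v w)" if "v \<in> carrier V" "w \<in> carrier W" for v w
    unfolding G_def using ex[OF that] by (rule someI_ex)
  have Gm: "G v w \<in> multilinear_maps K T X n" if "v \<in> carrier V" "w \<in> carrier W" for v w
    using G[OF that] by blast
  have Geq: "G v w (map (case_prod pure) ps) = \<beta> ((v, w) # ps)"
    if "v \<in> carrier V" "w \<in> carrier W" "ps \<in> ?S" "length ps = n" for v w ps
    using G[OF that(1,2)] that(3,4) by blast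
  have head: "(\<lambda>v w. \<beta> ((v, w) # ps)) \<in> bilinear_maps K V W X" if "ps \<in> ?S" "length ps = n" for ps
    using Suc.prems(2)[of "(\<zero>\<^bsub>V\<^esub>, \<zero>\<^bsub>W\<^esub>) # ps" 0] that by simp
  note head_simps = bilinear_simps[OF head]
  \<comment> \<open>A multilinear map is determined by its values on pure tensors, so the extensions inherit
  bilinearity in \<open>(v, w)\<close> from \<open>\<beta>\<close>; now the first argument can be lifted.\<close>
  have bilG: "(\<lambda>v w. G v w us) \<in> bilinear_maps K V W X" if us: "us \<in> tuples T n" for us
  proof (intro bilinear_mapsI module_homI)
    fix v v' w assume v: "v \<in> carrier V" "v' \<in> carrier V" "w \<in> carrier W"
    show "G (v \<oplus>\<^bsub>V\<^esub> v') w us = G v w us \<oplus>\<^bsub>X\<^esub> G v' w us"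
      by (rule multilinear_eqI[OF X Gm multilinear_plus[OF X Gm Gm] _ us])
        (use v in \<open>simp_all add: Geq head_simps\<close>)
  next
    fix v w w' assume v: "v \<in> carrier V" "w \<in> carrier W" "w' \<in> carrier W"
    show "G v (w \<oplus>\<^bsub>W\<^esub> w') us = G v w us \<oplus>\<^bsub>X\<^esub> G v w' us"
      by (rule multilinear_eqI[OF X Gm multilinear_plus[OF X Gm Gm] _ us])
        (use v in \<open>simp_all add: Geq head_simps\<close>)
  next
    fix c v w assume v: "c \<in> carrier K" "v \<in> carrier V" "w \<in> carrier W"
    show "G (c \<odot>\<^bsub>V\<^esub> v) w us = c \<odot>\<^bsub>X\<^esub> G v w us"
      by (rule multilinear_eqI[OF X Gm multilinear_smult[OF X _ Gm] _ us])
        (use v in \<open>simp_all add: Geq head_simps\<close>)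
    show "G v (c \<odot>\<^bsub>W\<^esub> w) us = c \<odot>\<^bsub>X\<^esub> G v w us"
      by (rule multilinear_eqI[OF X Gm multilinear_smult[OF X _ Gm] _ us])
        (use v in \<open>simp_all add: Geq head_simps\<close>)
  qed (use us in \<open>auto intro: multilinear_in[OF Gm]\<close>)
  define H where "H us = tensor_lift K V W X (\<lambda>v w. G v w (tl us)) (hd us)" for us
  have H_pure: "H (pure v w # us) = G v w us"
    if "v \<in> carrier V" "w \<in> carrier W" "us \<in> tuples T n" for v w us
    using that by (simp add: H_def tensor_lift_pure[OF X bilG])
  have H_left: "(\<lambda>u. H (u # us)) \<in> module_hom K T X" if "us \<in> tuples T n" for us
    using tensor_lift_hom[OF X bilG[OF that]] by (simp add: H_def)
  have H_right: "(\<lambda>x. H (u # us[j := x])) \<in> module_hom K T X"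
    if us: "us \<in> tuples T n" "j < n" and "u \<in> carrier T" for us j u
    using that(3)
  proof (induct rule: tensor_induct)
    case (pure v w)
    show ?case
      by (rule module_hom_cong[OF tensor_module multilinear_hom[OF Gm us]])
        (use pure us in \<open>simp_all add: H_pure tuples_update\<close>)
  next
    case (add u u')
    show ?case
      by (rule module_hom_cong[OF tensor_module module_hom_plus[OF X add(3,4)]])
        (use add us in \<open>simp add: module_hom_add[OF H_left] tuples_update\<close>)
  qed
  have "H \<in> multilinear_maps K T X (Suc n)"
    unfolding multilinear_maps_def
  proof (intro CollectI conjI ballI allI impI Pi_I)
    fix us assume us: "us \<in> tuples T (Suc n)"
    then obtain u us' where us': "us = u # us'" by (cases us) (auto simp: tuples_def)
    with us have u: "u \<in> carrier T" "us' \<in> tuples T n" by (auto simp: tuples_Cons)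
    show "H us \<in> carrier X" unfolding us' by (rule module_hom_in[OF H_left]) (use u in auto)
    fix i assume "i < Suc n"
    then show "(\<lambda>x. H (us[i := x])) \<in> module_hom K T X"
      using u H_left H_right unfolding us' by (cases i) auto
  qed
  moreover have "H (map (case_prod pure) ps) = \<beta> ps" if ps: "ps \<in> ?S" "length ps = Suc n" for ps
  proof -
    from ps obtain v w qs where q: "ps = (v, w) # qs" by (cases ps) auto
    with ps have "v \<in> carrier V" "w \<in> carrier W" "qs \<in> ?S" "length qs = n" by auto
    then show ?thesis using q by (simp add: H_pure Geq map_pure_tuple)
  qed
  ultimately show ?case by blast
qed

context
  fixes X :: "('k, 'u, 't) module_scheme" and G n
  assumes X: "module K X" and G: "G \<in> multilinear_maps K T X n"
    and swap: "\<And>ps i j. ps \<in> lists (carrier V \<times> carrier W) \<Longrightarrow> length ps = n \<Longrightarrow> i < j \<Longrightarrow> j < n \<Longrightarrow>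
      G (map (case_prod pure) ps) \<oplus>\<^bsub>X\<^esub> G (map (case_prod pure) (ps[i := ps ! j, j := ps ! i])) = \<zero>\<^bsub>X\<^esub>"
    and repeated: "\<And>ps i j. ps \<in> lists (carrier V \<times> carrier W) \<Longrightarrow> length ps = n \<Longrightarrow> i < j \<Longrightarrow> j < n \<Longrightarrow>
      ps ! i = ps ! j \<Longrightarrow> G (map (case_prod pure) ps) = \<zero>\<^bsub>X\<^esub>"
begin

lemma antisymmetric_if_on_pures:
  assumes us: "us \<in> tuples T n" and ij: "i < j" "j < n"
  shows "G us \<oplus>\<^bsub>X\<^esub> G (us[i := us ! j, j := us ! i]) = \<zero>\<^bsub>X\<^esub>"
proof (rule vanish_on_slots[OF X order.refl _ _ us])
  fix us k assume us: "us \<in> tuples T n" and k: "k \<in> {..<n}"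
  \<comment> \<open>The entry that stands at \<open>k\<close> before the exchange of \<open>i\<close> and \<open>j\<close> stands at
  \<open>k'\<close> after it.\<close>
  define k' where "k' = (if k = i then j else if k = j then i else k)"
  have "us[i := us ! j, j := us ! i] \<in> tuples T n"
    using us ij by (auto intro!: tuples_update tuples_nth)
  moreover have "k' < n" using k ij by (auto simp: k'_def)
  ultimately have "(\<lambda>u. G ((us[i := us ! j, j := us ! i])[k' := u])) \<in> module_hom K T X"
    by (rule multilinear_hom[OF G])
  moreover have "(us[k := u])[i := us[k := u] ! j, j := us[k := u] ! i]
      = (us[i := us ! j, j := us ! i])[k' := u]" for u
    using ij k tuples_length[OF us] by (intro nth_equalityI) (auto simp: k'_def nth_list_update)
  ultimately have "(\<lambda>u. G ((us[k := u])[i := us[k := u] ! j, j := us[k := u] ! i])) \<in> module_hom K T X"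
    by simp
  then show "(\<lambda>u. G (us[k := u]) \<oplus>\<^bsub>X\<^esub> G ((us[k := u])[i := us[k := u] ! j, j := us[k := u] ! i]))
      \<in> module_hom K T X"
    using multilinear_hom[OF G us] k by (intro module_hom_plus[OF X]) auto
next
  fix us assume us: "us \<in> tuples T n" and "\<forall>k\<in>{..<n}. is_pure (us ! k)"
  then have "\<forall>k<n. is_pure (us ! k)" by simp
  then obtain ps where ps: "ps \<in> lists (carrier V \<times> carrier W)" "length ps = n"
    "us = map (case_prod pure) ps" by (rule pure_tuple[OF us])
  moreover have "us[i := us ! j, j := us ! i] = map (case_prod pure) (ps[i := ps ! j, j := ps ! i])"
    using ps ij by (simp add: map_update)
  ultimately show "G us \<oplus>\<^bsub>X\<^esub> G (us[i := us ! j, j := us ! i]) = \<zero>\<^bsub>X\<^esub>"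
    using swap[OF ps(1,2) ij] by simp
qed

text \<open>An entry \<open>u + w\<close> occurring twice produces the cross terms with \<open>u\<close> and \<open>w\<close> in
  different positions.  They cancel by antisymmetry, which is why vanishing on repeated pairs and
  antisymmetry are both required on pure tensors.\<close>

lemma repeated_entry_zero:
  assumes us: "us \<in> tuples T n" and ij: "i < j" "j < n" and u: "u \<in> carrier T"
  shows "G (us[i := u, j := u]) = \<zero>\<^bsub>X\<^esub>"
  using u
proof (induct rule: tensor_induct)
  case (pure v w)
  let ?u = "pure v w"
  have u: "?u \<in> carrier T" using pure by (rule pure_closed)
  show ?case
  proof (rule vanish_on_slots[OF X, of "{..<n} - {i, j}" n "\<lambda>us. G (us[i := ?u, j := ?u])", OF _ _ _ us])
    fix us k assume us: "us \<in> tuples T n" and k: "k \<in> {..<n} - {i, j}"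
    then show "(\<lambda>w. G ((us[k := w])[i := ?u, j := ?u])) \<in> module_hom K T X"
      using multilinear_hom[OF G tuples_update[OF tuples_update[OF us u] u], of k i j]
      by (simp add: list_update_swap)
  next
    fix us assume us: "us \<in> tuples T n" and p: "\<forall>k\<in>{..<n} - {i, j}. is_pure (us ! k)"
    let ?us = "us[i := ?u, j := ?u]"
    have "is_pure (?us ! k)" if "k < n" for k
      using p that pure ij tuples_length[OF us] by (auto simp: nth_list_update is_pure_def)
    moreover have us': "?us \<in> tuples T n" using us u by (simp add: tuples_update)
    ultimately obtain ps where ps: "ps \<in> lists (carrier V \<times> carrier W)" "length ps = n"
      "?us = map (case_prod pure) ps" using pure_tuple by blast
    \<comment> \<open>Equal tensors need not come from equal pairs, so the two pairs are replaced by \<open>(v, w)\<close>.\<close>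
    define qs where "qs = ps[i := (v, w), j := (v, w)]"
    have "map (case_prod pure) qs = (map (case_prod pure) ps)[i := ?u, j := ?u]"
      by (simp add: qs_def map_update)
    also have "\<dots> = ?us[i := ?u, j := ?u]" by (simp add: ps(3))
    also have "\<dots> = ?us" using ij by (simp add: list_update_swap)
    finally have eq: "?us = map (case_prod pure) qs" ..
    have "qs \<in> lists (carrier V \<times> carrier W)" "length qs = n"
      using ps pure by (auto simp: qs_def in_lists_conv_set dest!: set_update_subset_insert[THEN subsetD])
    moreover have "qs ! i = qs ! j" using ij ps by (simp add: qs_def nth_list_update)
    ultimately show "G ?us = \<zero>\<^bsub>X\<^esub>"
      unfolding eq using repeated ij by blast
  qed auto
next
  case (add u w)
  interpret X: module K X by (rule X)
  have add_j: "G (us[i := y, j := u \<oplus>\<^bsub>T\<^esub> w]) = G (us[i := y, j := u]) \<oplus>\<^bsub>X\<^esub> G (us[i := y, j := w])"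
    if "y \<in> carrier T" for y
    using module_hom_add[OF multilinear_hom[OF G tuples_update[OF us that] ij(2)] add(1,2)] .
  have add_i: "G (us[i := u \<oplus>\<^bsub>T\<^esub> w, j := y]) = G (us[i := u, j := y]) \<oplus>\<^bsub>X\<^esub> G (us[i := w, j := y])"
    if "y \<in> carrier T" for y
    using module_hom_add[OF multilinear_hom[OF G tuples_update[OF us that]] add(1,2), of i j] ij
    by (simp add: list_update_swap)
  have "G (us[i := u, j := w]) \<oplus>\<^bsub>X\<^esub> G (us[i := w, j := u]) = \<zero>\<^bsub>X\<^esub>"
    using antisymmetric_if_on_pures[of "us[i := u, j := w]" i j] us ij add(1,2) tuples_length[OF us]
    by (simp add: tuples_update list_update_swap[of j i])
  moreover have "G (us[i := y, j := z]) \<in> carrier X" if "y \<in> carrier T" "z \<in> carrier T" for y z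
    using that us by (intro multilinear_in[OF G]) (simp add: tuples_update)
  ultimately show ?case
    using add by (simp add: add_i add_j X.M.a_comm)
qed

lemma alternating_if_on_pures:
  assumes us: "us \<in> tuples T n" and "\<not> distinct us"
  shows "G us = \<zero>\<^bsub>X\<^esub>"
proof -
  obtain i j where ij: "i < j" "j < n" "us ! i = us ! j"
    using assms(2) tuples_length[OF us] unfolding distinct_conv_nth by (metis linorder_neqE_nat)
  then have "us = us[i := us ! j, j := us ! j]"
    using tuples_length[OF us] by (intro nth_equalityI) (auto simp: nth_list_update)
  with repeated_entry_zero[OF us ij(1,2), of "us ! j"] us ij show ?thesis by (simp add: tuples_nth)
qed

end

end

section \<open>Cocycles on the current algebra\<close>

lemma nths_single: "i < length xs \<Longrightarrow> nths xs {i} = [xs ! i]"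
proof (induct xs arbitrary: i)
  case (Cons x xs)
  show ?case
  proof (cases i)
    case 0
    then show ?thesis by (simp add: nths_Cons)
  next
    case (Suc k)
    then have "{j. Suc j \<in> {i}} = {k}" by auto
    with Suc Cons show ?thesis by (simp add: nths_Cons)
  qed
qed simp

lemma nths_pair: "i < j \<Longrightarrow> j < length xs \<Longrightarrow> nths xs {i, j} = [xs ! i, xs ! j]"
proof (induct xs arbitrary: i j)
  case (Cons x xs)
  then obtain l where l: "j = Suc l" "l < length xs" by (cases j) auto
  show ?case
  proof (cases i)
    case 0
    then have "{k. Suc k \<in> {i, j}} = {l}" using l by auto
    with 0 l show ?thesis by (simp add: nths_Cons nths_single)
  next
    case (Suc k)
    then have "{m. Suc m \<in> {i, j}} = {k, l}" using l by auto
    with Suc l Cons show ?thesis by (simp add: nths_Cons)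
  qed
qed simp

context comm_monoid
begin

definition list_prod :: "'a list \<Rightarrow> 'a" where
  "list_prod as = foldr (\<otimes>\<^bsub>G\<^esub>) as \<one>\<^bsub>G\<^esub>"

lemma list_prod_simps [simp]:
  "list_prod [] = \<one>\<^bsub>G\<^esub>" "list_prod (a # as) = a \<otimes>\<^bsub>G\<^esub> list_prod as"
  by (simp_all add: list_prod_def)

lemma list_prod_closed [simp, intro]: "set as \<subseteq> carrier G \<Longrightarrow> list_prod as \<in> carrier G"
  by (induct as) auto

lemma list_prod_nths:
  "set as \<subseteq> carrier G \<Longrightarrow> list_prod (nths as I) \<otimes>\<^bsub>G\<^esub> list_prod (nths as (- I)) = list_prod as"
proof (induct as arbitrary: I)
  case (Cons a as)
  have "{j. Suc j \<in> - I} = - {j. Suc j \<in> I}" by auto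
  moreover have "set (nths as J) \<subseteq> carrier G" for J
    using Cons.prems set_nths_subset[of as J] by auto
  ultimately show ?case
    using Cons.prems Cons.hyps[of "{j. Suc j \<in> I}", symmetric] by (simp add: nths_Cons m_ac)
qed simp

lemma list_prod_remove_one:
  assumes "set as \<subseteq> carrier G" "i < length as"
  shows "as ! i \<otimes>\<^bsub>G\<^esub> list_prod (nths as (- {i})) = list_prod as"
proof -
  have "as ! i \<in> carrier G" using assms by auto
  then show ?thesis
    using list_prod_nths[OF assms(1), of "{i}"] assms(2) by (simp add: nths_single)
qed

lemma list_prod_remove_two:
  assumes "set as \<subseteq> carrier G" "i < j" "j < length as"
  shows "(as ! i \<otimes>\<^bsub>G\<^esub> as ! j) \<otimes>\<^bsub>G\<^esub> list_prod (nths as (- {i, j})) = list_prod as"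
proof -
  have "as ! i \<in> carrier G" "as ! j \<in> carrier G" using assms by auto
  then show ?thesis
    using list_prod_nths[OF assms(1), of "{i, j}"] assms(2,3) by (simp add: nths_pair)
qed

lemma list_prod_swap:
  assumes "set as \<subseteq> carrier G" "i < j" "j < length as"
  shows "list_prod (as[i := as ! j, j := as ! i]) = list_prod as"
proof -
  have c: "as ! i \<in> carrier G" "as ! j \<in> carrier G" using assms by auto
  then have "set (as[i := as ! j, j := as ! i]) \<subseteq> carrier G"
    using assms(1) by (auto dest!: set_update_subset_insert[THEN subsetD])
  from list_prod_remove_two[OF this assms(2)] list_prod_remove_two[OF assms]
  show ?thesis
    using assms c by (simp add: nths_update_notin m_comm[of "as ! j" "as ! i"])
qed

end

context lie_module_tensor
begin

lemma multilinear_LA_eq: "multilinear_maps K LA.LA N n = multilinear_maps K LA.T MV.T n"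
  by (simp add: multilinear_maps_def tuples_def module_hom_def)

lemma pure_hom_left: "v \<in> carrier V \<Longrightarrow> (\<lambda>m. MV.pure m v) \<in> module_hom K M N"
  using bilinear_left[OF MV.pure_bilinear, of v] by (simp add: module_hom_def)

text \<open>The value at \<open>x\<^sub>1 \<otimes> a\<^sub>1, \<dots>, x\<^sub>n \<otimes> a\<^sub>n\<close> of the cocycle that corresponds to
  \<open>f\<close>: the tensor of \<open>f (x\<^sub>1, \<dots>, x\<^sub>n)\<close> and \<open>a\<^sub>1 \<dots> a\<^sub>n v\<close>.\<close>

definition tensor_values :: "('l list \<Rightarrow> 'm) \<Rightarrow> 'v \<Rightarrow> ('l \<times> 'a) list \<Rightarrow> ('m \<times> 'v \<Rightarrow> 'k) set" where
  "tensor_values f v ps = MV.pure (f (map fst ps)) (A.list_prod (map snd ps) \<odot>\<^bsub>V\<^esub> v)"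

lemma map_fst_tuple:
  "ps \<in> lists (carrier L \<times> carrier A) \<Longrightarrow> length ps = n \<Longrightarrow> map fst ps \<in> tuples L n"
  by (auto simp: tuples_def in_lists_conv_set)

lemma map_snd_subset: "ps \<in> lists (carrier L \<times> carrier A) \<Longrightarrow> set (map snd ps) \<subseteq> carrier A"
  by (auto simp: in_lists_conv_set)

context
  fixes f n v
  assumes f: "f \<in> cocycles K L M n" and v: "v \<in> carrier V"
begin

lemma f_alt: "f \<in> alternating_maps K L M n"
  and coboundary_f: "coboundary K L M n f = (\<lambda>xs\<in>tuples L (Suc n). \<zero>\<^bsub>M\<^esub>)"
  using f by (auto simp: cocycles_def cochains_simps)

lemma f_in: "xs \<in> tuples L n \<Longrightarrow> f xs \<in> carrier M"
  using f_alt by (simp add: alternating_maps_def Pi_iff)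

context
  fixes ps
  assumes ps: "ps \<in> lists (carrier L \<times> carrier A)" "length ps = n"
begin

lemma tensor_values_closed: "tensor_values f v ps \<in> carrier MV.T"
  using f_in[OF map_fst_tuple[OF ps]] map_snd_subset[OF ps(1)] v
  unfolding tensor_values_def by (auto intro!: MV.pure_closed)

lemma tensor_values_bilinear:
  assumes i: "i < n"
  shows "(\<lambda>x a. tensor_values f v (ps[i := (x, a)])) \<in> bilinear_maps K L A MV.T"
proof -
  let ?c = "A.list_prod (nths (map snd ps) (- {i}))"
  note snd = map_snd_subset[OF ps(1)]
  have c: "?c \<in> carrier A"
    using snd set_nths_subset[of "map snd ps" "- {i}"] by (intro A.list_prod_closed) auto
  have prod: "A.list_prod ((map snd ps)[i := a]) = ?c \<otimes>\<^bsub>A\<^esub> a" if "a \<in> carrier A" for a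
  proof -
    have "set ((map snd ps)[i := a]) \<subseteq> carrier A"
      using snd that by (auto dest!: set_update_subset_insert[THEN subsetD])
    from A.list_prod_remove_one[OF this, of i] show ?thesis
      using ps i c that by (simp add: nths_update_notin A.m_comm)
  qed
  have left: "(\<lambda>x. f ((map fst ps)[i := x])) \<in> module_hom K L M"
    using f_alt map_fst_tuple[OF ps] i by (simp add: alternating_maps_def)
  have right: "(\<lambda>a. (?c \<otimes>\<^bsub>A\<^esub> a) \<odot>\<^bsub>V\<^esub> v) \<in> module_hom K A VK"
    using module_hom_comp[OF bilinear_right[OF LA.mult_bilinear c] bilinear_left[OF smult_bilinear]] v
    by simp
  show ?thesis
    by (rule bilinear_cong[OF L_module A.module_axioms
          bilinear_comp_args[OF MV.pure_bilinear left right]])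
      (simp add: tensor_values_def map_update prod)
qed

lemma tensor_values_zero:
  assumes "f (map fst ps) = \<zero>\<^bsub>M\<^esub>"
  shows "tensor_values f v ps = \<zero>\<^bsub>MV.T\<^esub>"
  unfolding tensor_values_def assms using map_snd_subset[OF ps(1)] v
  by (intro module_hom_zero[OF M_module MV.tensor_module bilinear_left[OF MV.pure_bilinear]]) auto

lemma tensor_values_repeated:
  assumes "i < j" "j < n" "ps ! i = ps ! j"
  shows "tensor_values f v ps = \<zero>\<^bsub>MV.T\<^esub>"
proof (rule tensor_values_zero)
  have "\<not> distinct (map fst ps)"
    using assms ps nth_eq_iff_index_eq[of "map fst ps" i j] by auto
  then show "f (map fst ps) = \<zero>\<^bsub>M\<^esub>"
    using f_alt map_fst_tuple[OF ps] by (simp add: alternating_maps_def)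
qed

lemma tensor_values_swap:
  assumes ij: "i < j" "j < n"
  shows "tensor_values f v ps \<oplus>\<^bsub>MV.T\<^esub> tensor_values f v (ps[i := ps ! j, j := ps ! i]) = \<zero>\<^bsub>MV.T\<^esub>"
proof -
  let ?qs = "ps[i := ps ! j, j := ps ! i]" and ?w = "A.list_prod (map snd ps) \<odot>\<^bsub>V\<^esub> v"
  have qs: "?qs \<in> lists (carrier L \<times> carrier A)" "length ?qs = n"
    using ps ij by (auto simp: in_lists_conv_set dest!: set_update_subset_insert[THEN subsetD])
  have w: "?w \<in> carrier V" using map_snd_subset[OF ps(1)] v by auto
  have "A.list_prod (map snd ?qs) = A.list_prod (map snd ps)"
    using A.list_prod_swap[OF map_snd_subset[OF ps(1)], of i j] ps ij by (simp add: map_update)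
  then have "tensor_values f v ps \<oplus>\<^bsub>MV.T\<^esub> tensor_values f v ?qs
      = MV.pure (f (map fst ps) \<oplus>\<^bsub>M\<^esub> f (map fst ?qs)) ?w"
    using f_in map_fst_tuple[OF ps] map_fst_tuple[OF qs] w
    by (simp add: tensor_values_def MV.pure_simps)
  also have "f (map fst ps) \<oplus>\<^bsub>M\<^esub> f (map fst ?qs) = \<zero>\<^bsub>M\<^esub>"
  proof -
    have "ps ! i \<in> carrier L \<times> carrier A" "ps ! j \<in> carrier L \<times> carrier A"
      using ps ij by (auto simp: in_lists_conv_set)
    moreover have "(map fst ps)[i := fst (ps ! i), j := fst (ps ! j)] = map fst ps"
      by (simp flip: map_update)
    ultimately show ?thesis
      using alternating_swap[OF L_module M_module f_alt map_fst_tuple[OF ps],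
          of i j "fst (ps ! i)" "fst (ps ! j)"] ps ij
      by (auto simp: map_update)
  qed
  also have "MV.pure \<zero>\<^bsub>M\<^esub> ?w = \<zero>\<^bsub>MV.T\<^esub>"
    using w by (intro module_hom_zero[OF M_module MV.tensor_module bilinear_left[OF MV.pure_bilinear]]) simp
  finally show ?thesis .
qed

end

context
  fixes G
  assumes G: "G \<in> multilinear_maps K LA.T MV.T n"
    and G_pure: "\<And>ps. ps \<in> lists (carrier L \<times> carrier A) \<Longrightarrow> length ps = n
      \<Longrightarrow> G (map (case_prod LA.pure) ps) = tensor_values f v ps"
begin

lemma extension_alternating: "G \<in> alternating_maps K LA.LA N n"
proof -
  have "G us = \<zero>\<^bsub>MV.T\<^esub>" if "us \<in> tuples LA.T n" "\<not> distinct us" for us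
  proof (rule LA.alternating_if_on_pures[OF MV.tensor_module G _ _ that])
    fix ps i j assume ps: "ps \<in> lists (carrier L \<times> carrier A)" "length ps = n" and ij: "i < j" "j < n"
    have "ps[i := ps ! j, j := ps ! i] \<in> lists (carrier L \<times> carrier A)"
      using ps ij by (auto simp: in_lists_conv_set dest!: set_update_subset_insert[THEN subsetD])
    then show "G (map (case_prod LA.pure) ps)
        \<oplus>\<^bsub>MV.T\<^esub> G (map (case_prod LA.pure) (ps[i := ps ! j, j := ps ! i])) = \<zero>\<^bsub>MV.T\<^esub>"
      using tensor_values_swap[OF ps ij] ps by (simp add: G_pure)
    assume "ps ! i = ps ! j"
    then show "G (map (case_prod LA.pure) ps) = \<zero>\<^bsub>MV.T\<^esub>"
      using tensor_values_repeated[OF ps ij] ps by (simp add: G_pure)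
  qed
  then show ?thesis
    using G unfolding alternating_maps_eq multilinear_LA_eq by (simp add: tuples_def)
qed

text \<open>Every summand of the coboundary of \<open>G\<close> is the corresponding summand for \<open>f\<close> tensored with
  one and the same vector \<open>w\<close>: the product of all the \<open>a\<^sub>i\<close> arises both when one of them acts
  on \<open>V\<close> and when two of them are multiplied in a bracket.\<close>

lemma coboundary_extension_pure:
  assumes ps: "ps \<in> lists (carrier L \<times> carrier A)" "length ps = Suc n"
  shows "coboundary K LA.LA N n G (map (case_prod LA.pure) ps) = \<zero>\<^bsub>N\<^esub>"
proof -
  define us where "us = map (case_prod LA.pure) ps"
  define xs where "xs = map fst ps"
  define as where "as = map snd ps"
  define w where "w = A.list_prod as \<odot>\<^bsub>V\<^esub> v"
  have xs: "xs \<in> tuples L (Suc n)" and as: "set as \<subseteq> carrier A" "length as = Suc n"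
    using ps map_fst_tuple map_snd_subset by (auto simp: xs_def as_def)
  have us: "us \<in> tuples LA.LA (Suc n)"
    using LA.map_pure_tuple[OF ps] by (simp add: us_def tuples_def)
  have w: "w \<in> carrier V" using as v by (simp add: w_def)
  have nth: "us ! i = LA.pure (xs ! i) (as ! i)" "xs ! i \<in> carrier L" "as ! i \<in> carrier A"
    if "i \<le> n" for i
    using that ps as tuples_nth[OF xs] by (auto simp: us_def xs_def as_def split_beta)
  have sub: "nths ps I \<in> lists (carrier L \<times> carrier A)" for I
    using ps set_nths_subset[of ps I] by (auto simp: in_lists_conv_set)
  have len: "length (nths ps (- {i})) = n" if "i \<le> n" for i
    using length_nths_compl[of "{i}" ps] ps that by simp
  have asI: "A.list_prod (nths as I) \<in> carrier A" for I
    using as set_nths_subset[of as I] by (intro A.list_prod_closed) auto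
  have G1: "lie_act N (us ! i) (G (nths us (- {i})))
      = MV.pure (lie_act M (xs ! i) (f (nths xs (- {i})))) w" if i: "i \<le> n" for i
  proof -
    have "G (nths us (- {i})) = tensor_values f v (nths ps (- {i}))"
      using G_pure[OF sub len[OF i]] by (simp add: us_def nths_map)
    also have "\<dots> = MV.pure (f (nths xs (- {i}))) (A.list_prod (nths as (- {i})) \<odot>\<^bsub>V\<^esub> v)"
      by (simp add: tensor_values_def xs_def as_def nths_map)
    finally show ?thesis
      using i nth f_in[OF tuples_nths_one[OF xs i]] asI v as
        A.list_prod_remove_one[OF as(1), of i]
      by (simp add: lie_act_N_pure w_def V.smult_assoc1[symmetric])
  qed
  have G2: "G (bracket LA.LA (us ! i) (us ! j) # nths us (- {i, j}))
      = MV.pure (f (bracket L (xs ! i) (xs ! j) # nths xs (- {i, j}))) w"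
    if ij: "j \<le> n" "i < j" for i j
  proof -
    let ?q = "(bracket L (xs ! i) (xs ! j), as ! i \<otimes>\<^bsub>A\<^esub> as ! j) # nths ps (- {i, j})"
    have q: "?q \<in> lists (carrier L \<times> carrier A)" using sub nth ij by (simp add: bracket_closed)
    have lq: "length ?q = n" using length_nths_compl[of "{i, j}" ps] ps ij by simp
    have "bracket LA.LA (us ! i) (us ! j) # nths us (- {i, j}) = map (case_prod LA.pure) ?q"
      using nth ij by (simp add: LA.current_bracket_pure us_def nths_map)
    then have "G (bracket LA.LA (us ! i) (us ! j) # nths us (- {i, j})) = tensor_values f v ?q"
      using G_pure[OF q lq] by simp
    also have "\<dots> = MV.pure (f (bracket L (xs ! i) (xs ! j) # nths xs (- {i, j})))
        ((as ! i \<otimes>\<^bsub>A\<^esub> as ! j \<otimes>\<^bsub>A\<^esub> A.list_prod (nths as (- {i, j}))) \<odot>\<^bsub>V\<^esub> v)"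
      by (simp add: tensor_values_def xs_def as_def nths_map)
    finally show ?thesis
      using A.list_prod_remove_two[OF as(1) ij(2)] ij as by (simp add: w_def)
  qed
  have "MV.pure (coboundary K L M n f xs) w = coboundary K LA.LA N n G us"
    by (rule hom_coboundary[OF lie_module_axioms N_lie_module pure_hom_left[OF w] xs us f_in])
      (simp_all only: G1 G2)
  then show ?thesis
    using xs module_hom_zero[OF M_module N_module pure_hom_left[OF w]] by (simp add: coboundary_f us_def)
qed

lemma coboundary_extension:
  assumes "us \<in> tuples LA.LA (Suc n)"
  shows "coboundary K LA.LA N n G us = \<zero>\<^bsub>N\<^esub>"
proof -
  interpret N: lie_module K LA.LA N by (rule N_lie_module)
  have us: "us \<in> tuples LA.T (Suc n)" using assms by (simp add: tuples_def)
  have "coboundary K LA.LA N n G us = \<zero>\<^bsub>MV.T\<^esub>"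
  proof (rule LA.vanish_on_slots[OF MV.tensor_module order.refl _ _ us])
    fix us k assume "us \<in> tuples LA.T (Suc n)" "k \<in> {..<Suc n}"
    then show "(\<lambda>u. coboundary K LA.LA N n G (us[k := u])) \<in> module_hom K LA.T MV.T"
      using N.coboundary_slot_hom[of G n us k] G
      by (simp add: multilinear_LA_eq tuples_def module_hom_def)
  next
    fix us assume us: "us \<in> tuples LA.T (Suc n)" and "\<forall>k\<in>{..<Suc n}. LA.is_pure (us ! k)"
    then have "\<forall>k<Suc n. LA.is_pure (us ! k)" by simp
    then obtain ps where "ps \<in> lists (carrier L \<times> carrier A)" "length ps = Suc n"
      "us = map (case_prod LA.pure) ps"
      by (rule LA.pure_tuple[OF us])
    then show "coboundary K LA.LA N n G us = \<zero>\<^bsub>MV.T\<^esub>" using coboundary_extension_pure by simp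
  qed
  then show ?thesis by simp
qed

end

theorem tensor_cocycle_exists:
  obtains G where "G \<in> cocycles K LA.LA N n"
    and "\<And>xs. xs \<in> tuples L n \<Longrightarrow> G (map (\<lambda>x. LA.pure x \<one>\<^bsub>A\<^esub>) xs) = MV.pure (f xs) v"
proof -
  interpret N: lie_module K LA.LA N by (rule N_lie_module)
  let ?S = "lists (carrier L \<times> carrier A)"
  let ?p = "case_prod LA.pure"
  have "\<exists>G\<in>multilinear_maps K LA.T MV.T n.
      \<forall>ps\<in>?S. length ps = n \<longrightarrow> G (map ?p ps) = tensor_values f v ps"
    by (intro LA.multilinear_extension[OF MV.tensor_module] tensor_values_closed tensor_values_bilinear)
  then obtain H where H: "H \<in> multilinear_maps K LA.T MV.T n"
    "\<forall>ps\<in>?S. length ps = n \<longrightarrow> H (map ?p ps) = tensor_values f v ps" by blast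
  \<comment> \<open>Cochains are extensional, the multilinear extension need not be.\<close>
  define G where "G = restrict H (tuples LA.T n)"
  have G: "G \<in> multilinear_maps K LA.T MV.T n"
    by (rule multilinear_cong[OF LA.tensor_module H(1)]) (simp add: G_def)
  have G_pure: "G (map ?p ps) = tensor_values f v ps" if "ps \<in> ?S" "length ps = n" for ps
    using H(2) that by (simp add: G_def LA.map_pure_tuple)
  have "tuples LA.LA n = tuples LA.T n" by (simp add: tuples_def)
  then have "G \<in> extensional (tuples LA.LA n)" by (simp add: G_def)
  moreover have "coboundary K LA.LA N n G = (\<lambda>us\<in>tuples LA.LA (Suc n). \<zero>\<^bsub>N\<^esub>)"
    unfolding fun_eq_iff restrict_apply
    using coboundary_extension[OF G G_pure] by (simp only: if_True if_False coboundary_def restrict_apply split: if_split) simp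
  ultimately have "G \<in> cocycles K LA.LA N n"
    using extension_alternating[OF G G_pure] by (simp only: cocycles_def N.cochains_simps mem_Collect_eq Int_iff)
  moreover have "G (map (\<lambda>x. LA.pure x \<one>\<^bsub>A\<^esub>) xs) = MV.pure (f xs) v" if xs: "xs \<in> tuples L n" for xs
  proof -
    let ?ps = "map (\<lambda>x. (x, \<one>\<^bsub>A\<^esub>)) xs"
    have ps: "?ps \<in> ?S" "length ?ps = n"
      using xs by (auto simp: tuples_def)
    have one: "A.list_prod (map (\<lambda>_. \<one>\<^bsub>A\<^esub>) xs) = \<one>\<^bsub>A\<^esub>" by (induct xs) auto
    have "map (\<lambda>x. LA.pure x \<one>\<^bsub>A\<^esub>) xs = map ?p ?ps" by simp
    then show ?thesis
      using G_pure[OF ps] v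
      by (simp add: tensor_values_def o_def one)
  qed
  ultimately show thesis by (rule that)
qed

end

end

section \<open>Coordinates and the dimension of a tensor product\<close>

text \<open>The linear forms on \<open>V\<close> are the elements of \<open>module_hom K V (scalars K)\<close>.\<close>

definition scalars :: "('k, 'x) ring_scheme \<Rightarrow> ('k, 'k) module" where
  "scalars K = \<lparr>carrier = carrier K, mult = mult K, one = one K, zero = zero K, add = add K, smult = mult K\<rparr>"

lemma scalars_simps [simp]:
  "carrier (scalars K) = carrier K" "zero (scalars K) = zero K" "add (scalars K) = add K"
  "smult (scalars K) = mult K"
  by (simp_all add: scalars_def)

lemma (in cring) scalars_module: "module R (scalars R)"
  by (rule module_criteria)
    (use is_cring r_neg in \<open>auto simp: a_ac m_assoc l_distr r_distr intro!: bexI[of _ "\<ominus>\<^bsub>R\<^esub> _"]\<close>)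

lemma submodule_finsum:
  assumes "submodule K U V" "\<And>i. i \<in> I \<Longrightarrow> f i \<in> U"
  shows "(\<Oplus>\<^bsub>V\<^esub>i\<in>I. f i) \<in> U"
proof -
  interpret V: module K V using assms(1) by (simp add: submodule_def)
  have "U \<subseteq> carrier V" using assms(1) by (simp add: submodule_def)
  then show ?thesis
    using assms(2)
    by (induct I rule: infinite_finite_induct)
      (auto intro: submodule.m_closed[OF assms(1)] submodule.zero_closed[OF assms(1)]
        simp: V.M.finsum_insert Pi_iff subset_iff)
qed

text \<open>The forms \<open>e b\<close> are the coordinates with respect to a basis \<open>B\<close>.\<close>

lemma (in vectorspace) dual_basis:
  assumes "fin_dim"
  shows "\<exists>B e. finite B \<and> card B = dim \<and> B \<subseteq> carrier V
    \<and> (\<forall>b\<in>B. e b \<in> module_hom K V (scalars K))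
    \<and> (\<forall>v\<in>carrier V. (\<Oplus>\<^bsub>V\<^esub>b\<in>B. e b v \<odot>\<^bsub>V\<^esub> b) = v)
    \<and> (\<forall>b\<in>B. \<forall>c\<in>B. e b c = (if b = c then \<one>\<^bsub>K\<^esub> else \<zero>\<^bsub>K\<^esub>))"
proof -
  obtain B where B: "finite B" "basis B" using finite_basis_exists[OF assms] by blast
  have BV: "B \<subseteq> carrier V" using B(2) by (simp add: basis_def)
  define c where "c v = (THE a. a \<in> B \<rightarrow>\<^sub>E carrier K \<and> lincomb a B = v)" for v
  have ex1: "\<exists>!a. a \<in> B \<rightarrow>\<^sub>E carrier K \<and> lincomb a B = v" if "v \<in> carrier V" for v
    using basis_criterion[OF B(1) BV] B(2) that by blast
  have c: "c v \<in> B \<rightarrow>\<^sub>E carrier K" "lincomb (c v) B = v" if "v \<in> carrier V" for v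
    using theI'[OF ex1[OF that]] by (simp_all add: c_def)
  have cK: "c v b \<in> carrier K" if "v \<in> carrier V" "b \<in> B" for v b
    using c(1)[OF that(1)] that(2) by auto
  have c_eq: "c v b = a b"
    if "a \<in> B \<rightarrow> carrier K" "lincomb a B = v" "v \<in> carrier V" "b \<in> B" for a v b
  proof -
    have "restrict a B \<in> B \<rightarrow>\<^sub>E carrier K" using that(1) by auto
    moreover have "lincomb (restrict a B) B = v"
      using that(1,2) BV by (subst lincomb_cong[where b = a]) auto
    ultimately have "c v = restrict a B" using ex1[OF that(3)] c[OF that(3)] by blast
    then show ?thesis using that(4) by simp
  qed
  show ?thesis
  proof (intro exI[of _ B] exI[of _ "\<lambda>b v. c v b"] conjI ballI)
    show "finite B" "B \<subseteq> carrier V" "card B = dim"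
      using B BV dim_basis by auto
    show "(\<Oplus>\<^bsub>V\<^esub>b\<in>B. c v b \<odot>\<^bsub>V\<^esub> b) = v" if "v \<in> carrier V" for v
      using c(2)[OF that] by (simp add: lincomb_def)
  next
    fix b assume b: "b \<in> B"
    show "(\<lambda>v. c v b) \<in> module_hom K V (scalars K)"
    proof (rule module_homI)
      fix v w assume v: "v \<in> carrier V" "w \<in> carrier V"
      then have "lincomb (\<lambda>b. c v b \<oplus>\<^bsub>K\<^esub> c w b) B = v \<oplus>\<^bsub>V\<^esub> w"
        using B(1) BV cK c(2) by (subst lincomb_sum) auto
      then show "c (v \<oplus>\<^bsub>V\<^esub> w) b = c v b \<oplus>\<^bsub>scalars K\<^esub> c w b"
        using v b cK by (subst c_eq[of "\<lambda>b. c v b \<oplus>\<^bsub>K\<^esub> c w b"]) auto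
    next
      fix r v assume v: "r \<in> carrier K" "v \<in> carrier V"
      then have "lincomb (\<lambda>b. r \<otimes>\<^bsub>K\<^esub> c v b) B = r \<odot>\<^bsub>V\<^esub> v"
        using BV cK c(2) by (subst lincomb_smult) auto
      then show "c (r \<odot>\<^bsub>V\<^esub> v) b = r \<odot>\<^bsub>scalars K\<^esub> c v b"
        using v b cK by (subst c_eq[of "\<lambda>b. r \<otimes>\<^bsub>K\<^esub> c v b"]) auto
    qed (use b cK in auto)
    fix b' assume b': "b' \<in> B"
    have "lincomb (\<lambda>b. if b = b' then \<one>\<^bsub>K\<^esub> else \<zero>\<^bsub>K\<^esub>) B = b'"
    proof -
      have "lincomb (\<lambda>b. if b = b' then \<one>\<^bsub>K\<^esub> else \<zero>\<^bsub>K\<^esub>) B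
          = (\<Oplus>\<^bsub>V\<^esub>b\<in>B. if b' = b then b else \<zero>\<^bsub>V\<^esub>)"
        unfolding lincomb_def using BV by (intro M.finsum_cong') auto
      also have "\<dots> = b'" using BV b' B(1) by (intro M.finsum_singleton) auto
      finally show ?thesis .
    qed
    then show "c b' b = (if b = b' then \<one>\<^bsub>K\<^esub> else \<zero>\<^bsub>K\<^esub>)"
      using b b' BV by (subst c_eq[of "\<lambda>b. if b = b' then \<one>\<^bsub>K\<^esub> else \<zero>\<^bsub>K\<^esub>"]) auto
  qed
qed

lemma (in vectorspace) form_exists:
  assumes "fin_dim" "v \<in> carrier V" "v \<noteq> \<zero>\<^bsub>V\<^esub>"
  obtains g where "g \<in> module_hom K V (scalars K)" "g v = \<one>\<^bsub>K\<^esub>"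
proof -
  obtain B e where BV: "B \<subseteq> carrier V"
    and e: "\<And>b. b \<in> B \<Longrightarrow> e b \<in> module_hom K V (scalars K)"
    and sum: "\<And>v. v \<in> carrier V \<Longrightarrow> (\<Oplus>\<^bsub>V\<^esub>b\<in>B. e b v \<odot>\<^bsub>V\<^esub> b) = v"
    using dual_basis[OF assms(1)] by blast
  have "\<exists>b\<in>B. e b v \<noteq> \<zero>\<^bsub>K\<^esub>"
  proof (rule ccontr)
    assume "\<not> ?thesis"
    then have "(\<Oplus>\<^bsub>V\<^esub>b\<in>B. e b v \<odot>\<^bsub>V\<^esub> b) = (\<Oplus>\<^bsub>V\<^esub>b\<in>B. \<zero>\<^bsub>V\<^esub>)"
      using BV by (intro M.finsum_cong') auto
    with sum[OF assms(2)] assms(3) show False by simp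
  qed
  then obtain b where b: "b \<in> B" "e b v \<noteq> \<zero>\<^bsub>K\<^esub>" by blast
  have ebv: "e b v \<in> carrier K" using module_hom_in[OF e[OF b(1)] assms(2)] by simp
  then have u: "e b v \<in> Units K" using b(2) field_Units by blast
  have "(\<lambda>w. inv\<^bsub>K\<^esub> (e b v) \<odot>\<^bsub>scalars K\<^esub> e b w) \<in> module_hom K V (scalars K)"
    using u by (intro module_hom_smult'[OF scalars_module] e b) simp
  moreover have "inv\<^bsub>K\<^esub> (e b v) \<odot>\<^bsub>scalars K\<^esub> e b v = \<one>\<^bsub>K\<^esub>" using u by simp
  ultimately show thesis by (rule that)
qed

locale tensor_spaces = V: vectorspace K V + W: vectorspace K W
  for K :: "('k, 'x) ring_scheme" and V :: "('k, 'v, 'y) module_scheme"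
    and W :: "('k, 'w, 'z) module_scheme"
begin

sublocale tensor_factors K V W
  by unfold_locales

lemma V_module: "module K V" and W_module: "module K W"
  by unfold_locales

text \<open>The contractions \<open>id \<otimes> g\<close> and \<open>f \<otimes> id\<close> of a tensor by a linear form.\<close>

definition slice_left :: "('w \<Rightarrow> 'k) \<Rightarrow> ('v \<times> 'w \<Rightarrow> 'k) set \<Rightarrow> 'v" where
  "slice_left g = tensor_lift K V W V (\<lambda>v w. g w \<odot>\<^bsub>V\<^esub> v)"

definition slice_right :: "('v \<Rightarrow> 'k) \<Rightarrow> ('v \<times> 'w \<Rightarrow> 'k) set \<Rightarrow> 'w" where
  "slice_right f = tensor_lift K V W W (\<lambda>v w. f v \<odot>\<^bsub>W\<^esub> w)"

lemma smult_form_bilinear: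
  assumes "g \<in> module_hom K W (scalars K)"
  shows "(\<lambda>v w. g w \<odot>\<^bsub>V\<^esub> v) \<in> bilinear_maps K V W V"
proof (intro bilinear_mapsI module_homI)
  fix c v w assume "c \<in> carrier K" "v \<in> carrier V" "w \<in> carrier W"
  then show "g w \<odot>\<^bsub>V\<^esub> (c \<odot>\<^bsub>V\<^esub> v) = c \<odot>\<^bsub>V\<^esub> (g w \<odot>\<^bsub>V\<^esub> v)"
    "g (c \<odot>\<^bsub>W\<^esub> w) \<odot>\<^bsub>V\<^esub> v = c \<odot>\<^bsub>V\<^esub> (g w \<odot>\<^bsub>V\<^esub> v)"
    using module_hom_in[OF assms] module_hom_smult[OF assms]
    by (simp_all add: V.smult_assoc1[symmetric] V.R.m_comm)
qed (use module_hom_in[OF assms] module_hom_add[OF assms] in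
      \<open>simp_all add: V.smult_l_distr V.smult_r_distr\<close>)

lemma smult_form_bilinear':
  assumes "f \<in> module_hom K V (scalars K)"
  shows "(\<lambda>v w. f v \<odot>\<^bsub>W\<^esub> w) \<in> bilinear_maps K V W W"
proof (intro bilinear_mapsI module_homI)
  fix c v w assume "c \<in> carrier K" "v \<in> carrier V" "w \<in> carrier W"
  then show "f v \<odot>\<^bsub>W\<^esub> (c \<odot>\<^bsub>W\<^esub> w) = c \<odot>\<^bsub>W\<^esub> (f v \<odot>\<^bsub>W\<^esub> w)"
    "f (c \<odot>\<^bsub>V\<^esub> v) \<odot>\<^bsub>W\<^esub> w = c \<odot>\<^bsub>W\<^esub> (f v \<odot>\<^bsub>W\<^esub> w)"
    using module_hom_in[OF assms] module_hom_smult[OF assms]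
    by (simp_all add: W.smult_assoc1[symmetric] V.R.m_comm)
qed (use module_hom_in[OF assms] module_hom_add[OF assms] in
      \<open>simp_all add: W.smult_l_distr W.smult_r_distr\<close>)

lemma slice_left_hom: "g \<in> module_hom K W (scalars K) \<Longrightarrow> slice_left g \<in> module_hom K T V"
  unfolding slice_left_def by (rule tensor_lift_hom[OF V_module smult_form_bilinear])

lemma slice_right_hom: "f \<in> module_hom K V (scalars K) \<Longrightarrow> slice_right f \<in> module_hom K T W"
  unfolding slice_right_def by (rule tensor_lift_hom[OF W_module smult_form_bilinear'])

lemma slice_left_pure:
  "g \<in> module_hom K W (scalars K) \<Longrightarrow> v \<in> carrier V \<Longrightarrow> w \<in> carrier W
    \<Longrightarrow> slice_left g (pure v w) = g w \<odot>\<^bsub>V\<^esub> v"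
  unfolding slice_left_def by (rule tensor_lift_pure[OF V_module smult_form_bilinear])

lemma slice_right_pure:
  "f \<in> module_hom K V (scalars K) \<Longrightarrow> v \<in> carrier V \<Longrightarrow> w \<in> carrier W
    \<Longrightarrow> slice_right f (pure v w) = f v \<odot>\<^bsub>W\<^esub> w"
  unfolding slice_right_def by (rule tensor_lift_pure[OF W_module smult_form_bilinear'])

text \<open>Both sides are the value of \<open>f \<otimes> g\<close> at \<open>X\<close>.\<close>

lemma slices_commute:
  assumes f: "f \<in> module_hom K V (scalars K)" and g: "g \<in> module_hom K W (scalars K)"
    and X: "X \<in> carrier T"
  shows "g (slice_right f X) = f (slice_left g X)"
proof -
  have "g (f v \<odot>\<^bsub>W\<^esub> w) = f (g w \<odot>\<^bsub>V\<^esub> v)" if "v \<in> carrier V" "w \<in> carrier W" for v w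
    using that module_hom_in[OF f that(1)] module_hom_in[OF g that(2)]
    by (simp add: module_hom_smult[OF f] module_hom_smult[OF g] V.R.m_comm)
  then show ?thesis
    by (intro tensor_hom_eqI[OF module_hom_comp[OF slice_right_hom[OF f] g]
          module_hom_comp[OF slice_left_hom[OF g] f] _ X])
      (simp add: slice_left_pure[OF g] slice_right_pure[OF f])
qed

text \<open>Every tensor is the sum of the \<open>(id \<otimes> e b) X \<otimes> b\<close> over a basis of \<open>W\<close> with dual basis
  \<open>e\<close>.\<close>

lemma zero_if_slices_left_zero:
  assumes "W.fin_dim" and X: "X \<in> carrier T"
    and zero: "\<And>g. g \<in> module_hom K W (scalars K) \<Longrightarrow> slice_left g X = \<zero>\<^bsub>V\<^esub>"
  shows "X = \<zero>\<^bsub>T\<^esub>"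
proof -
  obtain B e where B: "B \<subseteq> carrier W"
    and e: "\<And>b. b \<in> B \<Longrightarrow> e b \<in> module_hom K W (scalars K)"
    and sum: "\<And>w. w \<in> carrier W \<Longrightarrow> (\<Oplus>\<^bsub>W\<^esub>b\<in>B. e b w \<odot>\<^bsub>W\<^esub> b) = w"
    using W.dual_basis[OF assms(1)] by blast
  have hom: "(\<lambda>X. \<Oplus>\<^bsub>T\<^esub>b\<in>B. pure (slice_left (e b) X) b) \<in> module_hom K T T"
    using B by (intro module_hom_sum[OF tensor_module tensor_module]
        module_hom_comp[OF slice_left_hom[OF e] bilinear_left[OF pure_bilinear]]) auto
  have "(\<Oplus>\<^bsub>T\<^esub>b\<in>B. pure (slice_left (e b) X) b) = X"
  proof (rule tensor_hom_eqI[OF hom module_hom_id _ X])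
    fix v w assume v: "v \<in> carrier V" "w \<in> carrier W"
    have "(\<Oplus>\<^bsub>T\<^esub>b\<in>B. pure (slice_left (e b) (pure v w)) b) = (\<Oplus>\<^bsub>T\<^esub>b\<in>B. pure v (e b w \<odot>\<^bsub>W\<^esub> b))"
      using v B module_hom_in[OF e v(2)]
      by (intro T.M.finsum_cong') (auto simp: slice_left_pure[OF e] pure_simps intro!: pure_closed)
    also have "\<dots> = pure v (\<Oplus>\<^bsub>W\<^esub>b\<in>B. e b w \<odot>\<^bsub>W\<^esub> b)"
      using v B module_hom_in[OF e v(2)]
      by (intro module_hom_finsum[OF W_module tensor_module bilinear_right[OF pure_bilinear], symmetric]) auto
    finally show "(\<Oplus>\<^bsub>T\<^esub>b\<in>B. pure (slice_left (e b) (pure v w)) b) = pure v w"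
      using v by (simp add: sum)
  qed
  moreover have "(\<Oplus>\<^bsub>T\<^esub>b\<in>B. pure (slice_left (e b) X) b) = (\<Oplus>\<^bsub>T\<^esub>b\<in>B. \<zero>\<^bsub>T\<^esub>)"
    using B zero e module_hom_zero[OF V_module tensor_module bilinear_left[OF pure_bilinear]]
    by (intro T.M.finsum_cong') auto
  ultimately show ?thesis by simp
qed

text \<open>By \<open>slices_commute\<close>, each form \<open>f\<close> on \<open>V\<close> vanishes on all the left slices as
  well.\<close>

lemma zero_if_slices_zero:
  assumes "V.fin_dim" "W.fin_dim" and X: "X \<in> carrier T"
    and zero: "\<And>f. f \<in> module_hom K V (scalars K) \<Longrightarrow> slice_right f X = \<zero>\<^bsub>W\<^esub>"
  shows "X = \<zero>\<^bsub>T\<^esub>"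
proof (rule zero_if_slices_left_zero[OF assms(2) X])
  fix g assume g: "g \<in> module_hom K W (scalars K)"
  show "slice_left g X = \<zero>\<^bsub>V\<^esub>"
  proof (rule ccontr)
    assume "slice_left g X \<noteq> \<zero>\<^bsub>V\<^esub>"
    then obtain f where f: "f \<in> module_hom K V (scalars K)" "f (slice_left g X) = \<one>\<^bsub>K\<^esub>"
      using V.form_exists[OF assms(1)] module_hom_in[OF slice_left_hom[OF g] X] by blast
    then show False
      using slices_commute[OF f(1) g X] zero[OF f(1)]
        module_hom_zero[OF W_module V.R.scalars_module g] by simp
  qed
qed

lemma pure_nonzero:
  assumes "W.fin_dim" "v \<in> carrier V" "v \<noteq> \<zero>\<^bsub>V\<^esub>" "w \<in> carrier W" "w \<noteq> \<zero>\<^bsub>W\<^esub>"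
  shows "pure v w \<noteq> \<zero>\<^bsub>T\<^esub>"
proof
  assume zero: "pure v w = \<zero>\<^bsub>T\<^esub>"
  obtain g where g: "g \<in> module_hom K W (scalars K)" "g w = \<one>\<^bsub>K\<^esub>"
    using W.form_exists[OF assms(1,4,5)] .
  have "v = slice_left g (pure v w)" using assms g by (simp add: slice_left_pure)
  also have "\<dots> = \<zero>\<^bsub>V\<^esub>"
    unfolding zero by (rule module_hom_zero[OF tensor_module V_module slice_left_hom[OF g(1)]])
  finally show False using assms by simp
qed

lemma tensor_vectorspace: "vectorspace K T"
  using tensor_module V.field_axioms by (simp add: vectorspace_def)

text \<open>The tensors \<open>a \<otimes> b\<close> of basis vectors form a basis.  They are independent because the forms
  \<open>p a \<otimes> q b\<close>, composed from coordinate forms, take the values 0 and 1 on them.\<close>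

theorem tensor_dimension:
  assumes V: "V.fin_dim" and W: "W.fin_dim"
  shows "has_dimension K T (V.dim * W.dim)"
proof -
  interpret VS: vectorspace K T by (rule tensor_vectorspace)
  obtain A p where A: "finite A" "card A = V.dim" "A \<subseteq> carrier V"
    and p: "\<And>a. a \<in> A \<Longrightarrow> p a \<in> module_hom K V (scalars K)"
    and p_sum: "\<And>v. v \<in> carrier V \<Longrightarrow> (\<Oplus>\<^bsub>V\<^esub>a\<in>A. p a v \<odot>\<^bsub>V\<^esub> a) = v"
    and p_delta: "\<And>a a'. a \<in> A \<Longrightarrow> a' \<in> A \<Longrightarrow> p a a' = (if a = a' then \<one>\<^bsub>K\<^esub> else \<zero>\<^bsub>K\<^esub>)"
    using V.dual_basis[OF V] by blast
  obtain B q where B: "finite B" "card B = W.dim" "B \<subseteq> carrier W"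
    and q: "\<And>b. b \<in> B \<Longrightarrow> q b \<in> module_hom K W (scalars K)"
    and q_sum: "\<And>w. w \<in> carrier W \<Longrightarrow> (\<Oplus>\<^bsub>W\<^esub>b\<in>B. q b w \<odot>\<^bsub>W\<^esub> b) = w"
    and q_delta: "\<And>b b'. b \<in> B \<Longrightarrow> b' \<in> B \<Longrightarrow> q b b' = (if b = b' then \<one>\<^bsub>K\<^esub> else \<zero>\<^bsub>K\<^esub>)"
    using W.dual_basis[OF W] by blast
  define \<kappa> where "\<kappa> ab X = p (fst ab) (slice_left (q (snd ab)) X)" for ab X
  let ?f = "\<lambda>(a, b). pure a b"
  let ?P = "?f ` (A \<times> B)"
  have \<kappa>_hom: "\<kappa> ab \<in> module_hom K T (scalars K)" if "ab \<in> A \<times> B" for ab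
    unfolding \<kappa>_def using that by (intro module_hom_comp[OF slice_left_hom[OF q] p]) auto
  have \<kappa>_pure: "\<kappa> ab (?f ab') = (if ab = ab' then \<one>\<^bsub>K\<^esub> else \<zero>\<^bsub>K\<^esub>)"
    if "ab \<in> A \<times> B" "ab' \<in> A \<times> B" for ab ab'
  proof -
    obtain a b a' b' where [simp]: "ab = (a, b)" "ab' = (a', b')" by (cases ab; cases ab')
    have ab: "a \<in> A" "b \<in> B" "a' \<in> A" "b' \<in> B" using that by auto
    then have abV: "a' \<in> carrier V" "b' \<in> carrier W" using A B by auto
    have "\<kappa> ab (?f ab') = p a (q b b' \<odot>\<^bsub>V\<^esub> a')"
      using abV ab by (simp add: \<kappa>_def slice_left_pure[OF q])
    also have "\<dots> = q b b' \<otimes>\<^bsub>K\<^esub> p a a'"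
      using module_hom_smult[OF p[OF ab(1)] _ abV(1)] module_hom_in[OF q[OF ab(2)] abV(2)] by simp
    finally show ?thesis using ab by (simp add: p_delta q_delta)
  qed
  have inj: "inj_on ?f (A \<times> B)"
    using \<kappa>_pure V.one_not_zero by (intro inj_onI) metis
  have P: "finite ?P" "?P \<subseteq> carrier T" "card ?P = V.dim * W.dim"
    using A B inj by (auto simp: card_image card_cartesian_product intro!: pure_closed)
  have li: "\<not> T.lin_dep ?P"
  proof (rule T.finite_lin_indpt2[OF P(1,2)], rule ballI)
    fix c x assume c: "c \<in> ?P \<rightarrow> carrier K" "T.lincomb c ?P = \<zero>\<^bsub>T\<^esub>" and x: "x \<in> ?P"
    from x obtain ab where ab: "x = ?f ab" "ab \<in> A \<times> B" by (rule imageE)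
    have \<kappa>x: "\<kappa> ab y = (if x = y then \<one>\<^bsub>K\<^esub> else \<zero>\<^bsub>K\<^esub>)" if "y \<in> ?P" for y
    proof -
      from that obtain ab' where ab': "y = ?f ab'" "ab' \<in> A \<times> B" by (rule imageE)
      have "x = y \<longleftrightarrow> ab = ab'"
        using inj_on_eq_iff[OF inj ab(2) ab'(2)] ab(1) ab'(1) by simp
      then show ?thesis
        using \<kappa>_pure[OF ab(2) ab'(2)] ab'(1) by (simp only:)
    qed
    have "\<zero>\<^bsub>K\<^esub> = \<kappa> ab (T.lincomb c ?P)"
      using c(2) module_hom_zero[OF tensor_module V.R.scalars_module \<kappa>_hom[OF ab(2)]] by simp
    also have "\<dots> = (\<Oplus>\<^bsub>scalars K\<^esub>y\<in>?P. \<kappa> ab (c y \<odot>\<^bsub>T\<^esub> y))"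
      unfolding T.lincomb_def using c P
      by (intro module_hom_finsum[OF tensor_module V.R.scalars_module \<kappa>_hom[OF ab(2)]]) (auto simp: Pi_iff)
    also have "\<dots> = (\<Oplus>\<^bsub>scalars K\<^esub>y\<in>?P. if x = y then c y else \<zero>\<^bsub>scalars K\<^esub>)"
    proof -
      interpret S: module K "scalars K" by (rule V.R.scalars_module)
      show ?thesis
      proof (rule S.M.finsum_cong'[OF refl])
        fix y assume y: "y \<in> ?P"
        then have "c y \<in> carrier K" "y \<in> carrier T" using c P by auto
        then show "\<kappa> ab (c y \<odot>\<^bsub>T\<^esub> y) = (if x = y then c y else \<zero>\<^bsub>scalars K\<^esub>)"
          using module_hom_smult[OF \<kappa>_hom[OF ab(2)]] \<kappa>x[OF y] by simp
      qed (use c in \<open>auto simp: Pi_iff\<close>)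
    qed
    also have "\<dots> = c x"
    proof -
      interpret S: module K "scalars K" by (rule V.R.scalars_module)
      show ?thesis using c x P by (intro S.M.finsum_singleton) (auto simp: Pi_iff)
    qed
    finally show "c x = \<zero>\<^bsub>K\<^esub>" ..
  qed
  have sub: "submodule K (T.span ?P) T" by (rule T.span_is_submodule[OF P(2)])
  have "X \<in> T.span ?P" if "X \<in> carrier T" for X
    using that
  proof (induct rule: tensor_induct)
    case (pure v w)
    have pv: "p a v \<in> carrier K" if "a \<in> A" for a using module_hom_in[OF p[OF that] pure(1)] by simp
    have qw: "q b w \<in> carrier K" if "b \<in> B" for b using module_hom_in[OF q[OF that] pure(2)] by simp
    have "pure v w = pure (\<Oplus>\<^bsub>V\<^esub>a\<in>A. p a v \<odot>\<^bsub>V\<^esub> a) w" using pure by (simp add: p_sum)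
    also have "\<dots> = (\<Oplus>\<^bsub>T\<^esub>a\<in>A. pure (p a v \<odot>\<^bsub>V\<^esub> a) w)"
      using pure A pv by (intro module_hom_finsum[OF V_module tensor_module bilinear_left[OF pure_bilinear]]) auto
    also have "\<dots> \<in> T.span ?P"
    proof (rule submodule_finsum[OF sub])
      fix a assume a: "a \<in> A"
      have aV: "p a v \<odot>\<^bsub>V\<^esub> a \<in> carrier V" using a A pv by auto
      have "pure (p a v \<odot>\<^bsub>V\<^esub> a) w = pure (p a v \<odot>\<^bsub>V\<^esub> a) (\<Oplus>\<^bsub>W\<^esub>b\<in>B. q b w \<odot>\<^bsub>W\<^esub> b)"
        using pure by (simp add: q_sum)
      also have "\<dots> = (\<Oplus>\<^bsub>T\<^esub>b\<in>B. pure (p a v \<odot>\<^bsub>V\<^esub> a) (q b w \<odot>\<^bsub>W\<^esub> b))"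
        using aV B qw
        by (intro module_hom_finsum[OF W_module tensor_module bilinear_right[OF pure_bilinear]]) auto
      also have "\<dots> \<in> T.span ?P"
      proof (rule submodule_finsum[OF sub])
        fix b assume b: "b \<in> B"
        have "pure a b \<in> T.span ?P"
          using a b T.in_own_span[OF P(2)] by blast
        then have "q b w \<odot>\<^bsub>T\<^esub> (p a v \<odot>\<^bsub>T\<^esub> pure a b) \<in> T.span ?P"
          using pv qw a b by (intro submodule.smult_closed[OF sub]) auto
        moreover have "pure (p a v \<odot>\<^bsub>V\<^esub> a) (q b w \<odot>\<^bsub>W\<^esub> b) = q b w \<odot>\<^bsub>T\<^esub> (p a v \<odot>\<^bsub>T\<^esub> pure a b)"
          using a b A B pv qw by (auto simp: pure_simps subset_iff)
        ultimately show "pure (p a v \<odot>\<^bsub>V\<^esub> a) (q b w \<odot>\<^bsub>W\<^esub> b) \<in> T.span ?P" by simp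
      qed
      finally show "pure (p a v \<odot>\<^bsub>V\<^esub> a) w \<in> T.span ?P" .
    qed
    finally show ?case .
  next
    case (add X Y)
    then show ?case by (intro submodule.m_closed[OF sub])
  qed
  then have gen: "T.span ?P = carrier T"
    using T.span_is_subset2[OF P(2)] by blast
  have "VS.basis ?P" using li gen P(2) by (simp add: VS.basis_def)
  then have "VS.dim = V.dim * W.dim" using VS.dim_basis[OF P(1)] P(3) by simp
  moreover have "VS.fin_dim" unfolding VS.fin_dim_def using P gen by blast
  ultimately show ?thesis by (simp add: has_dimension_def)
qed

end

section \<open>Nontriviality of the cohomology of the tensor product\<close>

text \<open>If \<open>M\<close> were zero, the zero cochain would be the only one, and it is a coboundary.\<close>

lemma (in lie_module) nontrivial_imp_nonzero:
  assumes "cohomologically_nontrivial K L M"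
  obtains m where "m \<in> carrier M" "m \<noteq> \<zero>\<^bsub>M\<^esub>"
proof (rule ccontr)
  assume "\<not> thesis"
  with that have zero: "m = \<zero>\<^bsub>M\<^esub>" if "m \<in> carrier M" for m using \<open>m \<in> carrier M\<close> by blast
  obtain n f where f: "f \<in> cocycles K L M n" "f \<notin> coboundaries K L M n"
    using assms by (auto simp: cohomologically_nontrivial_iff)
  have fM: "f xs \<in> carrier M" if "xs \<in> tuples L n" for xs
    using f(1) that by (simp add: cocycles_def cochains_simps alternating_maps_def Pi_iff)
  have fe: "f \<in> extensional (tuples L n)"
    using f(1) by (simp add: cocycles_def cochains_simps)
  have "f = (\<lambda>xs\<in>tuples L n. \<zero>\<^bsub>M\<^esub>)"
    by (rule extensionalityI[OF fe restrict_extensional]) (use fM zero in auto)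
  with f(2) submodule.zero_closed[OF coboundaries_submodule] show False by simp
qed

context lie_module_tensor
begin

sublocale MS: tensor_spaces K M VK
  using VK.module_axioms M.vectorspace_axioms field_axioms
  by (simp add: tensor_spaces_def vectorspace_def)

lemma one_hom: "(\<lambda>x. LA.pure x \<one>\<^bsub>A\<^esub>) \<in> module_hom K L LA.LA"
  using bilinear_left[OF LA.pure_bilinear, of "\<one>\<^bsub>A\<^esub>"] by (simp add: module_hom_def)

lemma slice_left_act:
  assumes g: "g \<in> module_hom K VK (scalars K)" and x: "x \<in> carrier L" and w: "w \<in> carrier MV.T"
  shows "MS.slice_left g (lie_act N (LA.pure x \<one>\<^bsub>A\<^esub>) w) = lie_act M x (MS.slice_left g w)"
proof (rule MV.tensor_hom_eqI[OF _ _ _ w])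
  have x1: "LA.pure x \<one>\<^bsub>A\<^esub> \<in> carrier LA.T" using x by (intro LA.pure_closed) auto
  show "(\<lambda>w. MS.slice_left g (lie_act N (LA.pure x \<one>\<^bsub>A\<^esub>) w)) \<in> module_hom K MV.T M"
    by (rule module_hom_comp[OF bilinear_right[OF lie_act_N_bilinear x1] MS.slice_left_hom[OF g]])
  show "(\<lambda>w. lie_act M x (MS.slice_left g w)) \<in> module_hom K MV.T M"
    by (rule module_hom_comp[OF MS.slice_left_hom[OF g] act_hom_right[OF x]])
  fix m v assume mv: "m \<in> carrier M" "v \<in> carrier VK"
  then show "MS.slice_left g (lie_act N (LA.pure x \<one>\<^bsub>A\<^esub>) (MV.pure m v))
      = lie_act M x (MS.slice_left g (MV.pure m v))"
    using x module_hom_in[OF g mv(2)]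
    by (simp add: lie_act_N_pure MS.slice_left_pure[OF g] act_closed act_smult_right)
qed

text \<open>Restriction along \<open>x \<mapsto> x \<otimes> 1\<close> followed by \<open>id \<otimes> g\<close>, where \<open>g v = 1\<close>, takes
  the cocycle built from \<open>f\<close> and \<open>v\<close> back to \<open>f\<close>, and coboundaries to
  coboundaries.\<close>

theorem tensor_nontrivial:
  assumes nontriv: "cohomologically_nontrivial K L M"
    and fd: "vectorspace.fin_dim K VK" and v: "v \<in> carrier V" "v \<noteq> \<zero>\<^bsub>V\<^esub>"
  shows "cohomologically_nontrivial K LA.LA N"
proof -
  obtain g where g: "g \<in> module_hom K VK (scalars K)" "g v = \<one>\<^bsub>K\<^esub>"
    using MS.W.form_exists[OF fd, of v] v by auto
  interpret N: lie_module K LA.LA N by (rule N_lie_module)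
  have "MS.slice_left g \<in> module_hom K N M"
    using MS.slice_left_hom[OF g(1)] by (simp add: module_hom_def)
  then interpret pair: compatible_pair K L M LA.LA N "\<lambda>x. LA.pure x \<one>\<^bsub>A\<^esub>" "MS.slice_left g"
    using one_hom slice_left_act[OF g(1)]
    by unfold_locales (simp_all add: LA.current_bracket_pure)
  obtain n f where f: "f \<in> cocycles K L M n" "f \<notin> coboundaries K L M n"
    using nontriv by (auto simp: cohomologically_nontrivial_iff)
  obtain G where G: "G \<in> cocycles K LA.LA N n"
    "\<And>xs. xs \<in> tuples L n \<Longrightarrow> G (map (\<lambda>x. LA.pure x \<one>\<^bsub>A\<^esub>) xs) = MV.pure (f xs) v"
    using tensor_cocycle_exists[OF f(1) v(1)] by blast
  have fM: "f xs \<in> carrier M" if "xs \<in> tuples L n" for xs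
    using f(1) that by (simp add: cocycles_def cochains_simps alternating_maps_def Pi_iff)
  have fe: "f \<in> extensional (tuples L n)"
    using f(1) by (simp add: cocycles_def cochains_simps)
  have "pullback L (\<lambda>x. LA.pure x \<one>\<^bsub>A\<^esub>) (MS.slice_left g) n G = f"
    by (rule extensionalityI[OF _ fe])
      (simp_all add: pullback_def G(2) fM MS.slice_left_pure[OF g(1)] v g(2))
  with f(2) pair.pullback_coboundary have "G \<notin> coboundaries K LA.LA N n" by metis
  with G(1) show ?thesis unfolding N.cohomologically_nontrivial_iff by blast
qed

text \<open>Multiplication by \<open>a\<close> in the second factor.  It need not be the action of an element of
  \<open>L \<otimes> A\<close>, but the action of \<open>x \<otimes> a\<close> is its composition with that of \<open>x \<otimes> 1\<close>,
  in either order (\<open>act_scale\<close>).\<close>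

definition scale :: "'a \<Rightarrow> ('m \<times> 'v \<Rightarrow> 'k) set \<Rightarrow> ('m \<times> 'v \<Rightarrow> 'k) set" where
  "scale a = tensor_lift K M VK MV.T (\<lambda>m v. MV.pure m (a \<odot>\<^bsub>V\<^esub> v))"

lemma scale_bilinear: "a \<in> carrier A \<Longrightarrow> (\<lambda>m v. MV.pure m (a \<odot>\<^bsub>V\<^esub> v)) \<in> bilinear_maps K M VK MV.T"
  by (rule bilinear_comp_args[OF MV.pure_bilinear module_hom_id bilinear_right[OF smult_bilinear]])

lemma scale_hom: "a \<in> carrier A \<Longrightarrow> scale a \<in> module_hom K MV.T MV.T"
  unfolding scale_def by (rule MV.tensor_lift_hom[OF MV.tensor_module scale_bilinear])

lemma scale_pure:
  "a \<in> carrier A \<Longrightarrow> m \<in> carrier M \<Longrightarrow> v \<in> carrier V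
    \<Longrightarrow> scale a (MV.pure m v) = MV.pure m (a \<odot>\<^bsub>V\<^esub> v)"
  unfolding scale_def by (subst MV.tensor_lift_pure[OF MV.tensor_module scale_bilinear]) auto

lemma act_scale:
  assumes x: "x \<in> carrier L" and a: "a \<in> carrier A" and w: "w \<in> carrier MV.T"
  shows "lie_act N (LA.pure x \<one>\<^bsub>A\<^esub>) (scale a w) = lie_act N (LA.pure x a) w"
    and "scale a (lie_act N (LA.pure x \<one>\<^bsub>A\<^esub>) w) = lie_act N (LA.pure x a) w"
proof -
  have P: "LA.pure x \<one>\<^bsub>A\<^esub> \<in> carrier LA.T" "LA.pure x a \<in> carrier LA.T"
    using x a by (auto intro: LA.pure_closed)
  note homs = bilinear_right[OF lie_act_N_bilinear P(1)] bilinear_right[OF lie_act_N_bilinear P(2)]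
  show "lie_act N (LA.pure x \<one>\<^bsub>A\<^esub>) (scale a w) = lie_act N (LA.pure x a) w"
    by (rule MV.tensor_hom_eqI[OF module_hom_comp[OF scale_hom[OF a] homs(1)] homs(2) _ w])
      (use x a in \<open>simp add: scale_pure lie_act_N_pure\<close>)
  show "scale a (lie_act N (LA.pure x \<one>\<^bsub>A\<^esub>) w) = lie_act N (LA.pure x a) w"
    by (rule MV.tensor_hom_eqI[OF module_hom_comp[OF homs(1) scale_hom[OF a]] homs(2) _ w])
      (use x a in \<open>simp add: scale_pure lie_act_N_pure act_closed\<close>)
qed

lemma slice_right_scale:
  assumes f: "f \<in> module_hom K M (scalars K)" and a: "a \<in> carrier A" and w: "w \<in> carrier MV.T"
  shows "MS.slice_right f (scale a w) = a \<odot>\<^bsub>V\<^esub> MS.slice_right f w"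
proof (rule MV.tensor_hom_eqI[OF module_hom_comp[OF scale_hom[OF a] MS.slice_right_hom[OF f]]
      module_hom_comp[OF MS.slice_right_hom[OF f] bilinear_right[OF smult_bilinear a]] _ w])
  fix m v assume "m \<in> carrier M" "v \<in> carrier VK"
  then show "MS.slice_right f (scale a (MV.pure m v)) = a \<odot>\<^bsub>V\<^esub> MS.slice_right f (MV.pure m v)"
    using a module_hom_in[OF f, of m] bilinear_simps(4)[OF smult_bilinear, of "f m" a v]
    by (simp add: scale_pure MS.slice_right_pure[OF f])
qed

end

section \<open>Isomorphisms between the tensor products\<close>

lemma dimension_le_one:
  assumes "vectorspace K X" "has_dimension K X e" "e \<le> 1"
  obtains x0 where "x0 \<in> carrier X" "\<And>x. x \<in> carrier X \<Longrightarrow> \<exists>c\<in>carrier K. x = c \<odot>\<^bsub>X\<^esub> x0"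
proof -
  interpret X: vectorspace K X by fact
  obtain B where B: "finite B" "X.basis B"
    using X.finite_basis_exists assms(2) by (auto simp: has_dimension_def)
  have BX: "B \<subseteq> carrier X" and gen: "X.span B = carrier X" using B(2) by (auto simp: X.basis_def)
  have "card B \<le> 1" using X.dim_basis[OF B] assms(2,3) by (simp add: has_dimension_def)
  then obtain x0 where x0: "x0 \<in> carrier X" "B \<subseteq> {x0}"
  proof (cases "B = {}")
    case True
    then show ?thesis using that[of "\<zero>\<^bsub>X\<^esub>"] by simp
  next
    case False
    with B(1) \<open>card B \<le> 1\<close> have "card B = 1" using card_gt_0_iff[of B] by linarith
    then obtain b where "B = {b}" by (auto simp: card_1_singleton_iff)
    then show ?thesis using that[of b] BX by simp
  qed
  have "\<exists>c\<in>carrier K. x = c \<odot>\<^bsub>X\<^esub> x0" if "x \<in> carrier X" for x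
  proof -
    have "x \<in> X.span {x0}" using that gen X.span_is_monotone[OF x0(2)] by blast
    then obtain a where "a \<in> {x0} \<rightarrow> carrier K" "X.lincomb a {x0} = x"
      using X.finite_in_span[of "{x0}" x] x0(1) by auto
    then show ?thesis using x0(1) by (auto simp: X.lincomb_def)
  qed
  with x0(1) show thesis by (rule that)
qed

lemma inj_hom_same_dimension_bij:
  assumes "vectorspace K V" "vectorspace K W" and f: "f \<in> module_hom K V W"
    and d: "has_dimension K V d" "has_dimension K W d" and inj: "inj_on f (carrier V)"
  shows "bij_betw f (carrier V) (carrier W)"
proof -
  interpret linear_map K V W f
    using assms(1,2) f by (simp add: linear_map_def mod_hom_def mod_hom_axioms_def vectorspace_def)
  obtain B where B: "finite B" "V.basis B"
    using V.finite_basis_exists d(1) by (auto simp: has_dimension_def)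
  have BV: "B \<subseteq> carrier V" and li: "\<not> V.module.lin_dep B" using B(2) by (auto simp: V.basis_def)
  have fB: "finite (f ` B)" "f ` B \<subseteq> carrier W" using B BV by auto
  have "\<not> W.module.lin_dep (f ` B)"
  proof (rule W.module.finite_lin_indpt2[OF fB], rule ballI)
    fix c y assume c: "c \<in> f ` B \<rightarrow> carrier K" "W.module.lincomb c (f ` B) = \<zero>\<^bsub>W\<^esub>" and y: "y \<in> f ` B"
    have cf: "c \<circ> f \<in> B \<rightarrow> carrier K" using c(1) by auto
    have "f (V.module.lincomb (c \<circ> f) B) = f \<zero>\<^bsub>V\<^esub>"
      using lincomb_linear_image[OF inj BV c(1) B(1)] c(2) by simp
    then have "V.module.lincomb (c \<circ> f) B = \<zero>\<^bsub>V\<^esub>"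
      by (rule inj_onD[OF inj]) (use BV cf in \<open>auto intro!: V.module.lincomb_closed\<close>)
    then have "\<forall>b\<in>B. (c \<circ> f) b = \<zero>\<^bsub>K\<^esub>"
      using li V.module.lin_dep_crit[OF B(1) order.refl, of "c \<circ> f"] cf by blast
    with y show "c y = \<zero>\<^bsub>K\<^esub>" by auto
  qed
  moreover have "card (f ` B) = d"
    using B d(1) V.dim_basis[OF B] inj BV by (simp add: has_dimension_def card_image inj_on_subset)
  ultimately have "W.basis (f ` B)"
    using d(2) fB by (intro W.dim_li_is_basis) (auto simp: has_dimension_def)
  then have "carrier W = W.module.span (f ` B)" by (simp add: W.basis_def)
  also have "\<dots> \<subseteq> im"
    using BV by (intro W.module.span_is_subset im_is_submodule) (auto simp: im_def)
  finally have "carrier W \<subseteq> f ` carrier V" by (simp add: im_def)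
  with inj show ?thesis by (auto simp: bij_betw_def)
qed

lemma Hom_L_vectorspace:
  assumes "lie_module K L M" "lie_module K L N"
  shows "vectorspace K (Hom_L K L M N)"
proof -
  interpret M: lie_module K L M by fact
  interpret N: lie_module K L N by fact
  have restrict: "restrict f (carrier M) \<in> lie_module_hom K L M N"
    if "f \<in> module_hom K M N"
      "\<And>x m. x \<in> carrier L \<Longrightarrow> m \<in> carrier M \<Longrightarrow> f (lie_act M x m) = lie_act N x (f m)" for f
    using module_hom_cong[OF M.M_module that(1), of "restrict f (carrier M)"] that(2)
    by (simp add: lie_module_hom_def M.act_closed)
  have "module K (Hom_L K L M N)"
    unfolding Hom_L_def
  proof (rule function_module_is_module[OF N.M_module])
    fix f m assume "f \<in> lie_module_hom K L M N" "m \<in> carrier M"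
    then show "f m \<in> carrier N" by (auto simp: lie_module_hom_def intro: module_hom_in)
  next
    show "(\<lambda>m\<in>carrier M. \<zero>\<^bsub>N\<^esub>) \<in> lie_module_hom K L M N"
      using module_hom_zero[OF N.M_module N.M_module N.act_hom_right]
      by (intro restrict module_hom_const_zero[OF N.M_module]) simp
  next
    fix f g assume fg: "f \<in> lie_module_hom K L M N" "g \<in> lie_module_hom K L M N"
    then show "(\<lambda>m\<in>carrier M. f m \<oplus>\<^bsub>N\<^esub> g m) \<in> lie_module_hom K L M N"
      by (intro restrict module_hom_plus[OF N.M_module])
        (simp_all add: lie_module_hom_def N.act_add_right module_hom_in[of f K M N] module_hom_in[of g K M N])
  next
    fix c f assume cf: "c \<in> carrier K" "f \<in> lie_module_hom K L M N"
    then show "(\<lambda>m\<in>carrier M. c \<odot>\<^bsub>N\<^esub> f m) \<in> lie_module_hom K L M N"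
      by (intro restrict module_hom_smult'[OF N.M_module])
        (simp_all add: lie_module_hom_def N.act_smult_right module_hom_in[of f K M N])
  qed
  then show ?thesis using M.field_axioms by (simp add: vectorspace_def)
qed

lemma Hom_A_vectorspace:
  assumes "field K" "algebra K A" "module A V" "module A W"
  shows "vectorspace K (Hom_A A V W)"
proof -
  interpret A: algebra K A by fact
  interpret V: module A V by fact
  interpret W: module A W by fact
  have restrict: "restrict f (carrier V) \<in> module_hom A V W" if "f \<in> module_hom A V W" for f
    by (rule module_hom_cong[OF assms(3) that]) simp
  have "module K (Hom_A A V W)"
    unfolding Hom_A_def
    by (rule function_module_is_module[OF restrict_scalars_module[OF assms(2,4)]])
      (auto intro!: restrict module_hom_const_zero[OF assms(4)] module_hom_plus[OF assms(4)]
        module_hom_smult'[OF assms(4)] intro: module_hom_in)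
  then show ?thesis using assms(1) by (simp add: vectorspace_def)
qed

text \<open>The endomorphisms are the multiples of a single one \<open>x\<close>.  The identity is such a multiple
  \<open>c x\<close>; so \<open>x\<close> is itself a scalar, or \<open>c = 0\<close> and \<open>M\<close> is zero.\<close>

lemma endomorphisms_scalar:
  assumes "lie_module K L M" and dim: "has_dimension K (Hom_L K L M M) 1"
    and h: "h \<in> lie_module_hom K L M M"
  obtains c where "c \<in> carrier K" "\<And>m. m \<in> carrier M \<Longrightarrow> h m = c \<odot>\<^bsub>M\<^esub> m"
proof -
  interpret M: lie_module K L M by fact
  let ?H = "Hom_L K L M M"
  obtain x where x: "x \<in> carrier ?H" "\<And>y. y \<in> carrier ?H \<Longrightarrow> \<exists>c\<in>carrier K. y = c \<odot>\<^bsub>?H\<^esub> x"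
    using dimension_le_one[OF Hom_L_vectorspace[OF assms(1,1)] dim] by auto
  have xM: "x m \<in> carrier M" if "m \<in> carrier M" for m
    using x(1) that by (auto simp: Hom_L_def lie_module_hom_def intro: module_hom_in)
  have restrict: "restrict f (carrier M) \<in> carrier ?H" if "f \<in> lie_module_hom K L M M" for f
    using module_hom_cong[OF M.M_module, of f M "restrict f (carrier M)"] that
    by (simp add: Hom_L_def lie_module_hom_def M.act_closed)
  have mult: "\<exists>c\<in>carrier K. \<forall>m\<in>carrier M. f m = c \<odot>\<^bsub>M\<^esub> x m"
    if f: "f \<in> lie_module_hom K L M M" for f
  proof -
    obtain c where "c \<in> carrier K" "restrict f (carrier M) = c \<odot>\<^bsub>?H\<^esub> x"
      using x(2)[OF restrict[OF f]] by blast
    then show ?thesis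
      by (intro bexI[of _ c]) (auto simp: Hom_L_def fun_eq_iff split: if_splits)
  qed
  obtain c where c: "c \<in> carrier K" "\<And>m. m \<in> carrier M \<Longrightarrow> m = c \<odot>\<^bsub>M\<^esub> x m"
    using mult[of "\<lambda>m. m"] by (auto simp: lie_module_hom_def module_hom_id)
  obtain c' where c': "c' \<in> carrier K" "\<And>m. m \<in> carrier M \<Longrightarrow> h m = c' \<odot>\<^bsub>M\<^esub> x m"
    using mult[OF h] by blast
  show thesis
  proof (cases "c = \<zero>\<^bsub>K\<^esub>")
    case True
    then have zero: "m = \<zero>\<^bsub>M\<^esub>" if "m \<in> carrier M" for m
      using c(2)[OF that] xM[OF that] by simp
    have "h m = \<zero>\<^bsub>K\<^esub> \<odot>\<^bsub>M\<^esub> m" if "m \<in> carrier M" for m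
      using zero[of "h m"] h that by (auto simp: lie_module_hom_def module_hom_def Pi_iff)
    then show ?thesis by (intro that[of "\<zero>\<^bsub>K\<^esub>"]) auto
  next
    case False
    then have u: "c \<in> Units K" using c(1) M.field_Units by blast
    have "x m = inv\<^bsub>K\<^esub> c \<odot>\<^bsub>M\<^esub> m" if "m \<in> carrier M" for m
      using M.M.mult_inverse[OF c(1) xM[OF that] _ False] c(2)[OF that] by simp
    then show ?thesis
      using c' u by (intro that[of "c' \<otimes>\<^bsub>K\<^esub> inv\<^bsub>K\<^esub> c"]) (auto simp: module.smult_assoc1[OF M.M_module])
  qed
qed

locale tensor_iso = V: lie_module_tensor K L M A V + W: lie_module_tensor K L M A W
  for K :: "('k, 'x) ring_scheme" and L :: "('k, 'l, 'y) lie_alg_scheme"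
    and M :: "('k, 'l, 'm, 'z) lie_mod_scheme"
    and A :: "('k, 'a, 't) module_scheme" and V :: "('a, 'v, 'u) module_scheme"
    and W :: "('a, 'w, 's) module_scheme" +
  fixes F
  assumes F_hom: "F \<in> module_hom K V.MV.T W.MV.T"
    and F_inj: "inj_on F (carrier V.MV.T)"
    and F_act: "\<And>x w. x \<in> carrier V.LA.T \<Longrightarrow> w \<in> carrier V.MV.T
      \<Longrightarrow> F (lie_act V.N x w) = lie_act W.N x (F w)"
    and image_or_invariants: "lie_image K L M = carrier M \<or> \<not> has_trivial_submodule K L M"
    and fin_dim_M: "vectorspace.fin_dim K M"
    and fin_dim_W: "vectorspace.fin_dim K W.VK"
begin

lemma F_in: "m \<in> carrier M \<Longrightarrow> v \<in> carrier V \<Longrightarrow> F (V.MV.pure m v) \<in> carrier W.MV.T"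
  using module_hom_in[OF F_hom V.MV.pure_closed] by simp

lemma F_hom_left: "v \<in> carrier V \<Longrightarrow> (\<lambda>m. F (V.MV.pure m v)) \<in> module_hom K M W.MV.T"
  using module_hom_comp[OF bilinear_left[OF V.MV.pure_bilinear] F_hom] by simp

lemma F_hom_right: "m \<in> carrier M \<Longrightarrow> (\<lambda>v. F (V.MV.pure m v)) \<in> module_hom K V.VK W.MV.T"
  by (rule module_hom_comp[OF bilinear_right[OF V.MV.pure_bilinear] F_hom])

lemma F_act_pure:
  assumes "x \<in> carrier L" "a \<in> carrier A" "m \<in> carrier M" "v \<in> carrier V"
  shows "F (V.MV.pure (lie_act M x m) (a \<odot>\<^bsub>V\<^esub> v)) = lie_act W.N (V.LA.pure x a) (F (V.MV.pure m v))"
  using F_act[of "V.LA.pure x a" "V.MV.pure m v"] assms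
  by (simp add: V.lie_act_N_pure V.LA.pure_closed V.MV.pure_closed)

text \<open>The vectors annihilated by \<open>L\<close> form a submodule with trivial action.\<close>

lemma no_invariants:
  assumes "\<not> has_trivial_submodule K L M" "m \<in> carrier M"
    and "\<And>x. x \<in> carrier L \<Longrightarrow> lie_act M x m = \<zero>\<^bsub>M\<^esub>"
  shows "m = \<zero>\<^bsub>M\<^esub>"
proof (rule ccontr)
  assume nz: "m \<noteq> \<zero>\<^bsub>M\<^esub>"
  let ?N = "{m \<in> carrier M. \<forall>x\<in>carrier L. lie_act M x m = \<zero>\<^bsub>M\<^esub>}"
  have z: "lie_act M x \<zero>\<^bsub>M\<^esub> = \<zero>\<^bsub>M\<^esub>" if "x \<in> carrier L" for x
    using module_hom_zero[OF V.M_module V.M_module V.act_hom_right[OF that]] .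
  have "submodule K ?N M"
    using V.M_module module.smult_closed[OF V.M_module]
    by (simp add: submodule_def V.act_add_right V.act_smult_right z subset_eq)
  then have "has_trivial_submodule K L M"
    unfolding has_trivial_submodule_def lie_submodule_def
    using nz assms(2,3) z by (intro exI[of _ ?N]) auto
  with assms(1) show False by simp
qed

text \<open>The difference of both sides is a function of \<open>m\<close> that vanishes on \<open>L M\<close>, because
  \<open>x \<otimes> a\<close> acts as \<open>x \<otimes> 1\<close> followed by multiplication by \<open>a\<close>; and its values are
  annihilated by all \<open>x \<otimes> 1\<close>, because \<open>x \<otimes> a\<close> also acts as these maps in the other order.
  In the second alternative the slices \<open>(id \<otimes> g)\<close> of such a value are vectors of \<open>M\<close>
  annihilated by \<open>L\<close>, hence zero.\<close>

lemma F_scale: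
  assumes a: "a \<in> carrier A" and m: "m \<in> carrier M" and v: "v \<in> carrier V"
  shows "F (V.MV.pure m (a \<odot>\<^bsub>V\<^esub> v)) = W.scale a (F (V.MV.pure m v))"
proof -
  have av: "a \<odot>\<^bsub>V\<^esub> v \<in> carrier V" using a v by simp
  have act: "F (V.MV.pure (lie_act M x m) (a \<odot>\<^bsub>V\<^esub> v)) = W.scale a (F (V.MV.pure (lie_act M x m) v))"
    if "x \<in> carrier L" "m \<in> carrier M" for x m
    using F_act_pure[OF that(1) a that(2) v] F_act_pure[OF that(1) V.A.one_closed that(2) v]
      W.act_scale(2)[OF that(1) a F_in[OF that(2) v]] v by simp
  note homs = F_hom_left[OF av] module_hom_comp[OF F_hom_left[OF v] W.scale_hom[OF a]]
  from image_or_invariants show ?thesis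
  proof
    assume image: "lie_image K L M = carrier M"
    let ?E = "{m \<in> carrier M. F (V.MV.pure m (a \<odot>\<^bsub>V\<^esub> v)) = W.scale a (F (V.MV.pure m v))}"
    have "submodule K ?E M"
      by (rule submodule_eq[OF V.M_module W.MV.tensor_module homs])
    moreover have "{lie_act M x m |x m. x \<in> carrier L \<and> m \<in> carrier M} \<subseteq> ?E"
      using act V.act_closed by auto
    ultimately have "lie_image K L M \<subseteq> ?E"
      unfolding lie_image_def by (intro module.span_is_subset[OF V.M_module])
    with image m show ?thesis by auto
  next
    assume inv: "\<not> has_trivial_submodule K L M"
    let ?D = "F (V.MV.pure m (a \<odot>\<^bsub>V\<^esub> v)) \<ominus>\<^bsub>W.MV.T\<^esub> W.scale a (F (V.MV.pure m v))"
    have in1: "F (V.MV.pure m (a \<odot>\<^bsub>V\<^esub> v)) \<in> carrier W.MV.T" by (rule F_in[OF m av])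
    have in2: "W.scale a (F (V.MV.pure m v)) \<in> carrier W.MV.T"
      by (rule module_hom_in[OF W.scale_hom[OF a] F_in[OF m v]])
    have D: "?D \<in> carrier W.MV.T" using in1 in2 by simp
    have killed: "lie_act W.N (V.LA.pure x \<one>\<^bsub>A\<^esub>) ?D = \<zero>\<^bsub>W.MV.T\<^esub>" if x: "x \<in> carrier L" for x
    proof -
      have x1: "V.LA.pure x \<one>\<^bsub>A\<^esub> \<in> carrier V.LA.T" using x by (intro V.LA.pure_closed) auto
      have "lie_act W.N (V.LA.pure x \<one>\<^bsub>A\<^esub>) ?D
          = lie_act W.N (V.LA.pure x \<one>\<^bsub>A\<^esub>) (F (V.MV.pure m (a \<odot>\<^bsub>V\<^esub> v)))
            \<ominus>\<^bsub>W.MV.T\<^esub> lie_act W.N (V.LA.pure x \<one>\<^bsub>A\<^esub>) (W.scale a (F (V.MV.pure m v)))"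
        by (rule module_hom_minus[OF W.MV.tensor_module W.MV.tensor_module
              bilinear_right[OF W.lie_act_N_bilinear x1] in1 in2])
      also have "\<dots> = \<zero>\<^bsub>W.MV.T\<^esub>"
        using F_act_pure[OF x V.A.one_closed m av] F_act_pure[OF x a m v] av
          W.act_scale(1)[OF x a F_in[OF m v]]
          module_hom_in[OF bilinear_right[OF W.lie_act_N_bilinear x1] in1]
        by (simp add: W.MV.T.M.r_neg W.MV.T.M.minus_eq)
      finally show ?thesis .
    qed
    have "?D = \<zero>\<^bsub>W.MV.T\<^esub>"
    proof (rule W.MS.zero_if_slices_left_zero[OF fin_dim_W D])
      fix g assume g: "g \<in> module_hom K W.VK (scalars K)"
      show "W.MS.slice_left g ?D = \<zero>\<^bsub>M\<^esub>"
      proof (rule no_invariants[OF inv])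
        show "W.MS.slice_left g ?D \<in> carrier M"
          by (rule module_hom_in[OF W.MS.slice_left_hom[OF g] D])
        fix x assume x: "x \<in> carrier L"
        show "lie_act M x (W.MS.slice_left g ?D) = \<zero>\<^bsub>M\<^esub>"
          unfolding W.slice_left_act[OF g x D, symmetric] killed[OF x]
          by (rule module_hom_zero[OF W.MV.tensor_module V.M_module W.MS.slice_left_hom[OF g]])
      qed
    qed
    then show ?thesis using in1 in2 by simp
  qed
qed

lemma slice_right_module_hom:
  assumes f: "f \<in> module_hom K M (scalars K)" and m: "m \<in> carrier M"
  shows "(\<lambda>v. W.MS.slice_right f (F (V.MV.pure m v))) \<in> module_hom A V W"
proof (rule module_homI)
  note hom = module_hom_comp[OF F_hom_right[OF m] W.MS.slice_right_hom[OF f]]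
  fix v w assume v: "v \<in> carrier V" "w \<in> carrier V"
  then show "W.MS.slice_right f (F (V.MV.pure m v)) \<in> carrier W"
    "W.MS.slice_right f (F (V.MV.pure m (v \<oplus>\<^bsub>V\<^esub> w)))
      = W.MS.slice_right f (F (V.MV.pure m v)) \<oplus>\<^bsub>W\<^esub> W.MS.slice_right f (F (V.MV.pure m w))"
    using module_hom_in[OF hom, of v] module_hom_add[OF hom, of v w] by simp_all
next
  fix a v assume "a \<in> carrier A" "v \<in> carrier V"
  then show "W.MS.slice_right f (F (V.MV.pure m (a \<odot>\<^bsub>V\<^esub> v)))
      = a \<odot>\<^bsub>W\<^esub> W.MS.slice_right f (F (V.MV.pure m v))"
    using m by (simp add: F_scale W.slice_right_scale[OF f] F_in)
qed

lemma slice_left_module_hom: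
  assumes g: "g \<in> module_hom K W.VK (scalars K)" and v: "v \<in> carrier V"
  shows "(\<lambda>m. W.MS.slice_left g (F (V.MV.pure m v))) \<in> lie_module_hom K L M M"
proof -
  have "W.MS.slice_left g (F (V.MV.pure (lie_act M x m) v))
      = lie_act M x (W.MS.slice_left g (F (V.MV.pure m v)))"
    if "x \<in> carrier L" "m \<in> carrier M" for x m
    using F_act_pure[OF that(1) V.A.one_closed that(2) v] W.slice_left_act[OF g that(1) F_in[OF that(2) v]] v
    by simp
  then show ?thesis
    using module_hom_comp[OF F_hom_left[OF v] W.MS.slice_left_hom[OF g]]
    by (simp add: lie_module_hom_def)
qed

text \<open>If \<open>V\<close> and \<open>W\<close> were not isomorphic, there would be a nonzero \<open>v\<close> with
  \<open>F (m0 \<otimes> v) = 0\<close>, against the injectivity of \<open>F\<close>.  The vector \<open>v\<close> is taken from the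
  kernel of an \<open>A\<close>-homomorphism from \<open>V\<close> to \<open>W\<close>.\<close>

theorem factors_isomorphic:
  assumes M: "m0 \<in> carrier M" "m0 \<noteq> \<zero>\<^bsub>M\<^esub>"
    and dims: "has_dimension K V.VK d" "has_dimension K W.VK d"
    and cases: "has_dimension K (Hom_L K L M M) 1 \<or> (\<exists>e\<le>1. has_dimension K (Hom_A A V W) e)"
  shows "module_iso A V W"
proof (rule ccontr)
  assume no_iso: "\<not> module_iso A V W"
  have K: "field K" by (rule V.field_axioms)
  have kernel: "\<exists>v\<in>carrier V. v \<noteq> \<zero>\<^bsub>V\<^esub> \<and> b v = \<zero>\<^bsub>W\<^esub>" if b: "b \<in> module_hom A V W" for b
  proof (rule ccontr)
    assume no: "\<not> ?thesis"
    have bK: "b \<in> module_hom K V.VK W.VK"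
      by (rule module_hom_restrict_scalars[OF V.A.algebra_axioms b])
    have "inj_on b (carrier V)"
      using no unfolding module_hom_inj_iff[OF V.V.module_axioms W.V.module_axioms b] by blast
    then have "bij_betw b (carrier V.VK) (carrier W.VK)"
      using V.MS.W.vectorspace_axioms W.MS.W.vectorspace_axioms
      by (intro inj_hom_same_dimension_bij[OF _ _ bK dims]) simp_all
    with b no_iso show False by (auto simp: module_iso_def)
  qed
  have contra: False
    if v: "v \<in> carrier V" "v \<noteq> \<zero>\<^bsub>V\<^esub>" and zero: "F (V.MV.pure m0 v) = \<zero>\<^bsub>W.MV.T\<^esub>" for v
  proof -
    have "V.MV.pure m0 v = \<zero>\<^bsub>V.MV.T\<^esub>"
      using F_inj module_hom_inj_iff[OF V.MV.tensor_module W.MV.tensor_module F_hom] zero M(1) v(1)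
        V.MV.pure_closed[of m0 v] by simp
    then show False
      using V.MS.pure_nonzero[of m0 v] dims(1) M v by (simp add: has_dimension_def)
  qed
  from cases show False
  proof
    \<comment> \<open>One form \<open>f\<close> with \<open>f m0 = 1\<close> is enough: the slices of \<open>F (m0 \<otimes> v)\<close> by forms on
  \<open>W\<close> are multiples of \<open>m0\<close>, and \<open>f\<close> detects the factor.\<close>
    assume dim: "has_dimension K (Hom_L K L M M) 1"
    obtain f where f: "f \<in> module_hom K M (scalars K)" "f m0 = \<one>\<^bsub>K\<^esub>"
      using vectorspace.form_exists[OF V.M.vectorspace_axioms fin_dim_M M] .
    obtain v where v: "v \<in> carrier V" "v \<noteq> \<zero>\<^bsub>V\<^esub>"
      and fv: "W.MS.slice_right f (F (V.MV.pure m0 v)) = \<zero>\<^bsub>W\<^esub>"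
      using kernel[OF slice_right_module_hom[OF f(1) M(1)]] by blast
    have "F (V.MV.pure m0 v) = \<zero>\<^bsub>W.MV.T\<^esub>"
    proof (rule W.MS.zero_if_slices_left_zero[OF fin_dim_W F_in[OF M(1) v(1)]])
      fix g assume g: "g \<in> module_hom K W.VK (scalars K)"
      obtain c where c: "c \<in> carrier K" "W.MS.slice_left g (F (V.MV.pure m0 v)) = c \<odot>\<^bsub>M\<^esub> m0"
        using endomorphisms_scalar[OF V.lie_module_axioms dim slice_left_module_hom[OF g v(1)]] M(1)
        by blast
      have "c = f (c \<odot>\<^bsub>M\<^esub> m0)"
        using c(1) M(1) f(2) module_hom_smult[OF f(1) c(1) M(1)] by simp
      also have "\<dots> = g (W.MS.slice_right f (F (V.MV.pure m0 v)))"
        using W.MS.slices_commute[OF f(1) g F_in[OF M(1) v(1)]] c(2) by simp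
      also have "\<dots> = \<zero>\<^bsub>K\<^esub>"
        using module_hom_zero[OF W.VK.module_axioms V.scalars_module g] fv by simp
      finally show "W.MS.slice_left g (F (V.MV.pure m0 v)) = \<zero>\<^bsub>M\<^esub>"
        using c(2) M(1) by simp
    qed
    with contra v show False by blast
  next
    assume "\<exists>e\<le>1. has_dimension K (Hom_A A V W) e"
    then obtain e where e: "e \<le> 1" "has_dimension K (Hom_A A V W) e" by blast
    let ?H = "Hom_A A V W"
    obtain b where b: "b \<in> carrier ?H" "\<And>y. y \<in> carrier ?H \<Longrightarrow> \<exists>c\<in>carrier K. y = c \<odot>\<^bsub>?H\<^esub> b"
      using dimension_le_one[OF Hom_A_vectorspace[OF K V.A.algebra_axioms V.V.module_axioms
            W.V.module_axioms] e(2,1)] by auto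
    \<comment> \<open>As \<open>b\<close> spans the \<open>A\<close>-homomorphisms, all of them vanish at \<open>v\<close>.\<close>
    obtain v where v: "v \<in> carrier V" "v \<noteq> \<zero>\<^bsub>V\<^esub>" "b v = \<zero>\<^bsub>W\<^esub>"
      using kernel[of b] b(1) by (auto simp: Hom_A_def)
    have "h v = \<zero>\<^bsub>W\<^esub>" if h: "h \<in> module_hom A V W" for h
    proof -
      have "restrict h (carrier V) \<in> carrier ?H"
        using module_hom_cong[OF V.V.module_axioms h, of "restrict h (carrier V)"]
        by (simp add: Hom_A_def)
      then obtain c where "c \<in> carrier K" "restrict h (carrier V) = c \<odot>\<^bsub>?H\<^esub> b"
        using b(2) by blast
      then have "restrict h (carrier V) v = (c \<odot>\<^bsub>?H\<^esub> b) v" by simp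
      then show ?thesis
        using v \<open>c \<in> carrier K\<close> by (simp add: Hom_A_def)
    qed
    then have "F (V.MV.pure m0 v) = \<zero>\<^bsub>W.MV.T\<^esub>"
      using slice_right_module_hom M(1) v(1)
      by (intro W.MS.zero_if_slices_zero[OF fin_dim_M fin_dim_W F_in]) auto
    with contra v show False by blast
  qed
qed

end

section \<open>Copies of modules on another type\<close>

text \<open>Transport of structure along a map \<open>\<phi>\<close> that is injective on the carrier.  Here it replaces the
  cosets of formal sums of pairs, whose type depends on the factors, by sequences of scalars.\<close>

definition copy_module :: "('m \<Rightarrow> 'n) \<Rightarrow> ('k, 'l, 'm, 'z) lie_mod_scheme \<Rightarrow> ('k, 'l, 'n) lie_mod" where
  "copy_module \<phi> N =
    \<lparr>carrier = \<phi> ` carrier N,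
     mult = (\<lambda>x y. \<phi> \<zero>\<^bsub>N\<^esub>), one = \<phi> \<zero>\<^bsub>N\<^esub>, zero = \<phi> \<zero>\<^bsub>N\<^esub>,
     add = (\<lambda>x y. \<phi> (the_inv_into (carrier N) \<phi> x \<oplus>\<^bsub>N\<^esub> the_inv_into (carrier N) \<phi> y)),
     smult = (\<lambda>c x. \<phi> (c \<odot>\<^bsub>N\<^esub> the_inv_into (carrier N) \<phi> x)),
     lie_act = (\<lambda>x y. \<phi> (lie_act N x (the_inv_into (carrier N) \<phi> y)))\<rparr>"

lemma copy_module:
  assumes N: "lie_module K L N" and inj: "inj_on \<phi> (carrier N)"
  shows "lie_module K L (copy_module \<phi> N)" and "lie_module_iso K L N (copy_module \<phi> N)"
proof -
  interpret N: lie_module K L N by fact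
  let ?C = "copy_module \<phi> N"
  have car: "carrier ?C = \<phi> ` carrier N" and zero: "\<zero>\<^bsub>?C\<^esub> = \<phi> \<zero>\<^bsub>N\<^esub>"
    by (simp_all add: copy_module_def)
  have add: "\<phi> m \<oplus>\<^bsub>?C\<^esub> \<phi> n = \<phi> (m \<oplus>\<^bsub>N\<^esub> n)" if "m \<in> carrier N" "n \<in> carrier N" for m n
    using that by (simp add: copy_module_def the_inv_into_f_f[OF inj])
  have smult: "c \<odot>\<^bsub>?C\<^esub> \<phi> m = \<phi> (c \<odot>\<^bsub>N\<^esub> m)" if "m \<in> carrier N" for c m
    using that by (simp add: copy_module_def the_inv_into_f_f[OF inj])
  have act: "lie_act ?C x (\<phi> m) = \<phi> (lie_act N x m)" if "m \<in> carrier N" for x m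
    using that by (simp add: copy_module_def the_inv_into_f_f[OF inj])
  have C: "module K ?C"
  proof (rule module_criteria)
    show "\<forall>v\<in>carrier ?C. \<exists>w\<in>carrier ?C. v \<oplus>\<^bsub>?C\<^esub> w = \<zero>\<^bsub>?C\<^esub>"
      unfolding car
    proof (clarify)
      fix m assume "m \<in> carrier N"
      then show "\<exists>w\<in>\<phi> ` carrier N. \<phi> m \<oplus>\<^bsub>?C\<^esub> w = \<zero>\<^bsub>?C\<^esub>"
        by (intro bexI[of _ "\<phi> (\<ominus>\<^bsub>N\<^esub> m)"]) (auto simp: add zero N.M.module.M.r_neg)
    qed
  qed (use N.is_cring in \<open>auto simp: car zero add smult N.M.module.M.a_ac N.M.module.smult_assoc1
        N.M.module.smult_l_distr N.M.module.smult_r_distr\<close>)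
  have hom: "\<phi> \<in> module_hom K N ?C"
    by (rule module_homI) (auto simp: car add smult)
  note minus = module_hom_minus[OF N.M_module C hom]
  have "vectorspace K ?C" using C N.field_axioms by (simp add: vectorspace_def)
  then show "lie_module K L ?C"
  proof (rule lie_module.intro[OF N.lie_algebra_axioms], intro lie_module_axioms.intro)
    fix x y m assume xy: "x \<in> carrier L" "y \<in> carrier L" and "m \<in> carrier ?C"
    then obtain n where n: "n \<in> carrier N" "m = \<phi> n" by (auto simp: car)
    show "lie_act ?C (bracket L x y) m
        = lie_act ?C x (lie_act ?C y m) \<ominus>\<^bsub>?C\<^esub> lie_act ?C y (lie_act ?C x m)"
      unfolding n(2) using xy n(1)
      by (simp add: act minus[symmetric] N.act_closed N.act_bracket)
  qed (auto simp: car add smult act N.act_closed N.act_add_left N.act_add_right N.act_smult_left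
      N.act_smult_right)
  have "\<phi> \<in> lie_module_hom K L N ?C" using hom by (simp add: lie_module_hom_def act)
  then show "lie_module_iso K L N ?C"
    using inj by (auto simp: lie_module_iso_def bij_betw_def car)
qed

lemma (in vectorspace) injective_coordinates:
  assumes "fin_dim"
  shows "\<exists>\<phi>. inj_on \<phi> (carrier V) \<and> (\<forall>v\<in>carrier V. \<forall>i::nat. \<phi> v i \<in> carrier K)"
proof -
  obtain B e where B: "finite B" "B \<subseteq> carrier V"
    and e: "\<And>b. b \<in> B \<Longrightarrow> e b \<in> module_hom K V (scalars K)"
    and sum: "\<And>v. v \<in> carrier V \<Longrightarrow> (\<Oplus>\<^bsub>V\<^esub>b\<in>B. e b v \<odot>\<^bsub>V\<^esub> b) = v"
    using dual_basis[OF assms] by (elim exE conjE) (rule that, assumption+, (erule (1) bspec)+)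
  obtain b where b: "bij_betw b {0..<card B} B"
    using ex_bij_betw_nat_finite[OF B(1)] ..
  have "inj_on (\<lambda>v i. if i < card B then e (b i) v else \<zero>\<^bsub>K\<^esub>) (carrier V)"
  proof (rule inj_onI)
    fix v w assume v: "v \<in> carrier V" and w: "w \<in> carrier V"
      and eq: "(\<lambda>i. if i < card B then e (b i) v else \<zero>\<^bsub>K\<^esub>) = (\<lambda>i. if i < card B then e (b i) w else \<zero>\<^bsub>K\<^esub>)"
    have coeff: "e c v = e c w" if "c \<in> B" for c
    proof -
      have "c \<in> b ` {0..<card B}" using that bij_betw_imp_surj_on[OF b] by simp
      then obtain i where "c = b i" "i < card B" by (rule imageE) simp
      then show ?thesis using fun_cong[OF eq, of i] by simp
    qed
    have "e c w \<in> carrier K" if "c \<in> B" for c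
      using module_hom_in[OF e[OF that] w] by simp
    then have "(\<Oplus>\<^bsub>V\<^esub>c\<in>B. e c v \<odot>\<^bsub>V\<^esub> c) = (\<Oplus>\<^bsub>V\<^esub>c\<in>B. e c w \<odot>\<^bsub>V\<^esub> c)"
      using B(2) coeff by (intro M.finsum_cong') auto
    then show "v = w" using v w by (simp add: sum)
  qed
  moreover have "(if i < card B then e (b i) v else \<zero>\<^bsub>K\<^esub>) \<in> carrier K" if "v \<in> carrier V" for v i
    using module_hom_in[OF e that] bij_betw_apply[OF b] by simp
  ultimately show ?thesis
    by (intro exI[of _ "\<lambda>v i. if i < card B then e (b i) v else \<zero>\<^bsub>K\<^esub>"]) simp
qed

lemma has_dimension_iso:
  assumes "vectorspace K V" "vectorspace K W" and f: "f \<in> module_hom K V W"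
    and bij: "bij_betw f (carrier V) (carrier W)" and d: "has_dimension K V d"
  shows "has_dimension K W d"
proof -
  interpret linear_map K V W f
    using assms(1,2) f by (simp add: linear_map_def mod_hom_def mod_hom_axioms_def vectorspace_def)
  have fd: "V.fin_dim" "V.dim = d" using d by (auto simp: has_dimension_def)
  have "inj_on f (carrier V)" "f ` carrier V = carrier W" using bij by (auto simp: bij_betw_def)
  then show ?thesis
    using dim_eq[OF fd(1)] surj_fin_dim[OF fd(1)] fd(2) by (simp add: has_dimension_def)
qed

section \<open>Infinitely many nontrivial modules\<close>

text \<open>
  Which injection is chosen does not matter, as all the copies are isomorphic to the tensor product.
  There is one when both factors have finite dimension (\<open>injective_coordinates\<close>).\<close>

definition tensor_copy ::
    "('k, 'x) ring_scheme \<Rightarrow> ('k, 'l, 'y) lie_alg_scheme \<Rightarrow> ('k, 'l, 'm, 'z) lie_mod_scheme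
      \<Rightarrow> ('k, 'a, 't) module_scheme \<Rightarrow> ('a, 'v, 'u) module_scheme
      \<Rightarrow> ('k, ('l \<times> 'a \<Rightarrow> 'k) set, nat \<Rightarrow> 'k) lie_mod" where
  "tensor_copy K L M A V =
    copy_module (SOME \<phi>. inj_on \<phi> (carrier (tensor_lie_module K L M A V))) (tensor_lie_module K L M A V)"

context lie_module_tensor
begin

lemma tensor_copy:
  assumes "vectorspace.fin_dim K M" "vectorspace.fin_dim K VK"
  shows "lie_module K LA.LA (tensor_copy K L M A V)"
    and "lie_module_iso K LA.LA N (tensor_copy K L M A V)"
    and "has_dimension K (tensor_copy K L M A V) (vectorspace.dim K M * vectorspace.dim K VK)"
proof -
  have dim: "has_dimension K MV.T (vectorspace.dim K M * vectorspace.dim K VK)"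
    using MS.tensor_dimension[OF assms] .
  have T: "vectorspace K MV.T" by (rule MS.tensor_vectorspace)
  let ?P = "\<lambda>\<phi> :: ('m \<times> 'v \<Rightarrow> 'k) set \<Rightarrow> nat \<Rightarrow> 'k. inj_on \<phi> (carrier N)"
  have "\<exists>\<phi>. ?P \<phi>"
    using vectorspace.injective_coordinates[OF T] dim by (auto simp: has_dimension_def)
  then have "?P (SOME \<phi>. ?P \<phi>)" by (rule someI_ex)
  from copy_module[OF N_lie_module this]
  show L: "lie_module K LA.LA (tensor_copy K L M A V)"
    and iso: "lie_module_iso K LA.LA N (tensor_copy K L M A V)"
    by (simp_all add: tensor_copy_def)
  interpret C: lie_module K LA.LA "tensor_copy K L M A V" by (rule L)
  obtain f where "f \<in> module_hom K N (tensor_copy K L M A V)"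
    and "bij_betw f (carrier N) (carrier (tensor_copy K L M A V))"
    using iso by (auto simp: lie_module_iso_def lie_module_hom_def)
  then show "has_dimension K (tensor_copy K L M A V) (vectorspace.dim K M * vectorspace.dim K VK)"
    by (intro has_dimension_iso[OF T C.M.vectorspace_axioms _ _ dim, of f]) (simp_all add: module_hom_def)
qed

end

text \<open>Between zero modules the zero map is an isomorphism; so if \<open>V\<close> is zero, then \<open>W\<close>, being of
  the same dimension, is isomorphic to it.\<close>

lemma nonisomorphic_imp_nonzero:
  assumes K: "field K" and A: "algebra K A" and V: "module A V" and W: "module A W"
    and dims: "has_dimension K (restrict_scalars A V) d" "has_dimension K (restrict_scalars A W) d"
    and no_iso: "\<not> module_iso A V W"
  obtains v where "v \<in> carrier V" "v \<noteq> \<zero>\<^bsub>V\<^esub>"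
proof (rule ccontr)
  assume "\<not> thesis"
  with that have zero: "\<forall>v\<in>carrier V. v = \<zero>\<^bsub>V\<^esub>" by blast
  let ?z = "\<lambda>v. \<zero>\<^bsub>W\<^esub>"
  have z: "?z \<in> module_hom A V W" by (rule module_hom_const_zero[OF W])
  have "inj_on ?z (carrier V)" using zero by (intro inj_onI) metis
  then have "bij_betw ?z (carrier V) (carrier W)"
    using inj_hom_same_dimension_bij[OF _ _ module_hom_restrict_scalars[OF A z] dims]
      restrict_scalars_module[OF A V] restrict_scalars_module[OF A W] K
    by (simp add: vectorspace_def)
  with z no_iso show False by (auto simp: module_iso_def)
qed

lemma tensor_copies_isomorphic:
  assumes L: "lie_module K L M" and fd: "vectorspace.fin_dim K M" and A: "algebra K A"
    and nontriv: "cohomologically_nontrivial K L M"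
    and inv: "lie_image K L M = carrier M \<or> \<not> has_trivial_submodule K L M"
    and V: "module A V" "has_dimension K (restrict_scalars A V) d"
    and W: "module A W" "has_dimension K (restrict_scalars A W) d"
    and cases: "has_dimension K (Hom_L K L M M) 1 \<or> (\<exists>e\<le>1. has_dimension K (Hom_A A V W) e)"
    and iso: "lie_module_iso K (current_algebra K L A) (tensor_copy K L M A V) (tensor_copy K L M A W)"
  shows "module_iso A V W"
proof -
  interpret V: lie_module_tensor K L M A V
    using L A V(1) by (simp add: lie_module_tensor_def)
  interpret W: lie_module_tensor K L M A W
    using L A W(1) by (simp add: lie_module_tensor_def)
  have fdV: "vectorspace.fin_dim K V.VK" and fdW: "vectorspace.fin_dim K W.VK"
    using V(2) W(2) by (auto simp: has_dimension_def)
  note VC = V.tensor_copy[OF fd fdV] and WC = W.tensor_copy[OF fd fdW]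
  have "lie_module_iso K V.LA.LA V.N W.N"
    using lie_module_iso_trans[OF VC(2) lie_module_iso_trans[OF iso]]
      lie_module_iso_sym[OF W.N_lie_module WC(1,2)] by blast
  then obtain F where F: "F \<in> lie_module_hom K V.LA.LA V.N W.N" "bij_betw F (carrier V.N) (carrier W.N)"
    by (auto simp: lie_module_iso_def)
  interpret tensor_iso K L M A V W F
    using F fd fdW inv
    by unfold_locales (auto simp: lie_module_hom_def module_hom_def bij_betw_def)
  obtain m where "m \<in> carrier M" "m \<noteq> \<zero>\<^bsub>M\<^esub>"
    using V.nontrivial_imp_nonzero[OF nontriv] .
  then show ?thesis using V(2) W(2) cases by (rule factors_isomorphic)
qed

theorem theorem1:
  fixes K :: "('k, 'x) ring_scheme"
    and L :: "('k, 'l) lie_alg"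
    and M :: "('k, 'l, 'm) lie_mod"
    and A :: "('k, 'a) module"
    and \<V> :: "('a, 'v) module set"
    and d :: nat
  assumes "field K"
    and "lie_algebra K L"
    and "lie_module K L M"
    and "vectorspace.fin_dim K M"
    and "cohomologically_nontrivial K L M"
    and "lie_image K L M = carrier M \<or> \<not> has_trivial_submodule K L M"
    and "algebra K A"
    and "infinite \<V>"
    and "\<forall>V\<in>\<V>. module A V \<and> has_dimension K (restrict_scalars A V) d"
    and "pairwise (\<lambda>V W. \<not> module_iso A V W) \<V>"
    and "has_dimension K (Hom_L K L M M) 1 \<or>
         (\<forall>V\<in>\<V>. \<forall>W\<in>\<V>. \<not> module_iso A V W \<longrightarrow> (\<exists>e\<le>1. has_dimension K (Hom_A A V W) e))"
  shows "\<exists>(n::nat) (\<N> :: ('k, ('l \<times> 'a \<Rightarrow> 'k) set, nat \<Rightarrow> 'k) lie_mod set).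
           infinite \<N> \<and>
           (\<forall>N\<in>\<N>. lie_module K (current_algebra K L A) N \<and>
                    has_dimension K N n \<and>
                    cohomologically_nontrivial K (current_algebra K L A) N) \<and>
           pairwise (\<lambda>N N'. \<not> lie_module_iso K (current_algebra K L A) N N') \<N>"
proof (intro exI conjI)
  let ?C = "\<lambda>V. tensor_copy K L M A V"
  let ?N = "?C ` \<V>"
  let ?n = "vectorspace.dim K M * d"
  have noniso: "\<not> lie_module_iso K (current_algebra K L A) (?C V) (?C W)"
    if VW: "V \<in> \<V>" "W \<in> \<V>" "V \<noteq> W" for V W
  proof
    assume iso: "lie_module_iso K (current_algebra K L A) (?C V) (?C W)"
    have no_iso: "\<not> module_iso A V W" using assms(10) VW by (auto simp: pairwise_def)
    have "has_dimension K (Hom_L K L M M) 1 \<or> (\<exists>e\<le>1. has_dimension K (Hom_A A V W) e)"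
      using assms(11) VW no_iso by blast
    then have "module_iso A V W"
      using assms(9) VW
      by (intro tensor_copies_isomorphic[OF assms(3,4,7,5,6) _ _ _ _ _ iso]) auto
    with no_iso show False by simp
  qed
  \<comment> \<open>The isomorphism class of the copy determines \<open>V\<close>, so in particular equal copies come from equal \<open>V\<close>, and the
  set of copies is infinite.\<close>
  have refl: "lie_module_iso K (current_algebra K L A) N N" for N :: "('k, ('l \<times> 'a \<Rightarrow> 'k) set, nat \<Rightarrow> 'k) lie_mod"
    unfolding lie_module_iso_def
    by (rule bexI[of _ "\<lambda>x. x"]) (auto simp: lie_module_hom_def module_hom_id bij_betw_def)
  have "inj_on ?C \<V>"
    using noniso refl by (intro inj_onI) metis
  with assms(8) show "infinite ?N" by (simp add: finite_image_iff)
  show "pairwise (\<lambda>N N'. \<not> lie_module_iso K (current_algebra K L A) N N') ?N"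
    using noniso by (auto simp: pairwise_def)
  show "\<forall>N\<in>?N. lie_module K (current_algebra K L A) N \<and> has_dimension K N ?n \<and>
      cohomologically_nontrivial K (current_algebra K L A) N"
  proof
    fix N assume "N \<in> ?N"
    then obtain V where V: "V \<in> \<V>" "N = ?C V" by blast
    \<comment> \<open>A second, non-isomorphic member of \<open>\<V>\<close> of the same dimension excludes \<open>V = 0\<close>.\<close>
    have "\<V> - {V} \<noteq> {}" using assms(8) by (metis finite.emptyI infinite_remove)
    then obtain W where W: "W \<in> \<V>" "W \<noteq> V" by blast
    have "\<not> module_iso A V W" using assms(10) V W by (auto simp: pairwise_def)
    then obtain v where v: "v \<in> carrier V" "v \<noteq> \<zero>\<^bsub>V\<^esub>"
      using nonisomorphic_imp_nonzero[OF assms(1,7), of V W d] assms(9) V W by blast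
    interpret V: lie_module_tensor K L M A V
      using assms(3,7,9) V by (simp add: lie_module_tensor_def)
    have fd: "vectorspace.fin_dim K V.VK" and dim: "vectorspace.dim K V.VK = d"
      using assms(9) V(1) by (auto simp: has_dimension_def)
    note C = V.tensor_copy[OF assms(4) fd]
    have "cohomologically_nontrivial K V.LA.LA N"
      unfolding V(2)
      by (rule cohomologically_nontrivial_iso[OF V.N_lie_module C(1,2) V.tensor_nontrivial[OF assms(5) fd v]])
    then show "lie_module K (current_algebra K L A) N \<and> has_dimension K N ?n \<and>
        cohomologically_nontrivial K (current_algebra K L A) N"
      using C V(2) dim by simp
  qed
qed

end
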